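(* Let $F$ be a field and let $A,B$ be semiassociative $F$-algebras. Then, under the identification $\mathfrak{N}(A\otimes_F B)=\mathfrak{N}(A)\otimes_F\mathfrak{N}(B)$, $$\mathrm{J}(\mathfrak{N}(A\otimes_F B))=\mathrm{J}(\mathfrak{N}(A))\otimes_F\mathfrak{N}(B)+\mathfrak{N}(A)\otimes_F\mathrm{J}(\mathfrak{N}(B)),$$ and thus $$\sigma(A\otimes_F B)\cong\sigma(A)\otimes_F\sigma(B).$$
   Context: Algebras are unital and not necessarily associative. The associator is $(x,y,z)=(xy)z-x(yz)$; the nucleus $\mathfrak{N}(A)$ is the set of $x\in A$ with $(x,A,A)=(A,x,A)=(A,A,x)=0$, an associative subalgebra; for all algebras $A,B$ over a field $F$, $\mathfrak{N}(A\otimes_F B)=\mathfrak{N}(A)\otimes_F\mathfrak{N}(B)$. $\mathrm{J}(\cdot)$ denotes the Jacobson radical of an associative algebra, and $\sigma(A)=\mathfrak{N}(A)/\mathrm{J}(\mathfrak{N}(A))$. The center is $Z(A)=\{x\in\mathfrak{N}(A):xa=ax\text{ for all }a\in A\}$; $A$ is $F$-central if $Z(A)=F$. An étale $F$-algebra is a finite direct product of finite separable field extensions of $F$. A module over an associative ring is minimally faithful if it is faithful and has no faithful proper section (quotient of submodules). A finite dimensional $F$-central algebra $A$ is semiassociative if there is an étale $F$-subalgebra $K\subseteq\mathfrak{N}(A)$ (containing $1_A$) such that $A$ is minimally faithful (equivalently, faithful and cyclic) as a $K\otimes_F K$-module via $(k\otimes k')a=kak'$. *)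

theory Defs
  imports
    "Jordan_Normal_Form.VS_Connect"
    "HOL-Algebra.QuotRing"
    "HOL-Library.Poly_Mapping"
    "HOL-Computational_Algebra.Polynomial"
begin

text \<open>
  The ground field is a type of class \<^class>\<open>field\<close>, regarded as the ring
  \<open>class_ring\<close>.  Algebras are \<open>module\<close> records over it; they are not assumed
  to be associative, so the \<^const>\<open>monoid.mult\<close> field carries no law unless one is stated.
\<close>

section \<open>Unital nonassociative algebras\<close>

locale unital_algebra = vectorspace class_ring A
  for A :: "('f::field, 'a) module" (structure) +
  assumes mult_closed: "\<lbrakk>x \<in> carrier A; y \<in> carrier A\<rbrakk> \<Longrightarrow> x \<otimes> y \<in> carrier A"
    and one_in_carrier: "\<one> \<in> carrier A"
    and one_mult: "x \<in> carrier A \<Longrightarrow> \<one> \<otimes> x = x"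
    and mult_one: "x \<in> carrier A \<Longrightarrow> x \<otimes> \<one> = x"
    and add_mult: "\<lbrakk>x \<in> carrier A; y \<in> carrier A; z \<in> carrier A\<rbrakk>
      \<Longrightarrow> (x \<oplus> y) \<otimes> z = x \<otimes> z \<oplus> y \<otimes> z"
    and mult_add: "\<lbrakk>x \<in> carrier A; y \<in> carrier A; z \<in> carrier A\<rbrakk>
      \<Longrightarrow> z \<otimes> (x \<oplus> y) = z \<otimes> x \<oplus> z \<otimes> y"
    and smult_mult: "\<lbrakk>x \<in> carrier A; y \<in> carrier A\<rbrakk> \<Longrightarrow> (c \<odot> x) \<otimes> y = c \<odot> (x \<otimes> y)"
    and mult_smult: "\<lbrakk>x \<in> carrier A; y \<in> carrier A\<rbrakk> \<Longrightarrow> x \<otimes> (c \<odot> y) = c \<odot> (x \<otimes> y)"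

definition alg_isomorphic :: "('f::field, 'a) module \<Rightarrow> ('f, 'b) module \<Rightarrow> bool" where
  "alg_isomorphic A B \<longleftrightarrow>
     (\<exists>h \<in> ring_iso A B. \<forall>c. \<forall>x \<in> carrier A. h (c \<odot>\<^bsub>A\<^esub> x) = c \<odot>\<^bsub>B\<^esub> h x)"

definition associator :: "('f, 'a) module \<Rightarrow> 'a \<Rightarrow> 'a \<Rightarrow> 'a \<Rightarrow> 'a" where
  "associator A x y z = (x \<otimes>\<^bsub>A\<^esub> y) \<otimes>\<^bsub>A\<^esub> z \<ominus>\<^bsub>A\<^esub> x \<otimes>\<^bsub>A\<^esub> (y \<otimes>\<^bsub>A\<^esub> z)"

definition nucleus :: "('f, 'a) module \<Rightarrow> 'a set" where
  "nucleus A = {x \<in> carrier A. \<forall>y \<in> carrier A. \<forall>z \<in> carrier A.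
     associator A x y z = \<zero>\<^bsub>A\<^esub> \<and> associator A y x z = \<zero>\<^bsub>A\<^esub> \<and> associator A y z x = \<zero>\<^bsub>A\<^esub>}"

definition nucleus_alg :: "('f, 'a) module \<Rightarrow> ('f, 'a) module" where
  "nucleus_alg A = A\<lparr>carrier := nucleus A\<rparr>"

definition alg_center :: "('f, 'a) module \<Rightarrow> 'a set" where
  "alg_center A = {x \<in> nucleus A. \<forall>a \<in> carrier A. x \<otimes>\<^bsub>A\<^esub> a = a \<otimes>\<^bsub>A\<^esub> x}"

text \<open>
  \<open>Z(A) = F\<close> means that the structure map \<open>c \<mapsto> c 1\<close> identifies \<open>F\<close> with the center;
  injectivity excludes the zero algebra.
\<close>
definition central :: "('f::field, 'a) module \<Rightarrow> bool" where
  "central A \<longleftrightarrow> bij_betw (\<lambda>c. c \<odot>\<^bsub>A\<^esub> \<one>\<^bsub>A\<^esub>) UNIV (alg_center A)"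

definition subalgebra_with_one :: "'a set \<Rightarrow> ('f::field, 'a) module \<Rightarrow> bool" where
  "subalgebra_with_one K A \<longleftrightarrow>
     Module.submodule K (class_ring :: 'f ring) A \<and> \<one>\<^bsub>A\<^esub> \<in> K \<and> (\<forall>x \<in> K. \<forall>y \<in> K. x \<otimes>\<^bsub>A\<^esub> y \<in> K)"


section \<open>Quotients and the Jacobson radical\<close>

text \<open>
  \<^const>\<open>FactRing\<close> with the induced scalar multiplication.  For an ideal closed under scalars
  this is the quotient algebra; for a submodule, forgetting the multiplication, the
  quotient module.
\<close>
definition quot_alg :: "('r, 'a) module \<Rightarrow> 'a set \<Rightarrow> ('r, 'a set) module" where
  "quot_alg A I =
     ring.extend (A Quot I) (module.fields (\<lambda>c X. \<Union>x\<in>X. I +>\<^bsub>A\<^esub> (c \<odot>\<^bsub>A\<^esub> x)))"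

definition left_ideal :: "'a set \<Rightarrow> ('a, 'm) ring_scheme \<Rightarrow> bool" where
  "left_ideal I R \<longleftrightarrow>
     additive_subgroup I R \<and> (\<forall>r \<in> carrier R. \<forall>x \<in> I. r \<otimes>\<^bsub>R\<^esub> x \<in> I)"

definition maximal_left_ideal :: "'a set \<Rightarrow> ('a, 'm) ring_scheme \<Rightarrow> bool" where
  "maximal_left_ideal I R \<longleftrightarrow> left_ideal I R \<and> I \<noteq> carrier R \<and>
     (\<forall>L. left_ideal L R \<and> I \<subseteq> L \<longrightarrow> L = I \<or> L = carrier R)"

definition jacobson_radical :: "('a, 'm) ring_scheme \<Rightarrow> 'a set" where
  "jacobson_radical R = carrier R \<inter> \<Inter>{I. maximal_left_ideal I R}"

definition sigma_alg :: "('f, 'a) module \<Rightarrow> ('f, 'a set) module" where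
  "sigma_alg A = quot_alg (nucleus_alg A) (jacobson_radical (nucleus_alg A))"


section \<open>Tensor products\<close>

text \<open>
  The vector space with basis \<open>carrier A \<times> carrier B\<close>, multiplied by bilinear extension of the
  componentwise product of basis elements.  The bilinearity relations span an ideal in it,
  and \<open>A \<otimes> B\<close> is the quotient.
\<close>
definition pair_alg ::
  "('f::field, 'a) module \<Rightarrow> ('f, 'b) module \<Rightarrow> ('f, ('a \<times> 'b) \<Rightarrow>\<^sub>0 'f) module" where
  "pair_alg A B =
     \<lparr>carrier = {f. Poly_Mapping.keys f \<subseteq> carrier A \<times> carrier B},
      mult = (\<lambda>f g. \<Sum>p \<in> Poly_Mapping.keys f. \<Sum>q \<in> Poly_Mapping.keys g.
        Poly_Mapping.single (fst p \<otimes>\<^bsub>A\<^esub> fst q, snd p \<otimes>\<^bsub>B\<^esub> snd q)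
          (Poly_Mapping.lookup f p * Poly_Mapping.lookup g q)),
      one = Poly_Mapping.single (\<one>\<^bsub>A\<^esub>, \<one>\<^bsub>B\<^esub>) 1,
      zero = 0,
      add = (+),
      smult = (\<lambda>c. Poly_Mapping.map ((*) c))\<rparr>"

definition bilinearity_relations ::
  "('f::field, 'a) module \<Rightarrow> ('f, 'b) module \<Rightarrow> (('a \<times> 'b) \<Rightarrow>\<^sub>0 'f) set" where
  "bilinearity_relations A B =
     {Poly_Mapping.single (x \<oplus>\<^bsub>A\<^esub> x', y) 1 - Poly_Mapping.single (x, y) 1
        - Poly_Mapping.single (x', y) 1 | x x' y.
        x \<in> carrier A \<and> x' \<in> carrier A \<and> y \<in> carrier B}
   \<union> {Poly_Mapping.single (x, y \<oplus>\<^bsub>B\<^esub> y') 1 - Poly_Mapping.single (x, y) 1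
        - Poly_Mapping.single (x, y') 1 | x y y'.
        x \<in> carrier A \<and> y \<in> carrier B \<and> y' \<in> carrier B}
   \<union> {Poly_Mapping.single (c \<odot>\<^bsub>A\<^esub> x, y) 1 - Poly_Mapping.single (x, y) c | c x y.
        x \<in> carrier A \<and> y \<in> carrier B}
   \<union> {Poly_Mapping.single (x, c \<odot>\<^bsub>B\<^esub> y) 1 - Poly_Mapping.single (x, y) c | c x y.
        x \<in> carrier A \<and> y \<in> carrier B}"

definition relation_space ::
  "('f::field, 'a) module \<Rightarrow> ('f, 'b) module \<Rightarrow> (('a \<times> 'b) \<Rightarrow>\<^sub>0 'f) set" where
  "relation_space A B =
     LinearCombinations.module.span class_ring (pair_alg A B) (bilinearity_relations A B)"

definition tensor_alg ::
  "('f::field, 'a) module \<Rightarrow> ('f, 'b) module \<Rightarrow> ('f, (('a \<times> 'b) \<Rightarrow>\<^sub>0 'f) set) module" where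
  "tensor_alg A B = quot_alg (pair_alg A B) (relation_space A B)"

definition pure_tensor ::
  "('f::field, 'a) module \<Rightarrow> ('f, 'b) module \<Rightarrow> 'a \<Rightarrow> 'b \<Rightarrow> (('a \<times> 'b) \<Rightarrow>\<^sub>0 'f) set" where
  "pure_tensor A B x y =
     relation_space A B +>\<^bsub>pair_alg A B\<^esub> Poly_Mapping.single (x, y) 1"

text \<open>
  For subspaces \<open>U\<close> of \<open>A\<close> and \<open>W\<close> of \<open>B\<close>, the tensor product \<open>U \<otimes> W\<close> as a subspace
  of \<open>A \<otimes> B\<close>: over a field the canonical map \<open>U \<otimes> W \<rightarrow> A \<otimes> B\<close> is injective,
  and this is its image.
\<close>
definition tensor_subspace ::
  "('f::field, 'a) module \<Rightarrow> ('f, 'b) module \<Rightarrow> 'a set \<Rightarrow> 'b set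
    \<Rightarrow> (('a \<times> 'b) \<Rightarrow>\<^sub>0 'f) set set" where
  "tensor_subspace A B U W =
     LinearCombinations.module.span class_ring (tensor_alg A B)
       {pure_tensor A B u w | u w. u \<in> U \<and> w \<in> W}"


section \<open>Etale algebras\<close>

definition alg_eval :: "('f::field, 'a) module \<Rightarrow> 'f poly \<Rightarrow> 'a \<Rightarrow> 'a" where
  "alg_eval E p x =
     (\<Oplus>\<^bsub>E\<^esub>i \<in> {..Polynomial.degree p}. poly.coeff p i \<odot>\<^bsub>E\<^esub> (x [^]\<^bsub>E\<^esub> i))"

definition is_minimal_polynomial :: "('f::field, 'a) module \<Rightarrow> 'a \<Rightarrow> 'f poly \<Rightarrow> bool" where
  "is_minimal_polynomial E x p \<longleftrightarrow>
     lead_coeff p = 1 \<and> (\<forall>q. alg_eval E q x = \<zero>\<^bsub>E\<^esub> \<longleftrightarrow> p dvd q)"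

definition separable_element :: "('f::field, 'a) module \<Rightarrow> 'a \<Rightarrow> bool" where
  "separable_element E x \<longleftrightarrow> (\<exists>p. is_minimal_polynomial E x p \<and> coprime p (pderiv p))"

definition finite_separable_extension :: "('f::field, 'a) module \<Rightarrow> bool" where
  "finite_separable_extension E \<longleftrightarrow>
     unital_algebra E \<and> field E \<and> vectorspace.fin_dim class_ring E \<and>
     (\<forall>x \<in> carrier E. separable_element E x)"

definition product_alg :: "nat \<Rightarrow> (nat \<Rightarrow> ('f, 'a) module) \<Rightarrow> ('f, nat \<Rightarrow> 'a) module" where
  "product_alg n E =
     \<lparr>carrier = (\<Pi>\<^sub>E i\<in>{..<n}. carrier (E i)),
      mult = (\<lambda>f g. \<lambda>i\<in>{..<n}. f i \<otimes>\<^bsub>E i\<^esub> g i),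
      one = (\<lambda>i\<in>{..<n}. \<one>\<^bsub>E i\<^esub>),
      zero = (\<lambda>i\<in>{..<n}. \<zero>\<^bsub>E i\<^esub>),
      add = (\<lambda>f g. \<lambda>i\<in>{..<n}. f i \<oplus>\<^bsub>E i\<^esub> g i),
      smult = (\<lambda>c f. \<lambda>i\<in>{..<n}. c \<odot>\<^bsub>E i\<^esub> f i)\<rparr>"

text \<open>
  Taking the factors over the element type of \<open>K\<close> loses nothing, since each factor of
  \<open>K\<close> is isomorphic to an ideal of \<open>K\<close>.
\<close>
definition etale :: "('f::field, 'a) module \<Rightarrow> bool" where
  "etale K \<longleftrightarrow>
     (\<exists>n (E :: nat \<Rightarrow> ('f, 'a) module).
        (\<forall>i<n. finite_separable_extension (E i)) \<and> alg_isomorphic K (product_alg n E))"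


section \<open>Semiassociative algebras\<close>

definition faithful_module :: "('r, 'm) ring_scheme \<Rightarrow> ('r, 'a) module \<Rightarrow> bool" where
  "faithful_module R M \<longleftrightarrow>
     (\<forall>r \<in> carrier R. (\<forall>x \<in> carrier M. r \<odot>\<^bsub>M\<^esub> x = \<zero>\<^bsub>M\<^esub>) \<longrightarrow> r = \<zero>\<^bsub>R\<^esub>)"

text \<open>A section is a quotient \<open>P/Q\<close> of submodules; it is proper unless \<open>P = M\<close> and \<open>Q = 0\<close>.\<close>
definition minimally_faithful :: "('r, 'm) ring_scheme \<Rightarrow> ('r, 'a) module \<Rightarrow> bool" where
  "minimally_faithful R M \<longleftrightarrow> faithful_module R M \<and>
     (\<forall>P Q. Module.submodule P R M \<and> Module.submodule Q R M \<and> Q \<subseteq> P \<and>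
        \<not> (P = carrier M \<and> Q = {\<zero>\<^bsub>M\<^esub>})
        \<longrightarrow> \<not> faithful_module R (quot_alg (M\<lparr>carrier := P\<rparr>) Q))"

text \<open>
  \<open>A\<close> as a module over \<open>K \<otimes> K\<close> via \<open>(k \<otimes> k') a = k a k'\<close>.  An element of \<open>K \<otimes> K\<close> is a
  coset; the action is computed on any representative, the value being independent of the
  choice.  The multiplication and unit of the record are inherited from \<open>A\<close> and irrelevant.
\<close>
definition bimodule_action ::
  "('f::field, 'a) module \<Rightarrow> (('a \<times> 'a) \<Rightarrow>\<^sub>0 'f) set \<Rightarrow> 'a \<Rightarrow> 'a" where
  "bimodule_action A t a =
     (let f = (SOME f. f \<in> t) in
      \<Oplus>\<^bsub>A\<^esub>p \<in> Poly_Mapping.keys f.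
        Poly_Mapping.lookup f p \<odot>\<^bsub>A\<^esub> ((fst p \<otimes>\<^bsub>A\<^esub> a) \<otimes>\<^bsub>A\<^esub> snd p))"

definition bimodule ::
  "('f::field, 'a) module \<Rightarrow> ((('a \<times> 'a) \<Rightarrow>\<^sub>0 'f) set, 'a) module" where
  "bimodule A =
     \<lparr>carrier = carrier A, mult = mult A, one = \<one>\<^bsub>A\<^esub>, zero = \<zero>\<^bsub>A\<^esub>, add = add A,
      smult = bimodule_action A\<rparr>"

definition semiassociative :: "('f::field, 'a) module \<Rightarrow> bool" where
  "semiassociative A \<longleftrightarrow>
     unital_algebra A \<and> vectorspace.fin_dim class_ring A \<and> central A \<and>
     (\<exists>K. K \<subseteq> nucleus A \<and> subalgebra_with_one K A \<and> etale (A\<lparr>carrier := K\<rparr>) \<and>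
        minimally_faithful (tensor_alg (A\<lparr>carrier := K\<rparr>) (A\<lparr>carrier := K\<rparr>)) (bimodule A))"

end

theory Submission
  imports Defs
begin

text \<open>
  An etale subalgebra \<open>K\<close> carries a separability idempotent \<open>\<Sum> a\<^sub>i \<otimes> b\<^sub>i\<close>, that is,
  \<open>\<Sum> a\<^sub>i b\<^sub>i = 1\<close> and \<open>\<Sum> c a\<^sub>i \<otimes> b\<^sub>i = \<Sum> a\<^sub>i \<otimes> b\<^sub>i c\<close> for \<open>c \<in> K\<close>.  The averaging map
  \<open>\<pi>(z) = \<Sum> a\<^sub>i z b\<^sub>i\<close> projects \<open>A\<close> onto the centralizer of \<open>K\<close>, which is \<open>K\<close> itself by minimal
  faithfulness.  This gives a description of the radical of the nucleus \<open>N\<close> by equations: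
  \<open>J(N) = {x. \<pi>(y x z) = 0 for all y, z \<in> N}\<close>.  Indeed \<open>J(N) \<inter> K = 0\<close> by a Maschke argument,
  which gives one inclusion; conversely, if a two-sided ideal \<open>I\<close> with \<open>\<pi>(I) = 0\<close> were not
  contained in a maximal left ideal \<open>M\<close>, the density argument would give \<open>z \<in> I\<close> with
  \<open>(1 - z) b\<^sub>i \<in> M\<close> for all \<open>i\<close>, and then \<open>1 = \<Sum> a\<^sub>i (1 - z) b\<^sub>i \<in> M\<close>.  The same description applies
  to \<open>N \<otimes> N'\<close> with the tensor product of the two idempotents, and linear algebra turns it
  into \<open>J(N) \<otimes> N' + N \<otimes> J(N')\<close>.

  Algebras are transported to subspaces of finitely supported functions, with a multiplication
  that is bilinear on all functions; there the tensor product consists of functions on pairs,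
  and membership in \<open>U \<otimes> W\<close> is tested on rows and columns.
\<close>

section \<open>Linear algebra on finitely supported functions\<close>

text \<open>The formula is false for general algebras over an imperfect field: a tensor product of
  inseparable field extensions can have a nonzero radical. So the etale subalgebra must be used, and
  it enters through \<open>separating\<close> and \<open>avg\<close>. Maximal left ideals, which
  define the radical, give no hold on a tensor product, since those of the factors do not determine
  those of the product. Equations do: they say that a family of linear maps vanishes, the family for
  the product consists of tensor products of the maps for the factors, and
  \<open>tensor_kernel\<close> computes such common kernels. The separability idempotent is built
  without a primitive element, as a product over finitely many spanning elements, each contributing
  an explicit factor from a polynomial prime to its derivative. For the isomorphism, quotients by
  radicals are modelled on complements inside the same function spaces, so that both sides turn out
  to have literally the same model.\<close>

abbreviation lookup :: "('i \<Rightarrow>\<^sub>0 'f::zero) \<Rightarrow> 'i \<Rightarrow> 'f" where "lookup \<equiv> Poly_Mapping.lookup"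
abbreviation keys :: "('i \<Rightarrow>\<^sub>0 'f::zero) \<Rightarrow> 'i set" where "keys \<equiv> Poly_Mapping.keys"

text \<open>The same expression as the scalar multiplication of \<open>pair_alg\<close>, so that the
  record of formal pairs is its own model.\<close>

definition scl :: "'f::field \<Rightarrow> ('i \<Rightarrow>\<^sub>0 'f) \<Rightarrow> ('i \<Rightarrow>\<^sub>0 'f)" where
  "scl c = Poly_Mapping.map ((*) c)"

lemma lookup_scl [simp]: "lookup (scl c u) i = c * lookup u i"
  unfolding scl_def by transfer (simp add: when_def)

interpretation V: vector_space "scl :: 'f::field \<Rightarrow> ('i \<Rightarrow>\<^sub>0 'f) \<Rightarrow> ('i \<Rightarrow>\<^sub>0 'f)"
  by unfold_locales (auto intro!: poly_mapping_eqI simp: lookup_add algebra_simps)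

abbreviation lin :: "(('i \<Rightarrow>\<^sub>0 'f::field) \<Rightarrow> ('j \<Rightarrow>\<^sub>0 'f)) \<Rightarrow> bool" where
  "lin \<equiv> Vector_Spaces.linear scl scl"

interpretation VV: vector_space_pair "scl :: 'f::field \<Rightarrow> ('i \<Rightarrow>\<^sub>0 'f) \<Rightarrow> ('i \<Rightarrow>\<^sub>0 'f)"
  "scl :: 'f::field \<Rightarrow> ('j \<Rightarrow>\<^sub>0 'f) \<Rightarrow> ('j \<Rightarrow>\<^sub>0 'f)"
  by unfold_locales

lemma linI:
  assumes "\<And>x y. f (x + y) = f x + f y" "\<And>c x. f (scl c x) = scl c (f x)"
  shows "lin f"
  by (intro Vector_Spaces.linear.intro module_hom.intro module_hom_axioms.intro V.vector_space_axioms
      V.module_axioms assms)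

lemma lin_hom: "lin f \<Longrightarrow> Modules.module_hom scl scl f"
  by (simp add: Vector_Spaces.linear_def)

lemmas lin_add = Modules.module_hom.add[OF lin_hom]
  and lin_scl = Modules.module_hom.scale[OF lin_hom]
  and lin_0 = Modules.module_hom.zero[OF lin_hom]
  and lin_diff = Modules.module_hom.diff[OF lin_hom]
  and lin_sum = Modules.module_hom.sum[OF lin_hom]
  and lin_vimage = Modules.module_hom.subspace_linear_preimage[OF lin_hom]
  and lin_image = Modules.module_hom.subspace_image[OF lin_hom]
  and lin_kernel = Modules.module_hom.subspace_kernel[OF lin_hom]

lemma lin_comp: "lin f \<Longrightarrow> lin g \<Longrightarrow> lin (\<lambda>x. f (g x))"
  by (rule linI) (simp_all add: lin_add lin_scl)

lemma lin_ident: "lin (\<lambda>x. x)" by (rule linI) simp_all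

lemma lin_zero: "lin (\<lambda>x. 0)" by (rule linI) simp_all

lemma lin_minus: "lin f \<Longrightarrow> lin g \<Longrightarrow> lin (\<lambda>x. f x - g x)"
  by (rule linI) (simp_all add: lin_add lin_scl V.scale_right_diff_distrib)

lemma lin_plus: "lin f \<Longrightarrow> lin g \<Longrightarrow> lin (\<lambda>x. f x + g x)"
  by (rule linI) (simp_all add: lin_add lin_scl V.scale_right_distrib)

lemma lin_scale: "lin f \<Longrightarrow> lin (\<lambda>x. scl c (f x))"
  by (rule linI) (simp_all add: lin_add lin_scl V.scale_right_distrib mult.commute)

lemma lin_setsum: "(\<And>i. i \<in> S \<Longrightarrow> lin (f i)) \<Longrightarrow> lin (\<lambda>x. \<Sum>i\<in>S. f i x)"
  by (induction S rule: infinite_finite_induct) (auto simp: lin_zero intro: lin_plus)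

text \<open>\<open>p\<close> is a left inverse of the inclusion of \<open>S\<close>, which exists in
  every dimension. Projectors on the whole function space stand in for complements and for maps
  given only on a subspace.\<close>

lemma exists_projector:
  fixes S :: "('i \<Rightarrow>\<^sub>0 'f::field) set"
  assumes "V.subspace S"
  obtains p where "lin p" "\<And>x. p x \<in> S" "\<And>x. x \<in> S \<Longrightarrow> p x = x"
  using VV.linear_exists_left_inverse_on[OF lin_ident assms]
  by (auto simp: inj_on_def image_subset_iff)

abbreviation sgl :: "'i \<Rightarrow> ('i \<Rightarrow>\<^sub>0 'f::field)" where "sgl i \<equiv> Poly_Mapping.single i 1"

lemma single_scl: "Poly_Mapping.single i c = scl c (sgl i)"
  by (rule poly_mapping_eqI) (simp add: lookup_single when_def)

lemma sum_keys_superset: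
  fixes u :: "'i \<Rightarrow>\<^sub>0 'f::field"
  assumes "finite S" "keys u \<subseteq> S"
  shows "(\<Sum>k\<in>keys u. scl (lookup u k) (F k)) = (\<Sum>k\<in>S. scl (lookup u k) (F k))"
  using assms by (intro sum.mono_neutral_left) (auto simp: in_keys_iff)

lemma pm_expand:
  fixes u :: "'i \<Rightarrow>\<^sub>0 'f::field"
  shows "u = (\<Sum>k\<in>keys u. scl (lookup u k) (sgl k))"
proof (rule poly_mapping_eqI)
  fix i
  have "(\<Sum>k\<in>keys u. lookup u k * (1 when k = i)) = (\<Sum>k\<in>keys u. if k = i then lookup u i else 0)"
    by (rule sum.cong) (auto simp: when_def)
  then show "lookup u i = lookup (\<Sum>k\<in>keys u. scl (lookup u k) (sgl k)) i"
    by (simp add: lookup_sum lookup_single in_keys_iff)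
qed

text \<open>The free extension of values prescribed on the basis \<open>sgl i\<close>. By
  \<open>lin_expand\<close> every linear map has this form, which is why identities are tested on
  \<open>sgl\<close> only.\<close>

definition lext :: "('i \<Rightarrow> ('j \<Rightarrow>\<^sub>0 'f::field)) \<Rightarrow> ('i \<Rightarrow>\<^sub>0 'f) \<Rightarrow> ('j \<Rightarrow>\<^sub>0 'f)" where
  "lext F u = (\<Sum>k\<in>keys u. scl (lookup u k) (F k))"

lemma lext_superset: "finite S \<Longrightarrow> keys u \<subseteq> S \<Longrightarrow> lext F u = (\<Sum>k\<in>S. scl (lookup u k) (F k))"
  unfolding lext_def by (rule sum_keys_superset)

lemma lin_lext:
  fixes F :: "'a \<Rightarrow> ('c \<Rightarrow>\<^sub>0 'b::field)"
  shows "lin (lext F)"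
proof (rule linI)
  fix x y :: "'a \<Rightarrow>\<^sub>0 'b" and c
  \<comment> \<open>Cancellation can shrink the support of the sum, so all three sums are taken over
    one finite superset.\<close>
  let ?S = "keys x \<union> keys y"
  have "lext F (x + y) = (\<Sum>k\<in>?S. scl (lookup (x + y) k) (F k))"
    by (rule lext_superset) (auto dest: subsetD[OF Poly_Mapping.keys_add])
  also have "\<dots> = lext F x + lext F y"
    by (subst (1 2) lext_superset[of ?S]) (auto simp: lookup_add V.scale_left_distrib sum.distrib)
  finally show "lext F (x + y) = lext F x + lext F y" .
  have "lext F (scl c x) = (\<Sum>k\<in>keys x. scl (lookup (scl c x) k) (F k))"
    by (rule lext_superset) (auto simp: in_keys_iff)
  then show "lext F (scl c x) = scl c (lext F x)"
    by (simp add: lext_def V.scale_sum_right)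
qed

lemma lext_sgl [simp]: "lext F (sgl i) = F i"
  by (simp add: lext_def)

lemma lin_lext_param: "(\<And>p. lin (\<lambda>u. G u p)) \<Longrightarrow> lin (\<lambda>u. lext (G u) v)"
  unfolding lext_def by (intro lin_setsum lin_scale)

lemma lin_expand: "lin f \<Longrightarrow> f u = lext (\<lambda>k. f (sgl k)) u"
  by (subst pm_expand) (simp only: lin_sum lin_scl lext_def)

lemma lin_eqI: "lin f \<Longrightarrow> lin g \<Longrightarrow> (\<And>i. f (sgl i) = g (sgl i)) \<Longrightarrow> f u = g u"
  using lin_expand[of f u] lin_expand[of g u] by simp

definition blin :: "(('i \<Rightarrow>\<^sub>0 'f::field) \<Rightarrow> ('j \<Rightarrow>\<^sub>0 'f) \<Rightarrow> ('k \<Rightarrow>\<^sub>0 'f)) \<Rightarrow> bool" where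
  "blin m \<longleftrightarrow> (\<forall>x. lin (m x)) \<and> (\<forall>y. lin (\<lambda>x. m x y))"

lemma blinD: "blin m \<Longrightarrow> lin (m x)" "blin m \<Longrightarrow> lin (\<lambda>x. m x y)"
  by (simp_all add: blin_def)

lemma blin_eqI:
  assumes "blin f" "blin g" "\<And>i j. f (sgl i) (sgl j) = g (sgl i) (sgl j)"
  shows "f u v = g u v"
proof -
  have "f (sgl i) v = g (sgl i) v" for i
    by (rule lin_eqI[OF blinD(1) blinD(1)]) (use assms in auto)
  then show ?thesis
    by (rule lin_eqI[OF blinD(2)[OF assms(1)] blinD(2)[OF assms(2)]])
qed


section \<open>Tensors as functions on pairs\<close>

definition tens :: "('i \<Rightarrow>\<^sub>0 'f::field) \<Rightarrow> ('j \<Rightarrow>\<^sub>0 'f) \<Rightarrow> ('i \<times> 'j \<Rightarrow>\<^sub>0 'f)" where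
  "tens x y = Abs_poly_mapping (\<lambda>p. lookup x (fst p) * lookup y (snd p))"

lemma lookup_tens [simp]: "lookup (tens x y) p = lookup x (fst p) * lookup y (snd p)"
proof -
  have "finite {p. lookup x (fst p) * lookup y (snd p) \<noteq> 0}"
    by (rule finite_subset[of _ "keys x \<times> keys y"]) (auto simp: in_keys_iff mem_Times_iff)
  then show ?thesis by (simp add: tens_def)
qed

lemma blin_tens: "blin tens"
  unfolding blin_def
  by (intro conjI allI linI poly_mapping_eqI) (auto simp: lookup_add algebra_simps)

lemma tens_sgl: "tens (sgl i) (sgl j) = sgl (i, j)"
  by (rule poly_mapping_eqI) (auto simp: lookup_single when_def)

lemmas lin_tens = blinD[OF blin_tens]

text \<open>In tensor terms this contracts the first factor with the coordinate functional at
  \<open>i\<close>; \<open>cslice\<close> does so in the second. Hence slices commute with maps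
  acting on the other factor, and a tensor vanishes if all its rows do.\<close>

definition rslice :: "'i \<Rightarrow> ('i \<times> 'j \<Rightarrow>\<^sub>0 'f::field) \<Rightarrow> ('j \<Rightarrow>\<^sub>0 'f)" where
  "rslice i = Poly_Mapping.map_key (Pair i)"

definition cslice :: "'j \<Rightarrow> ('i \<times> 'j \<Rightarrow>\<^sub>0 'f::field) \<Rightarrow> ('i \<Rightarrow>\<^sub>0 'f)" where
  "cslice j = Poly_Mapping.map_key (\<lambda>i. (i, j))"

lemma lookup_rslice [simp]: "lookup (rslice i u) j = lookup u (i, j)"
  by (simp add: rslice_def map_key.rep_eq inj_on_def)

lemma lookup_cslice [simp]: "lookup (cslice j u) i = lookup u (i, j)"
  by (simp add: cslice_def map_key.rep_eq inj_on_def)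

lemma lin_rslice: "lin (rslice i)" and lin_cslice: "lin (cslice j)"
  by (auto intro!: linI poly_mapping_eqI simp: lookup_add)

lemma rslice_tens: "rslice i (tens x y) = scl (lookup x i) y"
  and cslice_tens: "cslice j (tens x y) = scl (lookup y j) x"
  by (auto intro!: poly_mapping_eqI simp: mult.commute)

lemma rslice_eqI: "(\<And>i. rslice i u = rslice i v) \<Longrightarrow> u = v"
  by (rule poly_mapping_eqI) (metis lookup_rslice prod.collapse)

lemma cslice_eqI: "(\<And>i. cslice i u = cslice i v) \<Longrightarrow> u = v"
  by (rule poly_mapping_eqI) (metis lookup_cslice prod.collapse)

section \<open>Tensor products of linear and bilinear maps\<close>

definition tmap :: "(('i \<Rightarrow>\<^sub>0 'f::field) \<Rightarrow> ('k \<Rightarrow>\<^sub>0 'f)) \<Rightarrow> (('j \<Rightarrow>\<^sub>0 'f) \<Rightarrow> ('l \<Rightarrow>\<^sub>0 'f))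
    \<Rightarrow> ('i \<times> 'j \<Rightarrow>\<^sub>0 'f) \<Rightarrow> ('k \<times> 'l \<Rightarrow>\<^sub>0 'f)" where
  "tmap f g = lext (\<lambda>p. tens (f (sgl (fst p))) (g (sgl (snd p))))"

lemma lin_tmap: "lin (tmap f g)"
  unfolding tmap_def by (rule lin_lext)

lemma blin_comp2:
  assumes "blin m" "lin f" "lin g" shows "blin (\<lambda>x y. m (f x) (g y))"
  unfolding blin_def
  using lin_comp[OF blinD(1)[OF assms(1)] assms(3)] lin_comp[OF blinD(2)[OF assms(1)] assms(2)] by auto

lemma blin_lin_comp:
  assumes "lin h" "blin m" shows "blin (\<lambda>x y. h (m x y))"
  unfolding blin_def
  using lin_comp[OF assms(1) blinD(1)[OF assms(2)]] lin_comp[OF assms(1) blinD(2)[OF assms(2)]] by auto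

lemma tmap_tens:
  assumes "lin f" "lin g" shows "tmap f g (tens x y) = tens (f x) (g y)"
  by (rule blin_eqI[OF blin_lin_comp[OF lin_tmap blin_tens] blin_comp2[OF blin_tens assms]])
    (simp add: tens_sgl tmap_def)

lemma tens_lin_eqI:
  assumes "lin f" "lin g" "\<And>x y. f (tens x y) = g (tens x y)"
  shows "f u = g u"
  by (rule lin_eqI[OF assms(1,2)]) (metis assms(3) tens_sgl surj_pair)

lemma tmap_comp:
  assumes "lin f" "lin g" "lin f'" "lin g'"
  shows "tmap f g (tmap f' g' u) = tmap (\<lambda>x. f (f' x)) (\<lambda>x. g (g' x)) u"
  by (rule tens_lin_eqI[OF lin_comp[OF lin_tmap lin_tmap] lin_tmap])
    (simp add: tmap_tens assms lin_comp[OF assms(1,3)] lin_comp[OF assms(2,4)])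

lemma rslice_tmap_snd:
  assumes "lin g" shows "rslice i (tmap (\<lambda>x. x) g u) = g (rslice i u)"
  by (rule tens_lin_eqI[OF lin_comp[OF lin_rslice lin_tmap] lin_comp[OF assms lin_rslice]])
    (simp add: tmap_tens assms lin_ident rslice_tens lin_scl)

lemma cslice_tmap_fst:
  assumes "lin f" shows "cslice i (tmap f (\<lambda>x. x) u) = f (cslice i u)"
  by (rule tens_lin_eqI[OF lin_comp[OF lin_cslice lin_tmap] lin_comp[OF assms lin_cslice]])
    (simp add: tmap_tens assms lin_ident cslice_tens lin_scl)

definition tmul :: "(('i \<Rightarrow>\<^sub>0 'f::field) \<Rightarrow> ('i' \<Rightarrow>\<^sub>0 'f) \<Rightarrow> ('k \<Rightarrow>\<^sub>0 'f))
    \<Rightarrow> (('j \<Rightarrow>\<^sub>0 'f) \<Rightarrow> ('j' \<Rightarrow>\<^sub>0 'f) \<Rightarrow> ('l \<Rightarrow>\<^sub>0 'f))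
    \<Rightarrow> ('i \<times> 'j \<Rightarrow>\<^sub>0 'f) \<Rightarrow> ('i' \<times> 'j' \<Rightarrow>\<^sub>0 'f) \<Rightarrow> ('k \<times> 'l \<Rightarrow>\<^sub>0 'f)" where
  "tmul m n u v = lext (\<lambda>p. tmap (m (sgl (fst p))) (n (sgl (snd p))) v) u"

lemma blin_tmul: "blin (tmul m n)"
  unfolding blin_def tmul_def by (auto intro: lin_lext lin_lext_param lin_tmap)

lemma tmul_tens:
  assumes "blin m" "blin n"
  shows "tmul m n (tens x y) (tens x' y') = tens (m x x') (n y y')"
  by (rule blin_eqI[OF blin_lin_comp[OF blinD(2)[OF blin_tmul] blin_tens]
        blin_comp2[OF blin_tens blinD(2)[OF assms(1)] blinD(2)[OF assms(2)]]])
    (simp add: tens_sgl tmul_def tmap_tens blinD[OF assms(1)] blinD[OF assms(2)])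

section \<open>Tensor products of subspaces\<close>

definition TS :: "('i \<Rightarrow>\<^sub>0 'f::field) set \<Rightarrow> ('j \<Rightarrow>\<^sub>0 'f) set \<Rightarrow> ('i \<times> 'j \<Rightarrow>\<^sub>0 'f) set" where
  "TS U W = {u. (\<forall>j. cslice j u \<in> U) \<and> (\<forall>i. rslice i u \<in> W)}"

lemma tens_in_TS: "V.subspace U \<Longrightarrow> V.subspace W \<Longrightarrow> x \<in> U \<Longrightarrow> y \<in> W \<Longrightarrow> tens x y \<in> TS U W"
  by (simp add: TS_def rslice_tens cslice_tens V.subspace_scale)

lemma subspace_TS:
  assumes "V.subspace U" "V.subspace W" shows "V.subspace (TS U W)"
  by (rule V.subspaceI)
    (auto simp: TS_def lin_0[OF lin_rslice] lin_0[OF lin_cslice] lin_add[OF lin_rslice] lin_add[OF lin_cslice]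
      lin_scl[OF lin_rslice] lin_scl[OF lin_cslice] V.subspace_0 V.subspace_add V.subspace_scale assms)

lemma TS_mono: "U \<subseteq> U' \<Longrightarrow> W \<subseteq> W' \<Longrightarrow> TS U W \<subseteq> TS U' W'"
  by (auto simp: TS_def)

text \<open>Columns in \<open>U\<close> mean that \<open>u\<close> is fixed by the projector
  \<open>p\<close> onto \<open>U\<close> on the first factor, rows in \<open>W\<close> that it is
  fixed by \<open>q\<close> on the second. So \<open>u\<close> is fixed by both at once, and the
  values of \<open>tmap p q\<close> are visibly sums of tensors from \<open>U\<close> and
  \<open>W\<close>.\<close>

lemma TS_eq_span:
  assumes "V.subspace U" "V.subspace W"
  shows "TS U W = V.span {tens x y | x y. x \<in> U \<and> y \<in> W}"
proof
  show "V.span {tens x y | x y. x \<in> U \<and> y \<in> W} \<subseteq> TS U W"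
    using assms by (intro V.span_minimal subspace_TS) (auto intro: tens_in_TS)
  obtain p where p: "lin p" "\<And>x. p x \<in> U" "\<And>x. x \<in> U \<Longrightarrow> p x = x"
    using exists_projector[OF assms(1)] by blast
  obtain q where q: "lin q" "\<And>x. q x \<in> W" "\<And>x. x \<in> W \<Longrightarrow> q x = x"
    using exists_projector[OF assms(2)] by blast
  show "TS U W \<subseteq> V.span {tens x y | x y. x \<in> U \<and> y \<in> W}"
  proof
    fix u assume u: "u \<in> TS U W"
    have "tmap p (\<lambda>x. x) u = u"
      by (rule cslice_eqI) (use u p in \<open>simp add: cslice_tmap_fst TS_def\<close>)
    moreover have "tmap (\<lambda>x. x) q u = u"
      by (rule rslice_eqI) (use u q in \<open>simp add: rslice_tmap_snd TS_def\<close>)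
    ultimately have "u = tmap p (\<lambda>x. x) (tmap (\<lambda>x. x) q u)" by simp
    also have "\<dots> = tmap p q u" by (simp add: tmap_comp p q lin_ident)
    also have "\<dots> \<in> V.span {tens x y | x y. x \<in> U \<and> y \<in> W}"
      unfolding tmap_def lext_def using p q
      by (intro V.span_sum V.span_scale V.span_base) (use p q in blast)
    finally show "u \<in> V.span {tens x y | x y. x \<in> U \<and> y \<in> W}" .
  qed
qed

text \<open>The property is passed as a set \<open>P\<close>, so that its linearity is the single
  condition \<open>V.subspace P\<close>.\<close>

lemma TS_induct [consumes 1, case_names subspaces tens]:
  assumes "u \<in> TS U W" "V.subspace U \<and> V.subspace W \<and> V.subspace P"
    "\<And>x y. x \<in> U \<Longrightarrow> y \<in> W \<Longrightarrow> tens x y \<in> P"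
  shows "u \<in> P"
proof -
  have "V.span {tens x y | x y. x \<in> U \<and> y \<in> W} \<subseteq> P"
    using assms by (intro V.span_minimal) auto
  then show ?thesis using assms TS_eq_span by blast
qed

lemma TS_linear_eq:
  assumes "u \<in> TS U W" "V.subspace U" "V.subspace W" "lin f" "lin g"
    "\<And>x y. x \<in> U \<Longrightarrow> y \<in> W \<Longrightarrow> f (tens x y) = g (tens x y)"
  shows "f u = g u"
proof -
  have "u \<in> {u. f u - g u = 0}"
    using assms(1) by (rule TS_induct) (use assms lin_kernel[OF lin_minus[OF assms(4,5)]] in auto)
  then show ?thesis by simp
qed

lemma tmap_TS:
  assumes "u \<in> TS U W" "V.subspace U" "V.subspace W" "V.subspace U'" "V.subspace W'" "lin f" "lin g"
    "\<And>x. x \<in> U \<Longrightarrow> f x \<in> U'" "\<And>y. y \<in> W \<Longrightarrow> g y \<in> W'"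
  shows "tmap f g u \<in> TS U' W'"
proof -
  have "u \<in> {u. tmap f g u \<in> TS U' W'}"
    using assms(1) by (rule TS_induct)
      (use assms in \<open>auto intro!: lin_vimage lin_tmap subspace_TS tens_in_TS simp: tmap_tens\<close>)
  then show ?thesis by simp
qed

lemma tmap_image_TS:
  assumes "V.subspace U" "V.subspace W" "lin f" "lin g"
  shows "tmap f g ` TS U W = TS (f ` U) (g ` W)"
proof
  show "tmap f g ` TS U W \<subseteq> TS (f ` U) (g ` W)"
    using assms by (auto intro!: tmap_TS lin_image)
  have "V.span {tens x y | x y. x \<in> f ` U \<and> y \<in> g ` W} \<subseteq> tmap f g ` TS U W"
  proof (rule V.span_minimal)
    show "{tens x y | x y. x \<in> f ` U \<and> y \<in> g ` W} \<subseteq> tmap f g ` TS U W"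
    proof safe
      fix x y assume "x \<in> U" "y \<in> W"
      then show "tens (f x) (g y) \<in> tmap f g ` TS U W"
        using assms by (intro image_eqI[of _ _ "tens x y"]) (auto simp: tmap_tens tens_in_TS)
    qed
  qed (use assms in \<open>auto intro!: lin_image lin_tmap subspace_TS\<close>)
  then show "TS (f ` U) (g ` W) \<subseteq> tmap f g ` TS U W"
    using assms by (simp add: TS_eq_span lin_image)
qed

lemma tmul_closed:
  assumes bl: "blin m" "blin n" and s: "V.subspace U" "V.subspace W"
    and cl: "\<And>x y. x \<in> U \<Longrightarrow> y \<in> U \<Longrightarrow> m x y \<in> U" "\<And>x y. x \<in> W \<Longrightarrow> y \<in> W \<Longrightarrow> n x y \<in> W"
    and u: "u \<in> TS U W" and v: "v \<in> TS U W"
  shows "tmul m n u v \<in> TS U W"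
proof -
  note l = lin_vimage[OF blinD(1)[OF blin_tmul] subspace_TS[OF s]] lin_vimage[OF blinD(2)[OF blin_tmul] subspace_TS[OF s]]
  have "u \<in> {u. tmul m n u v \<in> TS U W}"
    using u
  proof (rule TS_induct)
    fix x y assume xy: "x \<in> U" "y \<in> W"
    have "v \<in> {v. tmul m n (tens x y) v \<in> TS U W}"
      using v by (rule TS_induct) (use xy s l in \<open>auto intro!: tens_in_TS cl simp: tmul_tens[OF bl]\<close>)
    then show "tens x y \<in> {u. tmul m n u v \<in> TS U W}" by simp
  qed (use s l in auto)
  then show ?thesis by simp
qed

section \<open>Sums of subspaces and common kernels of tensored maps\<close>

definition ssum :: "('i \<Rightarrow>\<^sub>0 'f::field) set \<Rightarrow> ('i \<Rightarrow>\<^sub>0 'f) set \<Rightarrow> ('i \<Rightarrow>\<^sub>0 'f) set" where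
  "ssum U W = {x + y | x y. x \<in> U \<and> y \<in> W}"

lemma subspace_ssum: "V.subspace U \<Longrightarrow> V.subspace W \<Longrightarrow> V.subspace (ssum U W)"
  unfolding ssum_def by (rule V.subspace_sums)

lemma ssum_base:
  assumes "V.subspace U" "V.subspace W"
  shows "x \<in> U \<Longrightarrow> x \<in> ssum U W" "x \<in> W \<Longrightarrow> x \<in> ssum U W"
  using V.subspace_0[OF assms(1)] V.subspace_0[OF assms(2)] unfolding ssum_def by force+

text \<open>The projector \<open>p\<close> has kernel \<open>J\<close>, and \<open>u - (p \<otimes> q) u\<close> always lies in
  \<open>J \<otimes> N' + N \<otimes> J'\<close>; slicing shows that \<open>(p \<otimes> q) u\<close> vanishes.\<close>
lemma tensor_kernel:
  assumes J: "J = {x \<in> N. \<forall>f\<in>F. f x = 0}" and J': "J' = {x \<in> N'. \<forall>f\<in>F'. f x = 0}"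
    and N: "V.subspace N" "V.subspace N'" and F: "\<And>f. f \<in> F \<Longrightarrow> lin f" "\<And>f. f \<in> F' \<Longrightarrow> lin f"
    and u: "u \<in> TS N N'" and ker: "\<And>f g. f \<in> F \<Longrightarrow> g \<in> F' \<Longrightarrow> tmap f g u = 0"
  shows "u \<in> ssum (TS J N') (TS N J')"
proof -
  have sub: "V.subspace {x \<in> N. \<forall>f\<in>F. f x = 0}" if "V.subspace N" "\<And>f. f \<in> F \<Longrightarrow> lin f"
    for N :: "('x \<Rightarrow>\<^sub>0 'b) set" and F :: "(('x \<Rightarrow>\<^sub>0 'b) \<Rightarrow> ('y \<Rightarrow>\<^sub>0 'b)) set"
    using that by (auto intro!: V.subspaceI simp: V.subspace_0 V.subspace_add V.subspace_scale lin_0 lin_add lin_scl)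
  have sJ: "V.subspace J" and sJ': "V.subspace J'" using sub N F J J' by auto
  obtain p where p: "lin p" "\<And>x. p x \<in> J" "\<And>x. x \<in> J \<Longrightarrow> p x = x"
    using exists_projector[OF sJ] by blast
  obtain q where q: "lin q" "\<And>x. q x \<in> J'" "\<And>x. x \<in> J' \<Longrightarrow> q x = x"
    using exists_projector[OF sJ'] by blast
  \<comment> \<open>\<open>p1\<close> and \<open>q1\<close> are the complementary projectors: they
    remove \<open>J\<close> and \<open>J'\<close>, where all of \<open>F\<close> and
    \<open>F'\<close> vanish, so composing with them changes no \<open>f\<close> and no
    \<open>g\<close>.\<close>
  define p1 where "p1 x = x - p x" for x
  define q1 where "q1 x = x - q x" for x
  have l: "lin p1" "lin q1" unfolding p1_def q1_def by (auto intro!: lin_minus lin_ident p q)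
  have pq0: "p (p1 x) = 0" "q (q1 y) = 0" for x y
    by (simp_all add: p1_def q1_def lin_diff p q)
  have p1N: "p1 x \<in> N" if "x \<in> N" for x
    using that p(2)[of x] N J by (auto simp: p1_def V.subspace_diff)
  have q1N: "q1 x \<in> N'" if "x \<in> N'" for x
    using that q(2)[of x] N J' by (auto simp: q1_def V.subspace_diff)
  have fp1: "f (p1 x) = f x" if "f \<in> F" for f x
    using p(2)[of x] J that by (simp add: p1_def lin_diff F)
  have fq1: "f (q1 x) = f x" if "f \<in> F'" for f x
    using q(2)[of x] J' that by (simp add: q1_def lin_diff F)
  have 1: "u - tmap p1 q1 u \<in> ssum (TS J N') (TS N J')"
  proof -
    have "u \<in> {u. u - tmap p1 q1 u \<in> ssum (TS J N') (TS N J')}"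
      using u
    proof (rule TS_induct)
      show "V.subspace N \<and> V.subspace N' \<and> V.subspace {u. u - tmap p1 q1 u \<in> ssum (TS J N') (TS N J')}"
        using N sJ sJ' by (auto intro!: lin_vimage subspace_ssum subspace_TS lin_minus lin_ident lin_tmap)
      fix x y assume xy: "x \<in> N" "y \<in> N'"
      have "tens x y - tens (p1 x) (q1 y) = tens (p x) y + tens (p1 x) (q y)"
        by (simp add: p1_def q1_def lin_diff[OF lin_tens(1)] lin_diff[OF lin_tens(2)])
      moreover have "tens (p x) y \<in> TS J N'" "tens (p1 x) (q y) \<in> TS N J'"
        using xy p q N sJ sJ' p1N by (auto intro!: tens_in_TS)
      ultimately show "tens x y \<in> {u. u - tmap p1 q1 u \<in> ssum (TS J N') (TS N J')}"
        by (auto simp: tmap_tens l ssum_def)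
    qed
    then show ?thesis by simp
  qed
  let ?v = "tmap p1 q1 u"
  have v: "?v \<in> TS N N'" using u N l p1N q1N by (rule_tac tmap_TS) auto
  \<comment> \<open>A row \<open>w\<close> of this tensor lies in \<open>N'\<close> and is killed by
    every \<open>g\<close> of \<open>F'\<close>, by \<open>ker\<close>; hence it lies in
    \<open>J'\<close>, where \<open>q\<close> is the identity. But \<open>q w = 0\<close> because
    \<open>q\<close> after \<open>q1\<close> is zero. So \<open>w = 0\<close>.\<close>
  have z1: "tmap f (\<lambda>x. x) ?v = 0" if f: "f \<in> F" for f
  proof (rule rslice_eqI)
    fix i
    let ?w = "rslice i (tmap f (\<lambda>x. x) ?v)"
    have q1w: "q ?w = 0"
    proof -
      have "q ?w = rslice i (tmap (\<lambda>x. x) q (tmap f (\<lambda>x. x) ?v))" by (simp add: rslice_tmap_snd q)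
      also have "tmap (\<lambda>x. x) q (tmap f (\<lambda>x. x) ?v) = tmap (\<lambda>x. f (p1 x)) (\<lambda>x. 0) u"
        using tmap_comp[OF lin_ident q(1) lin_comp[OF F(1)[OF f] l(1)] l(2)]
            tmap_comp[OF F(1)[OF f] lin_ident l] by (simp add: pq0)
      also have "\<dots> = 0"
        by (rule tens_lin_eqI[OF lin_tmap lin_zero])
          (simp add: tmap_tens lin_zero lin_comp[OF F(1)[OF f] l(1)] lin_0[OF lin_tens(1)])
      finally show ?thesis by (simp add: lin_0[OF lin_rslice])
    qed
    have wN: "?w \<in> N'"
    proof -
      have "tmap f (\<lambda>x. x) ?v \<in> TS UNIV N'"
        using v N F(1)[OF f] by (rule_tac tmap_TS) (auto simp: lin_ident)
      then show ?thesis by (simp add: TS_def)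
    qed
    moreover have "g ?w = 0" if g: "g \<in> F'" for g
    proof -
      have "g ?w = rslice i (tmap (\<lambda>x. x) g (tmap f (\<lambda>x. x) ?v))" by (simp add: rslice_tmap_snd F g)
      also have "tmap (\<lambda>x. x) g (tmap f (\<lambda>x. x) ?v) = tmap f g u"
        using tmap_comp[OF lin_ident F(2)[OF g] lin_comp[OF F(1)[OF f] l(1)] l(2)]
            tmap_comp[OF F(1)[OF f] lin_ident l] by (simp add: fp1 fq1 f g)
      finally show ?thesis using ker f g by (simp add: lin_0[OF lin_rslice])
    qed
    ultimately have "?w \<in> J'" using J' by auto
    then have "?w = 0" using q(3) q1w by metis
    then show "?w = rslice i 0" by (simp add: lin_0[OF lin_rslice])
  qed
  \<comment> \<open>The same argument on columns, with \<open>z1\<close> in the role of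
    \<open>ker\<close>.\<close>
  have "?v = 0"
  proof (rule cslice_eqI)
    fix j
    let ?w = "cslice j ?v"
    have "p ?w = cslice j (tmap p (\<lambda>x. x) ?v)" by (simp add: cslice_tmap_fst p)
    also have "tmap p (\<lambda>x. x) ?v = 0"
    proof -
      have "tmap p (\<lambda>x. x) ?v = tmap (\<lambda>x. 0) q1 u"
        using tmap_comp[OF p(1) lin_ident l] by (simp add: pq0)
      also have "\<dots> = 0"
        by (rule tens_lin_eqI[OF lin_tmap lin_zero])
          (simp add: tmap_tens lin_zero l lin_0[OF lin_tens(2)])
      finally show ?thesis .
    qed
    finally have p0: "p ?w = 0" by (simp add: lin_0[OF lin_cslice])
    have "?w \<in> N" using v by (simp add: TS_def)
    moreover have "f ?w = 0" if f: "f \<in> F" for f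
      using z1[OF f] by (simp add: cslice_tmap_fst[symmetric] F f lin_0[OF lin_cslice])
    ultimately have "?w \<in> J" using J by auto
    then show "?w = cslice j 0" using p(3) p0 by (simp add: lin_0[OF lin_cslice])
  qed
  then show ?thesis using 1 by simp
qed

section \<open>The Jacobson radical of an associative algebra\<close>

text \<open>\<open>lideal\<close>, \<open>mlideal\<close> and \<open>jac\<close> are the notions
  \<open>left_ideal\<close>, \<open>maximal_left_ideal\<close> and \<open>jacobson_radical\<close>
  for a product on a subset \<open>N\<close>; \<open>maximal_left_ideal_iff\<close> and
  \<open>jacobson_iff\<close> match them.\<close>

definition lideal :: "('v \<Rightarrow> 'v \<Rightarrow> 'v) \<Rightarrow> 'v::ab_group_add set \<Rightarrow> 'v set \<Rightarrow> bool" where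
  "lideal mu N M \<longleftrightarrow> M \<subseteq> N \<and> 0 \<in> M \<and> (\<forall>x\<in>M. \<forall>y\<in>M. x + y \<in> M) \<and> (\<forall>x\<in>M. - x \<in> M)
     \<and> (\<forall>r\<in>N. \<forall>x\<in>M. mu r x \<in> M)"

definition mlideal :: "('v \<Rightarrow> 'v \<Rightarrow> 'v) \<Rightarrow> 'v::ab_group_add set \<Rightarrow> 'v set \<Rightarrow> bool" where
  "mlideal mu N M \<longleftrightarrow> lideal mu N M \<and> M \<noteq> N \<and> (\<forall>L. lideal mu N L \<and> M \<subseteq> L \<longrightarrow> L = M \<or> L = N)"

definition jac :: "('v \<Rightarrow> 'v \<Rightarrow> 'v) \<Rightarrow> 'v::ab_group_add set \<Rightarrow> 'v set" where
  "jac mu N = N \<inter> \<Inter>{M. mlideal mu N M}"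

definition avg :: "(('i \<Rightarrow>\<^sub>0 'f::field) \<Rightarrow> ('i \<Rightarrow>\<^sub>0 'f) \<Rightarrow> ('i \<Rightarrow>\<^sub>0 'f)) \<Rightarrow> 's set \<Rightarrow> ('s \<Rightarrow> ('i \<Rightarrow>\<^sub>0 'f))
    \<Rightarrow> ('s \<Rightarrow> ('i \<Rightarrow>\<^sub>0 'f)) \<Rightarrow> ('i \<Rightarrow>\<^sub>0 'f) \<Rightarrow> ('i \<Rightarrow>\<^sub>0 'f)" where
  "avg mu S a b z = (\<Sum>i\<in>S. mu (mu (a i) z) (b i))"

text \<open>In terms of coefficients: \<open>\<Sum> c a\<^sub>i \<otimes> b\<^sub>i = \<Sum> a\<^sub>i \<otimes> b\<^sub>i c\<close>.\<close>
definition balanced :: "(('i \<Rightarrow>\<^sub>0 'f::field) \<Rightarrow> ('i \<Rightarrow>\<^sub>0 'f) \<Rightarrow> ('i \<Rightarrow>\<^sub>0 'f)) \<Rightarrow> 's set \<Rightarrow> ('s \<Rightarrow> ('i \<Rightarrow>\<^sub>0 'f))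
    \<Rightarrow> ('s \<Rightarrow> ('i \<Rightarrow>\<^sub>0 'f)) \<Rightarrow> ('i \<Rightarrow>\<^sub>0 'f) \<Rightarrow> bool" where
  "balanced mu S a b c \<longleftrightarrow> (\<exists>m. \<forall>i\<in>S. mu c (a i) = (\<Sum>j\<in>S. scl (m j i) (a j))
     \<and> mu (b i) c = (\<Sum>j\<in>S. scl (m i j) (b j)))"

text \<open>A separability idempotent given as the families \<open>a\<close> and \<open>b\<close>,
  without forming the tensor product of \<open>C\<close> with itself. The matrix in
  \<open>balanced\<close> moves \<open>c\<close> from the \<open>a i\<close> to the
  \<open>b i\<close> in any bilinear expression, by exchanging two sums.\<close>

definition separating :: "(('i \<Rightarrow>\<^sub>0 'f::field) \<Rightarrow> ('i \<Rightarrow>\<^sub>0 'f) \<Rightarrow> ('i \<Rightarrow>\<^sub>0 'f)) \<Rightarrow> ('i \<Rightarrow>\<^sub>0 'f)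
    \<Rightarrow> ('i \<Rightarrow>\<^sub>0 'f) set \<Rightarrow> 's set \<Rightarrow> ('s \<Rightarrow> ('i \<Rightarrow>\<^sub>0 'f)) \<Rightarrow> ('s \<Rightarrow> ('i \<Rightarrow>\<^sub>0 'f)) \<Rightarrow> bool" where
  "separating mu e C S a b \<longleftrightarrow> V.subspace C \<and> (\<forall>x\<in>C. \<forall>y\<in>C. mu x y \<in> C)
     \<and> finite S \<and> (\<forall>i\<in>S. a i \<in> C \<and> b i \<in> C) \<and> (\<Sum>i\<in>S. mu (a i) (b i)) = e
     \<and> (\<forall>c\<in>C. balanced mu S a b c)"

lemma lin_avg: "blin mu \<Longrightarrow> lin (avg mu S a b)"
  unfolding avg_def by (intro lin_setsum lin_comp[OF blinD(2)[of mu] blinD(1)[of mu]])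

locale assoc_alg =
  fixes mu :: "('i \<Rightarrow>\<^sub>0 'f::field) \<Rightarrow> ('i \<Rightarrow>\<^sub>0 'f) \<Rightarrow> ('i \<Rightarrow>\<^sub>0 'f)" (infixl \<open>\<cdot>\<close> 70)
    and N :: "('i \<Rightarrow>\<^sub>0 'f) set" and e :: "'i \<Rightarrow>\<^sub>0 'f"
  assumes bl: "blin mu" and sub: "V.subspace N"
    and closed: "x \<in> N \<Longrightarrow> y \<in> N \<Longrightarrow> x \<cdot> y \<in> N" and unit: "e \<in> N"
    and unit_l: "x \<in> N \<Longrightarrow> e \<cdot> x = x" and unit_r: "x \<in> N \<Longrightarrow> x \<cdot> e = x"
    and assoc: "x \<in> N \<Longrightarrow> y \<in> N \<Longrightarrow> z \<in> N \<Longrightarrow> (x \<cdot> y) \<cdot> z = x \<cdot> (y \<cdot> z)"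
begin

lemmas distr = lin_add[OF blinD(1)[OF bl]] lin_add[OF blinD(2)[OF bl]]
  lin_diff[OF blinD(1)[OF bl]] lin_diff[OF blinD(2)[OF bl]]
lemmas scls = lin_scl[OF blinD(1)[OF bl]] lin_scl[OF blinD(2)[OF bl]]
lemmas zeros = lin_0[OF blinD(1)[OF bl]] lin_0[OF blinD(2)[OF bl]]
lemmas sums = lin_sum[OF blinD(1)[OF bl]] lin_sum[OF blinD(2)[OF bl]]

lemma neg_r: "x \<cdot> (- y) = - (x \<cdot> y)"
  using distr(3)[of x 0 y] by (simp add: zeros)

lemma neg_l: "(- x) \<cdot> y = - (x \<cdot> y)"
  using distr(4)[of 0 x y] by (simp add: zeros)

lemmas mem = V.subspace_0[OF sub] V.subspace_add[OF sub] V.subspace_diff[OF sub]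
  V.subspace_neg[OF sub] V.subspace_scale[OF sub] V.subspace_sum[OF sub] closed unit

lemma lidealD:
  assumes "lideal mu N M"
  shows "x \<in> M \<Longrightarrow> x \<in> N" "0 \<in> M" "x \<in> M \<Longrightarrow> y \<in> M \<Longrightarrow> x + y \<in> M" "x \<in> M \<Longrightarrow> - x \<in> M"
    "r \<in> N \<Longrightarrow> x \<in> M \<Longrightarrow> r \<cdot> x \<in> M" "x \<in> M \<Longrightarrow> y \<in> M \<Longrightarrow> x - y \<in> M"
  using assms unfolding lideal_def by (auto simp: diff_conv_add_uminus simp del: add_uminus_conv_diff)

text \<open>Left ideals are only required to be additive; scalars act through the multiples
  \<open>scl c e\<close> of the unit, which lie in \<open>N\<close>.\<close>

lemma lideal_subspace:
  assumes "lideal mu N M" shows "V.subspace M"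
proof (rule V.subspaceI)
  fix c x assume "x \<in> M"
  moreover have "scl c x = scl c e \<cdot> x"
    using \<open>x \<in> M\<close> lidealD(1)[OF assms] by (simp add: scls unit_l)
  ultimately show "scl c x \<in> M"
    using lidealD(5)[OF assms] by (simp add: mem)
qed (use lidealD[OF assms] in auto)

lemma lideal_whole: "lideal mu N M \<Longrightarrow> e \<in> M \<Longrightarrow> M = N"
  by (metis lidealD(1,5) unit_r subsetI subset_antisym)

lemma mlidealD: "mlideal mu N M \<Longrightarrow> lideal mu N M" "mlideal mu N M \<Longrightarrow> e \<notin> M"
  using lideal_whole unfolding mlideal_def by blast+

text \<open>The image of \<open>R x\<close> in the simple module \<open>N / M\<close> is a nonzero
  submodule, hence all of it. Speaking of elements modulo \<open>M\<close> avoids the quotient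
  module.\<close>

lemma mlideal_gen:
  assumes M: "mlideal mu N M" and x: "x \<in> N" "x \<notin> M" and y: "y \<in> N"
    and R: "lideal mu N R" and nz: "\<exists>r\<in>R. r \<cdot> x \<notin> M"
  shows "\<exists>r\<in>R. y - r \<cdot> x \<in> M"
proof -
  note lM = lidealD[OF mlidealD(1)[OF M]] and lR = lidealD[OF R]
  let ?L = "{z \<in> N. \<exists>r\<in>R. z - r \<cdot> x \<in> M}"
  have "lideal mu N ?L"
    unfolding lideal_def
  proof (intro conjI ballI)
    show "0 \<in> ?L" using lR(2) lM(2) by (auto simp: mem zeros intro!: bexI[of _ 0])
  next
    fix z w assume "z \<in> ?L" "w \<in> ?L"
    then obtain r s where "r \<in> R" "s \<in> R" "z - r \<cdot> x \<in> M" "w - s \<cdot> x \<in> M" "z \<in> N" "w \<in> N" by auto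
    then have "r + s \<in> R" "(z + w) - (r + s) \<cdot> x \<in> M"
      using lR(3) lM(3)[of "z - r \<cdot> x" "w - s \<cdot> x"] by (auto simp: distr algebra_simps)
    then show "z + w \<in> ?L" using \<open>z \<in> N\<close> \<open>w \<in> N\<close> by (auto simp: mem)
  next
    fix z assume "z \<in> ?L"
    then obtain r where "r \<in> R" "z - r \<cdot> x \<in> M" "z \<in> N" by auto
    then show "- z \<in> ?L" using lR(4)[of r] lM(4)[of "z - r \<cdot> x"]
      by (auto simp: mem neg_l intro!: bexI[of _ "- r"])
  next
    fix t z assume "t \<in> N" "z \<in> ?L"
    then obtain r where r: "r \<in> R" "z - r \<cdot> x \<in> M" "z \<in> N" by auto
    then have "t \<cdot> z - (t \<cdot> r) \<cdot> x = t \<cdot> (z - r \<cdot> x)"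
      using \<open>t \<in> N\<close> x lR(1) by (simp add: distr assoc)
    then show "t \<cdot> z \<in> ?L" using r \<open>t \<in> N\<close> lM(5) lR(5) by (auto simp: mem intro!: bexI[of _ "t \<cdot> r"])
  qed auto
  moreover have "M \<subseteq> ?L" using lM(1) lR(2) by (auto simp: zeros intro!: bexI[of _ 0])
  moreover have "?L \<noteq> M"
  proof -
    obtain r where r: "r \<in> R" "r \<cdot> x \<notin> M" using nz by auto
    then have "r \<cdot> x \<in> ?L" using x lR(1) lM(2) by (auto simp: mem intro!: bexI[of _ r])
    then show ?thesis using r(2) by blast
  qed
  ultimately have "?L = N" using M unfolding mlideal_def by blast
  then show ?thesis using y by blast
qed

lemma lideal_N: "lideal mu N N"
  by (auto simp: lideal_def mem)

text \<open>Zorn's lemma: a left ideal is proper exactly when it omits \<open>e\<close>, and that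
  property survives unions of chains.\<close>

lemma exists_mlideal:
  assumes I: "lideal mu N I" "e \<notin> I"
  shows "\<exists>M. mlideal mu N M \<and> I \<subseteq> M"
proof -
  let ?A = "{L. lideal mu N L \<and> I \<subseteq> L \<and> e \<notin> L}"
  have "\<exists>M\<in>?A. \<forall>X\<in>?A. M \<subseteq> X \<longrightarrow> X = M"
  proof (rule subset_Zorn_nonempty)
    fix \<C> assume \<C>: "\<C> \<noteq> {}" "subset.chain ?A \<C>"
    then have A: "L \<in> ?A" if "L \<in> \<C>" for L
      using that by (auto simp: subset_chain_def)
    have "x + y \<in> \<Union>\<C>" if xy: "x \<in> \<Union>\<C>" "y \<in> \<Union>\<C>" for x y
    proof -
      obtain L L' where L: "L \<in> \<C>" "L' \<in> \<C>" "x \<in> L" "y \<in> L'" using xy by auto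
      then have "L \<subseteq> L' \<or> L' \<subseteq> L" using \<C> by (auto simp: subset_chain_def)
      then show ?thesis using L A lidealD(3) by blast
    qed
    moreover have "\<And>x. x \<in> \<Union>\<C> \<Longrightarrow> x \<in> N" "0 \<in> \<Union>\<C>" "\<And>x. x \<in> \<Union>\<C> \<Longrightarrow> - x \<in> \<Union>\<C>"
      "\<And>r x. r \<in> N \<Longrightarrow> x \<in> \<Union>\<C> \<Longrightarrow> r \<cdot> x \<in> \<Union>\<C>"
      using A \<C>(1) lidealD(1,2,4,5) by blast+
    ultimately have "lideal mu N (\<Union>\<C>)" by (simp add: lideal_def subset_iff)
    then show "\<Union>\<C> \<in> ?A" using A \<C>(1) by blast
  qed (use I in auto)
  then obtain M where M: "lideal mu N M" "I \<subseteq> M" "e \<notin> M" "\<And>X. X \<in> ?A \<Longrightarrow> M \<subseteq> X \<Longrightarrow> X = M"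
    by auto
  have "mlideal mu N M"
    unfolding mlideal_def using M unit lideal_whole by blast
  then show ?thesis using M by blast
qed

section \<open>Elementary properties of the Jacobson radical\<close>

abbreviation J where "J \<equiv> jac mu N"

lemma jac_subset: "J \<subseteq> N" by (auto simp: jac_def)

lemma jac_lideal: "lideal mu N J"
  using lidealD(2-5)[OF mlidealD(1)] unfolding lideal_def jac_def by (auto simp: mem)

text \<open>The radical kills every simple module \<open>N / M\<close>, so also the class of
  \<open>r\<close> in it. Concretely, if \<open>x r\<close> is outside \<open>M\<close>, the
  annihilator \<open>?Q\<close> of that class is a maximal left ideal, and so it contains
  \<open>x\<close>.\<close>

lemma jac_right:
  assumes x: "x \<in> J" and r: "r \<in> N"
  shows "x \<cdot> r \<in> J"
proof (rule ccontr)
  have xN: "x \<in> N" using x jac_subset by auto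
  assume "x \<cdot> r \<notin> J"
  then obtain M where M: "mlideal mu N M" "x \<cdot> r \<notin> M" using xN r by (auto simp: jac_def mem)
  note lM = lidealD[OF mlidealD(1)[OF M(1)]]
  let ?Q = "{s \<in> N. s \<cdot> r \<in> M}"
  have rM: "r \<notin> M" using M(2) lM(5) xN by auto
  have Q: "lideal mu N ?Q"
    unfolding lideal_def
  proof (intro conjI ballI)
    fix s assume "s \<in> ?Q"
    then show "- s \<in> ?Q" using lM(4) by (auto simp: mem neg_l)
  qed (use lM r in \<open>auto simp: mem distr zeros assoc\<close>)
  have "mlideal mu N ?Q"
    unfolding mlideal_def
  proof (intro conjI allI impI)
    have "e \<notin> ?Q" using rM r by (simp add: unit_l)
    then show "?Q \<noteq> N" using unit by blast
    fix L assume L: "lideal mu N L \<and> ?Q \<subseteq> L"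
    show "L = ?Q \<or> L = N"
    proof (rule disjCI)
      assume "L \<noteq> N"
      show "L = ?Q"
      proof (rule ccontr)
        assume "L \<noteq> ?Q"
        then obtain s where s: "s \<in> L" "s \<notin> ?Q" using L by auto
        have sN: "s \<in> N" using s L lidealD(1) by blast
        have sr: "s \<cdot> r \<in> N" "s \<cdot> r \<notin> M" using s sN r by (auto simp: mem)
        \<comment> \<open>Any \<open>s\<close> outside \<open>?Q\<close> moves the nonzero class of
          \<open>r\<close> to another nonzero class, which generates \<open>N / M\<close>; so some
          \<open>u s\<close> fixes the class of \<open>r\<close>, and \<open>e - u s\<close> lies in
          \<open>?Q\<close>.\<close>
        obtain u where u: "u \<in> N" "r - u \<cdot> (s \<cdot> r) \<in> M"
          using mlideal_gen[OF M(1) sr r lideal_N] sr unit unit_l by metis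
        then have "(e - u \<cdot> s) \<cdot> r \<in> M" using sN r by (simp add: distr assoc unit_l)
        then have "e - u \<cdot> s \<in> L" using L u sN by (auto simp: mem)
        moreover have "u \<cdot> s \<in> L" using L u s lidealD(5) by blast
        ultimately have "e \<in> L" using L lidealD(3)[of L "e - u \<cdot> s" "u \<cdot> s"] by simp
        then show False using \<open>L \<noteq> N\<close> L lideal_whole by blast
      qed
    qed
  qed (rule Q)
  then have "x \<in> ?Q" using x by (auto simp: jac_def)
  then show False using M by auto
qed

text \<open>If the left ideal of multiples of \<open>e - f\<close> were proper, a maximal left ideal
  would contain \<open>e - f\<close> and also \<open>f\<close>, hence \<open>e\<close>. So
  \<open>e\<close> is a multiple of \<open>e - f\<close>, and \<open>(e - f) f = 0\<close> yields
  \<open>f = e f = 0\<close>.\<close>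

lemma jac_idem:
  assumes "f \<in> J" "f \<cdot> f = f" shows "f = 0"
proof -
  have fN: "f \<in> N" using assms jac_subset by auto
  let ?I = "(\<lambda>r. r \<cdot> (e - f)) ` N"
  have I: "lideal mu N ?I"
    unfolding lideal_def
  proof (intro conjI ballI)
    show "0 \<in> ?I" by (rule image_eqI[of _ _ 0]) (auto simp: zeros mem)
  next
    fix x y assume "x \<in> ?I" "y \<in> ?I"
    then show "x + y \<in> ?I" by (auto simp: distr(2)[symmetric] mem)
  next
    fix x assume "x \<in> ?I"
    then obtain r where "r \<in> N" "x = r \<cdot> (e - f)" by auto
    then have "- x = (- r) \<cdot> (e - f)" by (simp add: neg_l)
    then show "- x \<in> ?I" using \<open>r \<in> N\<close> by (auto simp: mem)
  next
    fix r x assume "r \<in> N" "x \<in> ?I"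
    then obtain s where "s \<in> N" "x = s \<cdot> (e - f)" by auto
    then have "r \<cdot> x = (r \<cdot> s) \<cdot> (e - f)" using \<open>r \<in> N\<close> fN by (simp add: assoc mem)
    then show "r \<cdot> x \<in> ?I" using \<open>r \<in> N\<close> \<open>s \<in> N\<close> by (auto simp: mem)
  qed (use fN in \<open>auto simp: mem\<close>)
  have "e \<in> ?I"
  proof (rule ccontr)
    assume "e \<notin> ?I"
    then obtain M where M: "mlideal mu N M" "?I \<subseteq> M" using exists_mlideal[OF I] by auto
    have "e \<cdot> (e - f) \<in> M" using M unit by auto
    then have "e - f \<in> M" using fN by (simp add: unit_l mem)
    moreover have "f \<in> M" using assms M by (auto simp: jac_def)
    ultimately have "e \<in> M" using lidealD(3)[OF mlidealD(1)[OF M(1)], of "e - f" f] by simp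
    then show False using mlidealD(2) M by blast
  qed
  then obtain r where r: "r \<in> N" "e = r \<cdot> (e - f)" by auto
  have "f = (r \<cdot> (e - f)) \<cdot> f" using r fN unit_l by metis
  also have "\<dots> = r \<cdot> ((e - f) \<cdot> f)" using r(1) fN by (simp add: assoc mem)
  also have "(e - f) \<cdot> f = 0" using fN assms by (simp add: distr unit_l)
  finally show ?thesis by (simp add: zeros)
qed

text \<open>A form of the Jacobson density theorem: one element \<open>z\<close> of \<open>I\<close>
  acts as the identity on finitely many classes of the simple module \<open>N / M\<close>. The
  classes are adjoined one at a time.\<close>

lemma mlideal_density:
  assumes M: "mlideal mu N M" and I: "lideal mu N I" "\<And>x r. x \<in> I \<Longrightarrow> r \<in> N \<Longrightarrow> x \<cdot> r \<in> I"
    and nI: "\<not> I \<subseteq> M" and X: "finite X" "X \<subseteq> N"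
  shows "\<exists>z\<in>I. \<forall>x\<in>X. (e - z) \<cdot> x \<in> M"
  using X
proof (induction X rule: finite_induct)
  case empty
  then show ?case using lidealD(2)[OF I(1)] by blast
next
  case (insert x' X)
  note lM = lidealD[OF mlidealD(1)[OF M]] and lI = lidealD[OF I(1)]
  obtain z where z: "z \<in> I" "\<forall>x\<in>X. (e - z) \<cdot> x \<in> M" using insert by auto
  define t where "t = e - z"
  have t: "t \<in> N" using z lI(1) by (auto simp: t_def mem)
  have x': "x' \<in> N" using insert by auto
  show ?case
  proof (cases "t \<cdot> x' \<in> M")
    case True
    then show ?thesis using z by (auto simp: t_def)
  next
    case False
    have tx: "t \<cdot> x' \<in> N" using t x' by (simp add: mem)
    \<comment> \<open>The class of \<open>t x'\<close> generates \<open>N / M\<close>. If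
      \<open>I\<close> killed it, then \<open>I\<close>, being closed under right multiplication,
      would kill every class, that of \<open>e\<close> included, and so lie in
      \<open>M\<close>.\<close>
    have "\<exists>r\<in>I. r \<cdot> (t \<cdot> x') \<notin> M"
    proof (rule ccontr)
      assume "\<not> (\<exists>r\<in>I. r \<cdot> (t \<cdot> x') \<notin> M)"
      then have *: "r \<cdot> (t \<cdot> x') \<in> M" if "r \<in> I" for r using that by auto
      obtain s where s: "s \<in> N" "e - s \<cdot> (t \<cdot> x') \<in> M"
        using mlideal_gen[OF M tx False unit lideal_N] False tx unit unit_l by metis
      have "i \<in> M" if i: "i \<in> I" for i
      proof -
        have iN: "i \<in> N" using i lI(1) by auto
        have "i \<cdot> (e - s \<cdot> (t \<cdot> x')) \<in> M" using lM(5) s iN by auto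
        moreover have "i \<cdot> (s \<cdot> (t \<cdot> x')) \<in> M"
          using *[OF I(2)[OF i s(1)]] iN s tx by (simp add: assoc)
        ultimately show ?thesis
          using lM(3)[of "i \<cdot> (e - s \<cdot> (t \<cdot> x'))" "i \<cdot> (s \<cdot> (t \<cdot> x'))"] iN by (simp add: distr unit_r)
      qed
      then show False using nI by auto
    qed
    then obtain r where r: "r \<in> I" "t \<cdot> x' - r \<cdot> (t \<cdot> x') \<in> M"
      using mlideal_gen[OF M tx False tx I(1)] by auto
    have rN: "r \<in> N" using r lI(1) by auto
    \<comment> \<open>Since \<open>e - ?z = (e - r) t\<close>, the new element still works for
      \<open>X\<close>, where \<open>t\<close> already lands in \<open>M\<close>, and works for
      \<open>x'\<close> by the choice of \<open>r\<close>.\<close>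
    let ?z = "z + r \<cdot> t"
    have eq: "(e - ?z) \<cdot> x = t \<cdot> x - r \<cdot> (t \<cdot> x)" if "x \<in> N" for x
      using that rN t by (simp add: t_def[symmetric] distr assoc algebra_simps)
        (simp add: t_def distr algebra_simps)
    have "?z \<in> I" using z r t I lI(3) by auto
    moreover have "(e - ?z) \<cdot> x \<in> M" if "x \<in> insert x' X" for x
    proof (cases "x = x'")
      case True
      then show ?thesis using r x' eq by auto
    next
      case F: False
      then have "t \<cdot> x \<in> M" "x \<in> N" using z that insert by (auto simp: t_def)
      then show ?thesis using eq lM(5)[OF rN] lM(6) by auto
    qed
    ultimately show ?thesis by blast
  qed
qed

lemma ideal_subset_jac:
  assumes S: "finite S" "\<And>i. i \<in> S \<Longrightarrow> a i \<in> N \<and> b i \<in> N" "(\<Sum>i\<in>S. a i \<cdot> b i) = e"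
    and I: "lideal mu N I" "\<And>x r. x \<in> I \<Longrightarrow> r \<in> N \<Longrightarrow> x \<cdot> r \<in> I"
    and avg: "\<And>z. z \<in> I \<Longrightarrow> avg mu S a b z = 0"
  shows "I \<subseteq> J"
proof -
  have "I \<subseteq> M" if M: "mlideal mu N M" for M
  proof (rule ccontr)
    assume "\<not> I \<subseteq> M"
    then obtain z where z: "z \<in> I" "\<forall>i\<in>S. (e - z) \<cdot> b i \<in> M"
      using mlideal_density[OF M I, of "b ` S"] S by auto
    have zN: "z \<in> N" using z I lidealD(1) by auto
    have "(\<Sum>i\<in>S. a i \<cdot> ((e - z) \<cdot> b i)) \<in> M"
      using lideal_subspace[OF mlidealD(1)[OF M]] lidealD(5)[OF mlidealD(1)[OF M]] S z
      by (intro V.subspace_sum) auto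
    also have "(\<Sum>i\<in>S. a i \<cdot> ((e - z) \<cdot> b i)) = (\<Sum>i\<in>S. a i \<cdot> b i - (a i \<cdot> z) \<cdot> b i)"
      using S zN by (intro sum.cong) (auto simp: distr unit_l assoc)
    also have "\<dots> = e" using avg[OF z(1)] S(3) by (simp add: sum_subtractf avg_def)
    finally show False using mlidealD(2)[OF M] by simp
  qed
  then show ?thesis using I lidealD(1) by (auto simp: jac_def)
qed

text \<open>As in Maschke's theorem, averaging a linear projection of \<open>C\<close> onto its ideal
  \<open>H = J \<inter> C\<close> yields an idempotent \<open>f \<in> H\<close> with \<open>h = h f\<close> on \<open>H\<close>.\<close>
lemma jac_Int_separating:
  assumes sep: "separating mu e C S a b" and C: "C \<subseteq> N" and h: "h \<in> J" "h \<in> C"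
  shows "h = 0"
proof -
  have S: "finite S" "\<And>i. i \<in> S \<Longrightarrow> a i \<in> C \<and> b i \<in> C" "(\<Sum>i\<in>S. a i \<cdot> b i) = e"
    and sC: "V.subspace C" and cC: "\<And>x y. x \<in> C \<Longrightarrow> y \<in> C \<Longrightarrow> x \<cdot> y \<in> C"
    and bal: "\<And>c. c \<in> C \<Longrightarrow> balanced mu S a b c"
    using sep by (auto simp: separating_def)
  let ?H = "J \<inter> C"
  have sH: "V.subspace ?H" by (intro V.subspace_inter lideal_subspace jac_lideal sC)
  obtain p where p: "lin p" "\<And>x. p x \<in> ?H" "\<And>x. x \<in> ?H \<Longrightarrow> p x = x"
    using exists_projector[OF sH] by blast
  define f where "f = (\<Sum>i\<in>S. a i \<cdot> p (b i))"
  have HH: "c \<cdot> k \<in> ?H" if "c \<in> C" "k \<in> ?H" for c k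
    using that lidealD(5)[OF jac_lideal] cC C by auto
  have f: "f \<in> ?H" unfolding f_def using S p(2) HH by (intro V.subspace_sum[OF sH]) auto
  have hf: "k \<cdot> f = k" if k: "k \<in> ?H" for k
  proof -
    have kN: "k \<in> N" and kC: "k \<in> C" using k C by auto
    obtain m where m: "\<And>i. i \<in> S \<Longrightarrow> k \<cdot> a i = (\<Sum>j\<in>S. scl (m j i) (a j))"
      "\<And>i. i \<in> S \<Longrightarrow> b i \<cdot> k = (\<Sum>j\<in>S. scl (m i j) (b j))"
      using bal[OF kC] by (auto simp: balanced_def)
    have "k \<cdot> f = (\<Sum>i\<in>S. (k \<cdot> a i) \<cdot> p (b i))"
      unfolding f_def sums using kN S C p(2) by (intro sum.cong refl assoc[symmetric]) auto
    also have "\<dots> = (\<Sum>i\<in>S. \<Sum>j\<in>S. scl (m j i) (a j \<cdot> p (b i)))"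
      by (intro sum.cong refl) (simp add: m sums scls)
    also have "\<dots> = (\<Sum>j\<in>S. \<Sum>i\<in>S. scl (m j i) (a j \<cdot> p (b i)))" by (rule sum.swap)
    \<comment> \<open>The coefficients \<open>m j i\<close> are scalars, so they pass through the
      merely linear \<open>p\<close> and reassemble \<open>b j k\<close> inside it. That element
      lies in \<open>?H\<close>, where \<open>p\<close> is the identity.\<close>
    also have "\<dots> = (\<Sum>j\<in>S. a j \<cdot> p (b j \<cdot> k))"
      by (intro sum.cong refl) (simp add: m sums scls lin_sum lin_scl p)
    also have "\<dots> = (\<Sum>j\<in>S. (a j \<cdot> b j) \<cdot> k)"
      using S HH[OF _ k] p(3) C kN by (intro sum.cong refl) (auto simp: assoc subset_iff)
    also have "\<dots> = (\<Sum>j\<in>S. a j \<cdot> b j) \<cdot> k" by (simp add: sums)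
    finally show ?thesis using S kN by (simp add: unit_l)
  qed
  have "f = 0" using jac_idem[of f] hf[OF f] f by auto
  then show ?thesis using hf[of h] h by (simp add: zeros)
qed

text \<open>The right side is the largest two-sided ideal of \<open>N\<close> on which the averaging
  vanishes. Each pair \<open>y\<close>, \<open>z\<close> contributes one linear condition on
  \<open>x\<close>, the form in which tensor products can be handled.\<close>

theorem jac_char:
  assumes sep: "separating mu e C S a b" and C: "C \<subseteq> N"
    and avgC: "\<And>z. z \<in> N \<Longrightarrow> avg mu S a b z \<in> C"
  shows "J = {x \<in> N. \<forall>y\<in>N. \<forall>z\<in>N. avg mu S a b (y \<cdot> x \<cdot> z) = 0}" (is "J = ?I")
proof
  have S: "finite S" "\<And>i. i \<in> S \<Longrightarrow> a i \<in> N \<and> b i \<in> N" "(\<Sum>i\<in>S. a i \<cdot> b i) = e"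
    using sep C by (auto simp: separating_def)
  show "J \<subseteq> ?I"
  proof
    fix x assume x: "x \<in> J"
    \<comment> \<open>The radical is two-sided, so the average stays in \<open>J\<close>; it also
      lies in \<open>C\<close>, and \<open>J\<close> meets \<open>C\<close> in zero only.\<close>
    have "avg mu S a b (y \<cdot> x \<cdot> z) = 0" if yz: "y \<in> N" "z \<in> N" for y z
    proof (rule jac_Int_separating[OF sep C])
      have yxz: "y \<cdot> x \<cdot> z \<in> J" using yz x lidealD(5)[OF jac_lideal] jac_right by auto
      then show "avg mu S a b (y \<cdot> x \<cdot> z) \<in> C" using avgC jac_subset by auto
      show "avg mu S a b (y \<cdot> x \<cdot> z) \<in> J"
        unfolding avg_def using S yxz lidealD(5)[OF jac_lideal] jac_right
        by (intro V.subspace_sum lideal_subspace jac_lideal) auto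
    qed
    then show "x \<in> ?I" using x jac_subset by auto
  qed
  note la = lin_avg[OF bl, of S a b]
  show "?I \<subseteq> J"
  proof (rule ideal_subset_jac[OF S])
    show "lideal mu N ?I"
      unfolding lideal_def
    proof (intro conjI ballI)
      fix x assume "x \<in> ?I"
      moreover have "avg mu S a b (y \<cdot> (- x) \<cdot> z) = - avg mu S a b (y \<cdot> x \<cdot> z)" for y z
        using lin_diff[OF la, of 0] by (simp add: neg_r neg_l lin_0[OF la])
      ultimately show "- x \<in> ?I" by (simp add: mem)
    next
      fix r x assume rx: "r \<in> N" "x \<in> ?I"
      then have "y \<cdot> (r \<cdot> x) \<cdot> z = (y \<cdot> r) \<cdot> x \<cdot> z" if "y \<in> N" for y z
        using that by (simp add: assoc)
      then show "r \<cdot> x \<in> ?I" using rx by (simp add: mem)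
    qed (auto simp: mem zeros distr lin_0[OF la] lin_add[OF la])
  next
    fix x r assume xr: "x \<in> ?I" "r \<in> N"
    then have "y \<cdot> (x \<cdot> r) \<cdot> z = y \<cdot> x \<cdot> (r \<cdot> z)" if "y \<in> N" "z \<in> N" for y z
      using that by (simp add: assoc mem)
    then show "x \<cdot> r \<in> ?I" using xr by (simp add: mem)
  next
    fix x assume "x \<in> ?I"
    then show "avg mu S a b x = 0" using unit unit_l unit_r by fastforce
  qed
qed

end

section \<open>Tensor products of associative algebras\<close>

lemma tens_sum: "tens (sum f S) (sum g T) = (\<Sum>p\<in>S \<times> T. tens (f (fst p)) (g (snd p)))"
  by (subst lin_sum[OF lin_tens(2)]) (simp add: lin_sum[OF lin_tens(1)] sum.cartesian_product split_def)

lemma tens_scl: "tens (scl c x) (scl d y) = scl (c * d) (tens x y)"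
  by (simp add: lin_scl[OF lin_tens(1)] lin_scl[OF lin_tens(2)])

lemma assoc_alg_tensor:
  assumes "assoc_alg mu N e" "assoc_alg nu N' e'"
  shows "assoc_alg (tmul mu nu) (TS N N') (tens e e')"
proof -
  interpret A: assoc_alg mu N e by fact
  interpret B: assoc_alg nu N' e' by fact
  note bl = A.bl B.bl and s = A.sub B.sub
  note sT = subspace_TS[OF s]
  note bT = blin_tmul[of mu nu]
  note tt = tmul_tens[OF bl]
  show ?thesis
  proof
    fix u v assume "u \<in> TS N N'" "v \<in> TS N N'"
    then show "tmul mu nu u v \<in> TS N N'" by (intro tmul_closed[OF bl s] A.closed B.closed)
  next
    fix u assume u: "u \<in> TS N N'"
    show "tmul mu nu (tens e e') u = u"
      by (rule TS_linear_eq[OF u s blinD(1)[OF bT] lin_ident]) (simp add: tt A.unit_l B.unit_l)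
    show "tmul mu nu u (tens e e') = u"
      by (rule TS_linear_eq[OF u s blinD(2)[OF bT] lin_ident]) (simp add: tt A.unit_r B.unit_r)
  next
    fix u v w assume u: "u \<in> TS N N'" and v: "v \<in> TS N N'" and w: "w \<in> TS N N'"
    show "tmul mu nu (tmul mu nu u v) w = tmul mu nu u (tmul mu nu v w)"
    proof (rule TS_linear_eq[OF u s])
      fix x y assume xy: "x \<in> N" "y \<in> N'"
      show "tmul mu nu (tmul mu nu (tens x y) v) w = tmul mu nu (tens x y) (tmul mu nu v w)"
      proof (rule TS_linear_eq[OF v s])
        fix x' y' assume xy': "x' \<in> N" "y' \<in> N'"
        show "tmul mu nu (tmul mu nu (tens x y) (tens x' y')) w
            = tmul mu nu (tens x y) (tmul mu nu (tens x' y') w)"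
          by (rule TS_linear_eq[OF w s])
            (simp_all add: tt xy xy' A.assoc B.assoc blinD(1)[OF bT] lin_comp[OF blinD(1)[OF bT] blinD(1)[OF bT]])
      qed (auto intro: lin_comp[OF blinD(1)[OF bT] blinD(2)[OF bT]] lin_comp[OF blinD(2)[OF bT] blinD(1)[OF bT]])
    qed (auto intro: lin_comp[OF blinD(2)[OF bT] blinD(2)[OF bT]] blinD(2)[OF bT])
  qed (auto intro!: bT sT tens_in_TS s A.unit B.unit)
qed

lemma avg_tensor:
  assumes "blin mu" "blin nu"
  shows "avg (tmul mu nu) (S \<times> T) (\<lambda>p. tens (a (fst p)) (a' (snd p))) (\<lambda>p. tens (b (fst p)) (b' (snd p))) u
     = tmap (avg mu S a b) (avg nu T a' b') u"
  by (rule tens_lin_eqI[OF lin_avg[OF blin_tmul] lin_tmap])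
    (simp add: tmap_tens lin_avg assms, simp add: avg_def tmul_tens assms tens_sum)

text \<open>Balancing matrices add and scale along with \<open>c\<close>. This reduces balancedness
  to a spanning set: pure tensors in \<open>separating_tensor\<close>, generators in
  \<open>separating_exists\<close>.\<close>

lemma subspace_balanced:
  assumes "blin mu" shows "V.subspace {c. balanced mu S a b c}"
proof (rule V.subspaceI)
  note l = blinD[OF assms]
  show "0 \<in> {c. balanced mu S a b c}"
    by (auto simp: balanced_def lin_0[OF l(1)] lin_0[OF l(2)] intro!: exI[of _ "\<lambda>_ _. 0"])
  fix x y assume "x \<in> {c. balanced mu S a b c}" "y \<in> {c. balanced mu S a b c}"
  then obtain m n where "\<forall>i\<in>S. mu x (a i) = (\<Sum>j\<in>S. scl (m j i) (a j)) \<and> mu (b i) x = (\<Sum>j\<in>S. scl (m i j) (b j))"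
    "\<forall>i\<in>S. mu y (a i) = (\<Sum>j\<in>S. scl (n j i) (a j)) \<and> mu (b i) y = (\<Sum>j\<in>S. scl (n i j) (b j))"
    unfolding balanced_def by blast
  then show "x + y \<in> {c. balanced mu S a b c}"
    by (auto simp: balanced_def lin_add[OF l(1)] lin_add[OF l(2)] sum.distrib[symmetric]
        V.scale_left_distrib[symmetric] intro!: exI[of _ "\<lambda>i j. m i j + n i j"])
next
  note l = blinD[OF assms]
  fix c x assume "x \<in> {c. balanced mu S a b c}"
  then obtain m where "\<forall>i\<in>S. mu x (a i) = (\<Sum>j\<in>S. scl (m j i) (a j)) \<and> mu (b i) x = (\<Sum>j\<in>S. scl (m i j) (b j))"
    unfolding balanced_def by blast
  then show "scl c x \<in> {c. balanced mu S a b c}"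
    by (auto simp: balanced_def lin_scl[OF l(1)] lin_scl[OF l(2)] V.scale_sum_right
        intro!: exI[of _ "\<lambda>i j. c * m i j"])
qed

lemma separating_tensor:
  assumes bl: "blin mu" "blin nu" and A: "separating mu e C S a b" and B: "separating nu e' C' T a' b'"
  shows "separating (tmul mu nu) (tens e e') (TS C C') (S \<times> T)
    (\<lambda>p. tens (a (fst p)) (a' (snd p))) (\<lambda>p. tens (b (fst p)) (b' (snd p)))" (is "separating ?mu _ _ _ ?a ?b")
proof -
  note bT = blin_tmul[of mu nu] and tt = tmul_tens[OF bl]
  have s: "V.subspace C" "V.subspace C'" and c: "\<And>x y. x \<in> C \<Longrightarrow> y \<in> C \<Longrightarrow> mu x y \<in> C"
    "\<And>x y. x \<in> C' \<Longrightarrow> y \<in> C' \<Longrightarrow> nu x y \<in> C'"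
    using A B by (auto simp: separating_def)
  note sT = subspace_TS[OF s]
  have "?mu u v \<in> TS C C'" if "u \<in> TS C C'" "v \<in> TS C C'" for u v
    by (intro tmul_closed[OF bl s] c that)
  moreover have "(\<Sum>p\<in>S \<times> T. ?mu (?a p) (?b p)) = tens e e'"
  proof -
    have "(\<Sum>p\<in>S \<times> T. ?mu (?a p) (?b p)) = tens (\<Sum>i\<in>S. mu (a i) (b i)) (\<Sum>i\<in>T. nu (a' i) (b' i))"
      by (simp add: tt tens_sum)
    then show ?thesis using A B by (simp add: separating_def)
  qed
  moreover have "balanced ?mu (S \<times> T) ?a ?b u" if u: "u \<in> TS C C'" for u
  proof -
    have "u \<in> {u. balanced ?mu (S \<times> T) ?a ?b u}"
      using u
    proof (rule TS_induct)
      fix x y assume xy: "x \<in> C" "y \<in> C'"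
      obtain m where m: "\<And>i. i \<in> S \<Longrightarrow> mu x (a i) = (\<Sum>j\<in>S. scl (m j i) (a j)) \<and> mu (b i) x = (\<Sum>j\<in>S. scl (m i j) (b j))"
        using A xy unfolding separating_def balanced_def by blast
      obtain n where n: "\<And>i. i \<in> T \<Longrightarrow> nu y (a' i) = (\<Sum>j\<in>T. scl (n j i) (a' j)) \<and> nu (b' i) y = (\<Sum>j\<in>T. scl (n i j) (b' j))"
        using B xy unfolding separating_def balanced_def by blast
      \<comment> \<open>The witness is the Kronecker product of the two balancing matrices.\<close>
      show "tens x y \<in> {u. balanced ?mu (S \<times> T) ?a ?b u}"
        unfolding balanced_def mem_Collect_eq
        by (rule exI[of _ "\<lambda>p q. m (fst p) (fst q) * n (snd p) (snd q)"])
          (auto simp: tt m n tens_sum tens_scl)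
    qed (use s subspace_balanced[OF bT] in auto)
    then show ?thesis by simp
  qed
  ultimately show ?thesis
    using A B sT unfolding separating_def by (auto intro!: tens_in_TS)
qed

text \<open>By \<open>Pfg\<close> the equations of the product, tested on the pure tensors of
  \<open>y\<close>, \<open>y'\<close> and of \<open>z\<close>, \<open>z'\<close>, are exactly
  \<open>tmap (f y z) (g y' z') u = 0\<close>. Thus one inclusion is \<open>tensor_kernel\<close>;
  for the other, one of the two maps already vanishes on \<open>A.J\<close> or
  \<open>B.J\<close>.\<close>

theorem jac_tensor:
  assumes A: "assoc_alg mu N e" "separating mu e C S a b" "C \<subseteq> N" "\<And>z. z \<in> N \<Longrightarrow> avg mu S a b z \<in> C"
    and B: "assoc_alg nu N' e'" "separating nu e' C' T a' b'" "C' \<subseteq> N'" "\<And>z. z \<in> N' \<Longrightarrow> avg nu T a' b' z \<in> C'"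
  shows "jac (tmul mu nu) (TS N N') = ssum (TS (jac mu N) N') (TS N (jac nu N'))"
proof -
  interpret A: assoc_alg mu N e by fact
  interpret B: assoc_alg nu N' e' by fact
  interpret T: assoc_alg "tmul mu nu" "TS N N'" "tens e e'" by (rule assoc_alg_tensor) fact+
  let ?mu = "tmul mu nu"
  define f where "f y z x = avg mu S a b (mu (mu y x) z)" for y z x
  define g where "g y z x = avg nu T a' b' (nu (nu y x) z)" for y z x
  define P where "P = avg ?mu (S \<times> T) (\<lambda>p. tens (a (fst p)) (a' (snd p))) (\<lambda>p. tens (b (fst p)) (b' (snd p)))"
  have lf: "lin (f y z)" and lg: "lin (g y' z')" for y z y' z'
    unfolding f_def g_def
    by (rule lin_comp[OF lin_avg[OF A.bl] lin_comp[OF blinD(2)[OF A.bl] blinD(1)[OF A.bl]]]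
        lin_comp[OF lin_avg[OF B.bl] lin_comp[OF blinD(2)[OF B.bl] blinD(1)[OF B.bl]]])+
  have sC: "V.subspace C" "V.subspace C'" using A B by (auto simp: separating_def)
  have jA: "A.J = {x\<in>N. \<forall>y\<in>N. \<forall>z\<in>N. f y z x = 0}"
    unfolding f_def by (rule A.jac_char[OF A(2-4)])
  have jB: "B.J = {x\<in>N'. \<forall>y\<in>N'. \<forall>z\<in>N'. g y z x = 0}"
    unfolding g_def by (rule B.jac_char[OF B(2-4)])
  have Ptens: "P (tens x y) = tens (avg mu S a b x) (avg nu T a' b' y)" for x y
    unfolding P_def by (simp add: avg_tensor A.bl B.bl tmap_tens lin_avg)
  have jT: "T.J = {x\<in>TS N N'. \<forall>y\<in>TS N N'. \<forall>z\<in>TS N N'. P (?mu (?mu y x) z) = 0}"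
    unfolding P_def
  proof (rule T.jac_char[OF separating_tensor[OF A.bl B.bl A(2) B(2)]])
    show "TS C C' \<subseteq> TS N N'" by (rule TS_mono) fact+
    fix z assume "z \<in> TS N N'"
    then show "avg ?mu (S \<times> T) (\<lambda>p. tens (a (fst p)) (a' (snd p))) (\<lambda>p. tens (b (fst p)) (b' (snd p))) z \<in> TS C C'"
      unfolding avg_tensor[OF A.bl B.bl]
      by (rule tmap_TS) (use A.sub B.sub sC A(4) B(4) lin_avg A.bl B.bl in auto)
  qed
  have lP: "lin P" unfolding P_def by (rule lin_avg[OF T.bl])
  have Pfg: "P (?mu (?mu (tens y y') u) (tens z z')) = tmap (f y z) (g y' z') u" for y z y' z' u
    by (rule tens_lin_eqI[OF lin_comp[OF lP lin_comp[OF blinD(2)[OF T.bl] blinD(1)[OF T.bl]]] lin_tmap])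
      (simp add: tmul_tens A.bl B.bl Ptens tmap_tens lf lg f_def[symmetric] g_def[symmetric])
  \<comment> \<open>Pure tensors suffice as test elements, because the averaged product is linear in
    each of them.\<close>
  have "u \<in> T.J" if u: "u \<in> TS N N'" and *: "\<And>y z y' z'. y \<in> N \<Longrightarrow> z \<in> N \<Longrightarrow> y' \<in> N' \<Longrightarrow> z' \<in> N' \<Longrightarrow> tmap (f y z) (g y' z') u = 0" for u
  proof -
    have "P (?mu (?mu v u) w) = 0" if v: "v \<in> TS N N'" and w: "w \<in> TS N N'" for v w
    proof (rule TS_linear_eq[OF v A.sub B.sub, of "\<lambda>v. P (?mu (?mu v u) w)" "\<lambda>_. 0"])
      fix y y' assume y: "y \<in> N" "y' \<in> N'"
      show "P (?mu (?mu (tens y y') u) w) = 0"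
        by (rule TS_linear_eq[OF w A.sub B.sub, of "\<lambda>w. P (?mu (?mu (tens y y') u) w)" "\<lambda>_. 0"])
          (simp_all add: Pfg * y lin_zero lin_comp[OF lP blinD(1)[OF T.bl]])
    qed (simp_all add: lin_zero lin_comp[OF lP lin_comp[OF blinD(2)[OF T.bl] blinD(2)[OF T.bl]]])
    then show ?thesis using u by (simp add: jT)
  qed note into = this
  show ?thesis
  proof
    show "T.J \<subseteq> ssum (TS A.J N') (TS N B.J)"
    proof
      fix u assume u: "u \<in> T.J"
      show "u \<in> ssum (TS A.J N') (TS N B.J)"
      proof (rule tensor_kernel[where F = "{f y z | y z. y \<in> N \<and> z \<in> N}" and F' = "{g y z | y z. y \<in> N' \<and> z \<in> N'}"])
        show "u \<in> TS N N'" using u T.jac_subset by auto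
        fix h k assume "h \<in> {f y z | y z. y \<in> N \<and> z \<in> N}" "k \<in> {g y z | y z. y \<in> N' \<and> z \<in> N'}"
        then obtain y z y' z' where hk: "h = f y z" "k = g y' z'" "y \<in> N" "z \<in> N" "y' \<in> N'" "z' \<in> N'" by auto
        then have "P (?mu (?mu (tens y y') u) (tens z z')) = 0"
          using u unfolding jT by (auto intro!: tens_in_TS A.sub B.sub)
        then show "tmap h k u = 0" using hk by (simp add: Pfg)
      qed (auto simp: jA jB lf lg A.sub B.sub)
    qed
    have sJ: "V.subspace A.J" "V.subspace B.J" "V.subspace T.J"
      using A.lideal_subspace[OF A.jac_lideal] B.lideal_subspace[OF B.jac_lideal]
        T.lideal_subspace[OF T.jac_lideal] by auto
    have 1: "tens x y \<in> T.J" if "x \<in> A.J" "y \<in> N'" for x y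
      using that jA by (intro into) (auto simp: tmap_tens lf lg lin_0[OF lin_tens(2)] intro!: tens_in_TS A.sub B.sub)
    have 2: "tens x y \<in> T.J" if "x \<in> N" "y \<in> B.J" for x y
      using that jB by (intro into) (auto simp: tmap_tens lf lg lin_0[OF lin_tens(1)] intro!: tens_in_TS A.sub B.sub)
    have "TS A.J N' \<subseteq> T.J" using 1 sJ A.sub B.sub by (auto elim!: TS_induct)
    moreover have "TS N B.J \<subseteq> T.J" using 2 sJ A.sub B.sub by (auto elim!: TS_induct)
    ultimately show "ssum (TS A.J N') (TS N B.J) \<subseteq> T.J"
      using sJ(3) by (auto simp: ssum_def intro!: V.subspace_add)
  qed
qed

section \<open>The nucleus in coordinates\<close>

definition assr :: "(('i \<Rightarrow>\<^sub>0 'f::field) \<Rightarrow> ('i \<Rightarrow>\<^sub>0 'f) \<Rightarrow> ('i \<Rightarrow>\<^sub>0 'f))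
    \<Rightarrow> ('i \<Rightarrow>\<^sub>0 'f) \<Rightarrow> ('i \<Rightarrow>\<^sub>0 'f) \<Rightarrow> ('i \<Rightarrow>\<^sub>0 'f) \<Rightarrow> ('i \<Rightarrow>\<^sub>0 'f)" where
  "assr mu x y z = mu (mu x y) z - mu x (mu y z)"

definition nuc :: "(('i \<Rightarrow>\<^sub>0 'f::field) \<Rightarrow> ('i \<Rightarrow>\<^sub>0 'f) \<Rightarrow> ('i \<Rightarrow>\<^sub>0 'f))
    \<Rightarrow> ('i \<Rightarrow>\<^sub>0 'f) set \<Rightarrow> ('i \<Rightarrow>\<^sub>0 'f) set" where
  "nuc mu E = {x \<in> E. \<forall>y\<in>E. \<forall>z\<in>E. assr mu x y z = 0 \<and> assr mu y x z = 0 \<and> assr mu y z x = 0}"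

lemma lin_assr:
  assumes "blin mu"
  shows "lin (\<lambda>x. assr mu x y z)" "lin (\<lambda>x. assr mu y x z)" "lin (\<lambda>x. assr mu y z x)"
  unfolding assr_def
  by (rule lin_minus lin_comp[OF blinD(2)[OF assms] blinD(2)[OF assms]] blinD[OF assms]
      lin_comp[OF blinD(2)[OF assms] blinD(1)[OF assms]] lin_comp[OF blinD(1)[OF assms] blinD(2)[OF assms]]
      lin_comp[OF blinD(1)[OF assms] blinD(1)[OF assms]])+

locale unital_model =
  fixes mu :: "('i \<Rightarrow>\<^sub>0 'f::field) \<Rightarrow> ('i \<Rightarrow>\<^sub>0 'f) \<Rightarrow> ('i \<Rightarrow>\<^sub>0 'f)" (infixl \<open>\<cdot>\<close> 70)
    and E :: "('i \<Rightarrow>\<^sub>0 'f) set" and e :: "'i \<Rightarrow>\<^sub>0 'f"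
  assumes bl: "blin mu" and sub: "V.subspace E"
    and closed: "x \<in> E \<Longrightarrow> y \<in> E \<Longrightarrow> x \<cdot> y \<in> E" and unit: "e \<in> E"
    and unit_l: "x \<in> E \<Longrightarrow> e \<cdot> x = x" and unit_r: "x \<in> E \<Longrightarrow> x \<cdot> e = x"
begin

abbreviation N where "N \<equiv> nuc mu E"

lemmas distr = lin_add[OF blinD(1)[OF bl]] lin_add[OF blinD(2)[OF bl]]
  lin_diff[OF blinD(1)[OF bl]] lin_diff[OF blinD(2)[OF bl]]
lemmas zeros = lin_0[OF blinD(1)[OF bl]] lin_0[OF blinD(2)[OF bl]]

lemma nuc_subset: "N \<subseteq> E" by (auto simp: nuc_def)

lemma nuc_assoc:
  assumes "x \<in> N" "y \<in> E" "z \<in> E"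
  shows "x \<cdot> y \<cdot> z = x \<cdot> (y \<cdot> z)" "y \<cdot> x \<cdot> z = y \<cdot> (x \<cdot> z)" "y \<cdot> z \<cdot> x = y \<cdot> (z \<cdot> x)"
  using assms by (auto simp: nuc_def assr_def)

lemma subspace_nuc: "V.subspace N"
  using sub unfolding nuc_def
  by (auto intro!: V.subspaceI simp: V.subspace_0 V.subspace_add V.subspace_scale
      lin_0[OF lin_assr(1)[OF bl]] lin_0[OF lin_assr(2)[OF bl]] lin_0[OF lin_assr(3)[OF bl]]
      lin_add[OF lin_assr(1)[OF bl]] lin_add[OF lin_assr(2)[OF bl]] lin_add[OF lin_assr(3)[OF bl]]
      lin_scl[OF lin_assr(1)[OF bl]] lin_scl[OF lin_assr(2)[OF bl]] lin_scl[OF lin_assr(3)[OF bl]])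

text \<open>The Teichmueller identity holds for every bilinear product. With two adjacent entries in
  the nucleus only one associator survives, which is how \<open>nuc_closed\<close> uses it.\<close>

lemma assr_teichmueller:
  "assr mu (w \<cdot> x) y z - assr mu w (x \<cdot> y) z + assr mu w x (y \<cdot> z) = w \<cdot> assr mu x y z + assr mu w x y \<cdot> z"
  by (simp add: assr_def distr)

lemma nuc_closed:
  assumes w: "w \<in> N" and x: "x \<in> N"
  shows "w \<cdot> x \<in> N"
proof -
  have E: "w \<in> E" "x \<in> E" using assms nuc_subset by auto
  have "assr mu (w \<cdot> x) y z = 0" if "y \<in> E" "z \<in> E" for y z
    using assr_teichmueller[of w x y z] that w x closed by (auto simp: nuc_def zeros)
  moreover have "assr mu y (w \<cdot> x) z = 0" if "y \<in> E" "z \<in> E" for y z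
    using assr_teichmueller[of y w x z] that w x closed by (auto simp: nuc_def zeros)
  moreover have "assr mu y z (w \<cdot> x) = 0" if "y \<in> E" "z \<in> E" for y z
    using assr_teichmueller[of y z w x] that w x closed by (auto simp: nuc_def zeros)
  ultimately show ?thesis using E closed by (simp add: nuc_def)
qed

lemma unit_nuc: "e \<in> N"
  using unit closed by (auto simp: nuc_def assr_def unit_l unit_r)

lemma assoc_alg_nuc: "assoc_alg mu N e"
proof
  fix x y z assume "x \<in> N" "y \<in> N" "z \<in> N"
  then show "x \<cdot> y \<cdot> z = x \<cdot> (y \<cdot> z)" using nuc_assoc nuc_subset by blast
qed (use bl subspace_nuc nuc_closed unit_nuc unit_l unit_r nuc_subset in auto)

end

lemma unital_model_tensor:
  assumes "unital_model mu E e" "unital_model nu E' e'"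
  shows "unital_model (tmul mu nu) (TS E E') (tens e e')"
proof -
  interpret A: unital_model mu E e by fact
  interpret B: unital_model nu E' e' by fact
  note bl = A.bl B.bl and s = A.sub B.sub
  note sT = subspace_TS[OF s]
  note bT = blin_tmul[of mu nu]
  note tt = tmul_tens[OF bl]
  show ?thesis
  proof
    fix u v assume "u \<in> TS E E'" "v \<in> TS E E'"
    then show "tmul mu nu u v \<in> TS E E'" by (intro tmul_closed[OF bl s] A.closed B.closed)
  next
    fix u assume u: "u \<in> TS E E'"
    show "tmul mu nu (tens e e') u = u"
      by (rule TS_linear_eq[OF u s blinD(1)[OF bT] lin_ident]) (simp add: tt A.unit_l B.unit_l)
    show "tmul mu nu u (tens e e') = u"
      by (rule TS_linear_eq[OF u s blinD(2)[OF bT] lin_ident]) (simp add: tt A.unit_r B.unit_r)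
  qed (auto intro!: bT sT tens_in_TS s A.unit B.unit)
qed

text \<open>Testing \<open>u\<close> against \<open>tens y e'\<close> and \<open>tens z e'\<close>
  applies an associator of the first factor to each column of \<open>u\<close>, so the columns are
  nuclear; the rows likewise. As membership in \<open>TS\<close> is a condition on slices, this is
  already the hard inclusion. The other one follows from pure tensors by trilinearity.\<close>

theorem nuc_tensor:
  assumes "unital_model mu E e" "unital_model nu E' e'"
  shows "nuc (tmul mu nu) (TS E E') = TS (nuc mu E) (nuc nu E')"
proof -
  interpret A: unital_model mu E e by fact
  interpret B: unital_model nu E' e' by fact
  let ?m = "tmul mu nu"
  note bl = A.bl B.bl and s = A.sub B.sub
  note bT = blin_tmul[of mu nu]
  note tt = tmul_tens[OF bl]
  note l = lin_assr[OF bT]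
  show ?thesis
  proof
    show "nuc ?m (TS E E') \<subseteq> TS A.N B.N"
    proof
      fix u assume u: "u \<in> nuc ?m (TS E E')"
      then have uT: "u \<in> TS E E'" by (auto simp: nuc_def)
      have te: "tens y e' \<in> TS E E'" if "y \<in> E" for y
        using that s B.unit by (auto intro: tens_in_TS)
      have et: "tens e y \<in> TS E E'" if "y \<in> E'" for y
        using that s A.unit by (auto intro: tens_in_TS)
      have c: "assr mu (cslice j u) y z = 0 \<and> assr mu y (cslice j u) z = 0 \<and> assr mu y z (cslice j u) = 0"
        if yz: "y \<in> E" "z \<in> E" for j y z
      proof -
        have "assr ?m u (tens y e') (tens z e') = tmap (\<lambda>x. assr mu x y z) (\<lambda>x. x) u"
          by (rule TS_linear_eq[OF uT s l(1) lin_tmap])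
            (simp add: tmap_tens lin_assr bl lin_ident, simp add: assr_def tt B.unit B.unit_r lin_diff[OF lin_tens(2)])
        moreover have "assr ?m (tens y e') u (tens z e') = tmap (\<lambda>x. assr mu y x z) (\<lambda>x. x) u"
          by (rule TS_linear_eq[OF uT s l(2) lin_tmap])
            (simp add: tmap_tens lin_assr bl lin_ident,
              simp add: assr_def tt B.unit B.unit_r B.unit_l B.closed lin_diff[OF lin_tens(2)])
        moreover have "assr ?m (tens y e') (tens z e') u = tmap (\<lambda>x. assr mu y z x) (\<lambda>x. x) u"
          by (rule TS_linear_eq[OF uT s l(3) lin_tmap])
            (simp add: tmap_tens lin_assr bl lin_ident,
              simp add: assr_def tt B.unit B.unit_r B.unit_l B.closed lin_diff[OF lin_tens(2)])
        ultimately show ?thesis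
          using u te[OF yz(1)] te[OF yz(2)] cslice_tmap_fst[OF lin_assr(1)[OF A.bl], of j y z u]
            cslice_tmap_fst[OF lin_assr(2)[OF A.bl], of j y z u] cslice_tmap_fst[OF lin_assr(3)[OF A.bl], of j y z u]
          by (simp add: nuc_def lin_0[OF lin_cslice])
      qed
      have r: "assr nu (rslice j u) y z = 0 \<and> assr nu y (rslice j u) z = 0 \<and> assr nu y z (rslice j u) = 0"
        if yz: "y \<in> E'" "z \<in> E'" for j y z
      proof -
        have "assr ?m u (tens e y) (tens e z) = tmap (\<lambda>x. x) (\<lambda>x. assr nu x y z) u"
          by (rule TS_linear_eq[OF uT s l(1) lin_tmap])
            (simp add: tmap_tens lin_assr bl lin_ident, simp add: assr_def tt A.unit A.unit_r lin_diff[OF lin_tens(1)])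
        moreover have "assr ?m (tens e y) u (tens e z) = tmap (\<lambda>x. x) (\<lambda>x. assr nu y x z) u"
          by (rule TS_linear_eq[OF uT s l(2) lin_tmap])
            (simp add: tmap_tens lin_assr bl lin_ident,
              simp add: assr_def tt A.unit A.unit_r A.unit_l A.closed lin_diff[OF lin_tens(1)])
        moreover have "assr ?m (tens e y) (tens e z) u = tmap (\<lambda>x. x) (\<lambda>x. assr nu y z x) u"
          by (rule TS_linear_eq[OF uT s l(3) lin_tmap])
            (simp add: tmap_tens lin_assr bl lin_ident,
              simp add: assr_def tt A.unit A.unit_r A.unit_l A.closed lin_diff[OF lin_tens(1)])
        ultimately show ?thesis
          using u et[OF yz(1)] et[OF yz(2)] rslice_tmap_snd[OF lin_assr(1)[OF B.bl], of j y z u]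
            rslice_tmap_snd[OF lin_assr(2)[OF B.bl], of j y z u] rslice_tmap_snd[OF lin_assr(3)[OF B.bl], of j y z u]
          by (simp add: nuc_def lin_0[OF lin_rslice])
      qed
      show "u \<in> TS A.N B.N"
        using c r uT by (auto simp: TS_def nuc_def)
    qed
  next
    show "TS A.N B.N \<subseteq> nuc ?m (TS E E')"
    proof
      fix u assume u: "u \<in> TS A.N B.N"
      note sN = A.subspace_nuc B.subspace_nuc
      have "assr ?m u v w = 0 \<and> assr ?m v u w = 0 \<and> assr ?m v w u = 0"
        if v: "v \<in> TS E E'" and w: "w \<in> TS E E'" for v w
      proof (intro conjI)
        have 0: "assr ?m (tens x x') (tens y y') (tens z z') = 0 \<and> assr ?m (tens y y') (tens x x') (tens z z') = 0
            \<and> assr ?m (tens y y') (tens z z') (tens x x') = 0"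
          if "x \<in> A.N" "x' \<in> B.N" "y \<in> E" "y' \<in> E'" "z \<in> E" "z' \<in> E'" for x x' y y' z z'
          using that by (simp add: assr_def tt A.nuc_assoc B.nuc_assoc)
        show "assr ?m u v w = 0"
        proof (rule TS_linear_eq[OF u sN l(1) lin_zero])
          fix x x' assume x: "x \<in> A.N" "x' \<in> B.N"
          show "assr ?m (tens x x') v w = 0"
          proof (rule TS_linear_eq[OF v s l(2) lin_zero])
            fix y y' assume y: "y \<in> E" "y' \<in> E'"
            show "assr ?m (tens x x') (tens y y') w = 0"
              by (rule TS_linear_eq[OF w s l(3) lin_zero]) (use 0 x y in auto)
          qed
        qed
        show "assr ?m v u w = 0"
        proof (rule TS_linear_eq[OF u sN l(2) lin_zero])
          fix x x' assume x: "x \<in> A.N" "x' \<in> B.N"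
          show "assr ?m v (tens x x') w = 0"
          proof (rule TS_linear_eq[OF v s l(1) lin_zero])
            fix y y' assume y: "y \<in> E" "y' \<in> E'"
            show "assr ?m (tens y y') (tens x x') w = 0"
              by (rule TS_linear_eq[OF w s l(3) lin_zero]) (use 0 x y in auto)
          qed
        qed
        show "assr ?m v w u = 0"
        proof (rule TS_linear_eq[OF u sN l(3) lin_zero])
          fix x x' assume x: "x \<in> A.N" "x' \<in> B.N"
          show "assr ?m v w (tens x x') = 0"
          proof (rule TS_linear_eq[OF v s l(1) lin_zero])
            fix y y' assume y: "y \<in> E" "y' \<in> E'"
            show "assr ?m (tens y y') w (tens x x') = 0"
              by (rule TS_linear_eq[OF w s l(2) lin_zero]) (use 0 x y in auto)
          qed
        qed
      qed
      moreover have "u \<in> TS E E'" using u TS_mono[OF A.nuc_subset B.nuc_subset] by auto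
      ultimately show "u \<in> nuc ?m (TS E E')" by (simp add: nuc_def)
    qed
  qed
qed


section \<open>Representing module records\<close>

text \<open>An isomorphism of the record onto the model \<open>E\<close>, with product
  \<open>mu\<close> and unit \<open>e\<close>. Of the record only closure is demanded; its group and
  module axioms are pulled back along \<open>h\<close>, so that subalgebra, quotient and tensor
  records are all treated alike.\<close>

locale alg_rep =
  fixes A :: "('f::field, 'a) module" (structure)
    and mu :: "('i \<Rightarrow>\<^sub>0 'f) \<Rightarrow> ('i \<Rightarrow>\<^sub>0 'f) \<Rightarrow> ('i \<Rightarrow>\<^sub>0 'f)" and E e h
  assumes bl: "blin mu" and sub: "V.subspace E" and bij: "bij_betw h (carrier A) E"
    and add_cl: "x \<in> carrier A \<Longrightarrow> y \<in> carrier A \<Longrightarrow> x \<oplus> y \<in> carrier A"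
    and mult_cl: "x \<in> carrier A \<Longrightarrow> y \<in> carrier A \<Longrightarrow> x \<otimes> y \<in> carrier A"
    and smult_cl: "x \<in> carrier A \<Longrightarrow> c \<odot> x \<in> carrier A"
    and zero_cl: "\<zero> \<in> carrier A" and one_cl: "\<one> \<in> carrier A"
    and h_add: "x \<in> carrier A \<Longrightarrow> y \<in> carrier A \<Longrightarrow> h (x \<oplus> y) = h x + h y"
    and h_mult: "x \<in> carrier A \<Longrightarrow> y \<in> carrier A \<Longrightarrow> h (x \<otimes> y) = mu (h x) (h y)"
    and h_smult: "x \<in> carrier A \<Longrightarrow> h (c \<odot> x) = scl c (h x)"
    and h_zero: "h \<zero> = 0" and h_one: "h \<one> = e"
begin

lemma h_mem: "x \<in> carrier A \<Longrightarrow> h x \<in> E"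
  using bij bij_betwE by blast

lemma h_eqI: "h x = h y \<Longrightarrow> x \<in> carrier A \<Longrightarrow> y \<in> carrier A \<Longrightarrow> x = y"
  using bij by (auto simp: bij_betw_def inj_on_def)

lemma h_surj: "v \<in> E \<Longrightarrow> \<exists>x\<in>carrier A. h x = v"
  using bij by (auto simp: bij_betw_def)

lemmas cl = add_cl mult_cl smult_cl zero_cl one_cl
lemmas hom = h_add h_mult h_smult h_zero h_one

lemma abelian_group: "abelian_group A"
proof (rule abelian_groupI)
  fix x assume "x \<in> carrier A"
  then show "\<exists>y\<in>carrier A. y \<oplus> x = \<zero>"
    by (intro bexI[of _ "(-1) \<odot> x"] h_eqI) (simp_all add: hom cl)
qed (auto intro!: h_eqI simp: hom cl algebra_simps)

sublocale abelian_group A by (rule abelian_group)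

lemma h_minus: "x \<in> carrier A \<Longrightarrow> y \<in> carrier A \<Longrightarrow> h (x \<ominus> y) = h x - h y"
  using h_add[of "x \<ominus> y" y] by (simp add: a_minus_def a_assoc l_neg)

lemma h_neg: "x \<in> carrier A \<Longrightarrow> h (\<ominus> x) = - h x"
  using h_add[of "\<ominus> x" x] by (simp add: l_neg h_zero eq_neg_iff_add_eq_0)

lemma module: "Module.module class_ring A"
  by (intro moduleI class_cring.is_cring abelian_group)
    (auto intro!: h_eqI simp: hom cl V.scale_left_distrib V.scale_right_distrib)

lemma h_finsum: "finite S \<Longrightarrow> (\<And>i. i \<in> S \<Longrightarrow> f i \<in> carrier A) \<Longrightarrow> h (\<Oplus>i\<in>S. f i) = (\<Sum>i\<in>S. h (f i))"
  by (induction S rule: finite_induct) (simp_all add: hom finsum_insert Pi_def)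

lemma image_span:
  assumes S: "S \<subseteq> carrier A"
  shows "h ` LinearCombinations.module.span class_ring A S = V.span (h ` S)"
proof -
  interpret M: Module.module class_ring A by (rule module)
  let ?sp = "LinearCombinations.module.span class_ring A S"
  have sp: "LinearCombinations.submodule class_ring ?sp A" by (rule M.span_is_submodule[OF S])
  then have spc: "?sp \<subseteq> carrier A" by (simp add: LinearCombinations.submodule_def)
  show ?thesis
  proof
    have "LinearCombinations.submodule class_ring {x \<in> carrier A. h x \<in> V.span (h ` S)} A"
      by (intro LinearCombinations.submodule.intro module)
        (auto simp: hom cl V.span_zero V.span_add V.span_scale)
    then have "?sp \<subseteq> {x \<in> carrier A. h x \<in> V.span (h ` S)}"
      using S by (intro M.span_is_subset) (auto intro: V.span_base)
    then show "h ` ?sp \<subseteq> V.span (h ` S)" by auto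
    show "V.span (h ` S) \<subseteq> h ` ?sp"
    proof (rule V.span_minimal)
      show "h ` S \<subseteq> h ` ?sp" using M.in_own_span[OF S] by auto
      show "V.subspace (h ` ?sp)"
      proof (rule V.subspaceI)
        show "0 \<in> h ` ?sp"
          using sp h_zero by (auto simp: LinearCombinations.submodule_def intro!: image_eqI[of _ _ \<zero>])
      next
        fix x y assume "x \<in> h ` ?sp" "y \<in> h ` ?sp"
        then obtain x' y' where *: "x' \<in> ?sp" "y' \<in> ?sp" "x = h x'" "y = h y'" by auto
        then have "x' \<oplus> y' \<in> ?sp" using sp by (auto simp: LinearCombinations.submodule_def)
        then show "x + y \<in> h ` ?sp"
          using * spc by (intro image_eqI[of _ _ "x' \<oplus> y'"]) (auto simp: hom subset_iff)
      next
        fix c x assume "x \<in> h ` ?sp"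
        then obtain x' where *: "x' \<in> ?sp" "x = h x'" by auto
        then have "c \<odot> x' \<in> ?sp" using sp by (auto simp: LinearCombinations.submodule_def)
        then show "scl c x \<in> h ` ?sp"
          using * spc by (intro image_eqI[of _ _ "c \<odot> x'"]) (auto simp: hom subset_iff)
      qed
    qed
  qed
qed

lemma image_set_add:
  assumes "X \<subseteq> carrier A" "Y \<subseteq> carrier A"
  shows "h ` (X <+> Y) = ssum (h ` X) (h ` Y)"
proof
  show "h ` (X <+> Y) \<subseteq> ssum (h ` X) (h ` Y)"
    using assms by (fastforce simp: set_add_def' ssum_def h_add subset_iff)
  show "ssum (h ` X) (h ` Y) \<subseteq> h ` (X <+> Y)"
  proof
    fix z assume "z \<in> ssum (h ` X) (h ` Y)"
    then obtain x y where *: "x \<in> X" "y \<in> Y" "z = h x + h y" by (auto simp: ssum_def)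
    then show "z \<in> h ` (X <+> Y)"
      using assms by (intro image_eqI[of _ _ "x \<oplus> y"]) (auto simp: h_add set_add_def' subset_iff)
  qed
qed

section \<open>Nucleus, left ideals and radical of a record, read in its model\<close>

lemma h_associator:
  assumes "x \<in> carrier A" "y \<in> carrier A" "z \<in> carrier A"
  shows "h (associator A x y z) = assr mu (h x) (h y) (h z)"
  using assms by (simp add: associator_def assr_def h_minus hom cl)

lemma associator_zero_iff:
  assumes "x \<in> carrier A" "y \<in> carrier A" "z \<in> carrier A"
  shows "associator A x y z = \<zero> \<longleftrightarrow> assr mu (h x) (h y) (h z) = 0"
proof -
  have "associator A x y z \<in> carrier A" using assms by (simp add: associator_def cl)
  then show ?thesis using h_associator[OF assms] h_eqI[of "associator A x y z" \<zero>] h_zero zero_cl by metis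
qed

lemma ball_h: "(\<forall>v\<in>E. P v) \<longleftrightarrow> (\<forall>x\<in>carrier A. P (h x))"
  using bij by (auto simp: bij_betw_def)

lemma nucleus_iff: "x \<in> nucleus A \<longleftrightarrow> x \<in> carrier A \<and> h x \<in> nuc mu E"
  by (auto simp: nucleus_def nuc_def ball_h h_mem associator_zero_iff)

lemma image_nucleus: "h ` nucleus A = nuc mu E"
proof
  show "nuc mu E \<subseteq> h ` nucleus A"
  proof
    fix v assume v: "v \<in> nuc mu E"
    then obtain x where "x \<in> carrier A" "h x = v" using h_surj[of v] by (auto simp: nuc_def)
    then show "v \<in> h ` nucleus A" using v nucleus_iff by auto
  qed
qed (use nucleus_iff in auto)

lemma alg_rep_subalgebra:
  assumes C: "C \<subseteq> carrier A" and s: "V.subspace (h ` C)" "e \<in> h ` C"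
    "\<And>x y. x \<in> h ` C \<Longrightarrow> y \<in> h ` C \<Longrightarrow> mu x y \<in> h ` C"
  shows "alg_rep (A\<lparr>carrier := C\<rparr>) mu (h ` C) e h"
proof -
  have mem: "x \<in> C \<longleftrightarrow> h x \<in> h ` C" if "x \<in> carrier A" for x
    using that C h_eqI by blast
  show ?thesis
  proof
    show "bij_betw h (carrier (A\<lparr>carrier := C\<rparr>)) (h ` C)"
      using bij C by (auto simp: bij_betw_def intro: inj_on_subset)
  qed (use C s in \<open>auto simp: hom mem cl subset_iff bl V.subspace_0 V.subspace_add V.subspace_scale\<close>)
qed

lemma left_ideal_iff:
  "left_ideal I A \<longleftrightarrow> I \<subseteq> carrier A \<and> lideal mu E (h ` I)"
proof
  assume I: "left_ideal I A"
  then interpret additive_subgroup I A by (simp add: left_ideal_def)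
  have c: "I \<subseteq> carrier A" using a_subset .
  have "r \<otimes> x \<in> I" if "r \<in> carrier A" "x \<in> I" for r x using I that by (simp add: left_ideal_def)
  then have "lideal mu E (h ` I)"
    unfolding lideal_def ball_h
    using c zero_closed h_mem h_zero h_add[symmetric] h_neg[symmetric] h_mult[symmetric] a_closed a_inv_closed
    by (auto simp: subset_iff image_iff)
  then show "I \<subseteq> carrier A \<and> lideal mu E (h ` I)" using c by simp
next
  assume I: "I \<subseteq> carrier A \<and> lideal mu E (h ` I)"
  then have mem: "x \<in> I \<longleftrightarrow> h x \<in> h ` I" if "x \<in> carrier A" for x
    using that h_eqI by blast
  have "additive_subgroup I A"
    using I by (intro additive_subgroup.intro subgroup.intro)
      (auto simp: mem hom cl subset_iff lideal_def h_neg a_inv_def[symmetric])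
  then show "left_ideal I A"
    using I by (auto simp: left_ideal_def mem hom cl subset_iff lideal_def h_mem)
qed

lemma maximal_left_ideal_iff:
  "maximal_left_ideal I A \<longleftrightarrow> I \<subseteq> carrier A \<and> mlideal mu E (h ` I)"
proof -
  have E: "h ` carrier A = E" using bij by (simp add: bij_betw_def)
  have inj_sub: "h ` X \<subseteq> h ` Y \<longleftrightarrow> X \<subseteq> Y" if "X \<subseteq> carrier A" "Y \<subseteq> carrier A" for X Y
    using that h_eqI by blast
  then have inj_eq: "h ` X = h ` Y \<longleftrightarrow> X = Y" if "X \<subseteq> carrier A" "Y \<subseteq> carrier A" for X Y
    using that by (metis order_antisym order_refl)
  note inj = inj_sub inj_eq
  \<comment> \<open>Every left ideal of the model is the image of a subset of the carrier, so
    maximality can be tested on either side.\<close>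
  have all: "(\<forall>L. lideal mu E L \<longrightarrow> P L) \<longleftrightarrow> (\<forall>X. X \<subseteq> carrier A \<and> lideal mu E (h ` X) \<longrightarrow> P (h ` X))" for P
  proof safe
    fix L assume *: "\<forall>X. X \<subseteq> carrier A \<and> lideal mu E (h ` X) \<longrightarrow> P (h ` X)" "lideal mu E L"
    then have "L \<subseteq> h ` carrier A" using E by (simp add: lideal_def)
    then obtain X where "X \<subseteq> carrier A" "L = h ` X" by (auto simp: subset_image_iff)
    then show "P L" using * by auto
  qed auto
  show ?thesis
  proof (cases "I \<subseteq> carrier A")
    case I: True
    have "(left_ideal L A \<and> I \<subseteq> L \<longrightarrow> L = I \<or> L = carrier A) \<longleftrightarrow>
        (L \<subseteq> carrier A \<and> lideal mu E (h ` L) \<longrightarrow> h ` I \<subseteq> h ` L \<longrightarrow> h ` L = h ` I \<or> h ` L = E)" for L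
    proof (cases "L \<subseteq> carrier A")
      case True
      then show ?thesis
        using inj_sub[OF I True] inj_eq[OF True I] inj_eq[OF True order_refl] E by (simp add: left_ideal_iff imp_conjL)
    qed (simp add: left_ideal_iff)
    then have "(\<forall>L. left_ideal L A \<and> I \<subseteq> L \<longrightarrow> L = I \<or> L = carrier A) \<longleftrightarrow>
        (\<forall>L. lideal mu E L \<and> h ` I \<subseteq> L \<longrightarrow> L = h ` I \<or> L = E)"
      using all[of "\<lambda>L. h ` I \<subseteq> L \<longrightarrow> L = h ` I \<or> L = E"] by (simp only: imp_conjL)
    moreover have "I \<noteq> carrier A \<longleftrightarrow> h ` I \<noteq> E" using inj_eq[OF I order_refl] E by simp
    ultimately show ?thesis using I by (simp add: maximal_left_ideal_def mlideal_def left_ideal_iff)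
  qed (simp add: maximal_left_ideal_def left_ideal_iff)
qed

lemma jacobson_iff: "x \<in> jacobson_radical A \<longleftrightarrow> x \<in> carrier A \<and> h x \<in> jac mu E"
proof (cases "x \<in> carrier A")
  case x: True
  have E: "h ` carrier A = E" using bij by (simp add: bij_betw_def)
  have "(\<forall>I. maximal_left_ideal I A \<longrightarrow> x \<in> I) \<longleftrightarrow> (\<forall>M. mlideal mu E M \<longrightarrow> h x \<in> M)"
  proof safe
    fix M assume *: "\<forall>I. maximal_left_ideal I A \<longrightarrow> x \<in> I" "mlideal mu E M"
    then have "M \<subseteq> h ` carrier A" using E by (simp add: mlideal_def lideal_def)
    then obtain X where "X \<subseteq> carrier A" "M = h ` X" by (auto simp: subset_image_iff)
    then show "h x \<in> M" using * maximal_left_ideal_iff by auto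
  next
    fix I assume *: "\<forall>M. mlideal mu E M \<longrightarrow> h x \<in> M" "maximal_left_ideal I A"
    then have "h x \<in> h ` I" "I \<subseteq> carrier A" using maximal_left_ideal_iff by auto
    then show "x \<in> I" using x h_eqI by blast
  qed
  then show ?thesis using x h_mem by (auto simp: jacobson_radical_def jac_def)
qed (auto simp: jacobson_radical_def)

lemma image_jacobson: "h ` jacobson_radical A = jac mu E"
proof
  show "jac mu E \<subseteq> h ` jacobson_radical A"
  proof
    fix v assume v: "v \<in> jac mu E"
    then obtain x where "x \<in> carrier A" "h x = v" using h_surj[of v] by (auto simp: jac_def)
    then show "v \<in> h ` jacobson_radical A" using v jacobson_iff by auto
  qed
qed (use jacobson_iff in auto)

end

text \<open>The source of the final isomorphism: no explicit map between the two sides is needed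
  there, only a common model.\<close>

lemma alg_isomorphic_reps:
  assumes "alg_rep A mu E e h" "alg_rep B mu E e k"
  shows "alg_isomorphic A B"
proof -
  interpret A: alg_rep A mu E e h by fact
  interpret B: alg_rep B mu E e k by fact
  define g where "g = (\<lambda>x. inv_into (carrier B) k (h x))"
  have bij: "bij_betw g (carrier A) (carrier B)"
    unfolding g_def using bij_betw_trans[OF A.bij bij_betw_inv_into[OF B.bij]] by (simp add: comp_def)
  have g: "g x \<in> carrier B" "k (g x) = h x" if "x \<in> carrier A" for x
    using that bij B.bij A.h_mem by (auto simp: bij_betwE g_def bij_betw_def intro!: f_inv_into_f)
  have "g \<in> Ring.ring_hom A B"
    by (rule ring_hom_memI) (auto intro!: B.h_eqI simp: g A.cl B.cl A.hom B.hom)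
  moreover have "g (c \<odot>\<^bsub>A\<^esub> x) = c \<odot>\<^bsub>B\<^esub> g x" if "x \<in> carrier A" for c x
    using that by (intro B.h_eqI) (simp_all add: g A.cl B.cl A.hom B.hom)
  ultimately show ?thesis using bij unfolding alg_isomorphic_def ring_iso_def by blast
qed

section \<open>Quotient records\<close>

lemma quot_alg_simps:
  "carrier (quot_alg A I) = (\<Union>a\<in>carrier A. {I +>\<^bsub>A\<^esub> a})"
  "mult (quot_alg A I) = rcoset_mult A I"
  "one (quot_alg A I) = I +>\<^bsub>A\<^esub> \<one>\<^bsub>A\<^esub>"
  "zero (quot_alg A I) = I"
  "add (quot_alg A I) = set_add A"
  "module.smult (quot_alg A I) c X = (\<Union>x\<in>X. I +>\<^bsub>A\<^esub> (c \<odot>\<^bsub>A\<^esub> x))"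
  by (simp_all add: quot_alg_def ring.extend_def module.fields_def FactRing_def A_RCOSETS_def')

text \<open>The cosets of the kernel of \<open>k\<close> are its fibres.\<close>
lemma alg_rep_quotient:
  fixes A :: "('f::field, 'a) module" (structure)
  assumes ag: "abelian_group A" and bl: "blin mu"
    and cl: "\<And>x y. x \<in> carrier A \<Longrightarrow> y \<in> carrier A \<Longrightarrow> x \<otimes> y \<in> carrier A"
      "\<And>c x. x \<in> carrier A \<Longrightarrow> c \<odot> x \<in> carrier A" "\<one> \<in> carrier A"
    and k_add: "\<And>x y. x \<in> carrier A \<Longrightarrow> y \<in> carrier A \<Longrightarrow> k (x \<oplus> y) = k x + k y"
    and k_mult: "\<And>x y. x \<in> carrier A \<Longrightarrow> y \<in> carrier A \<Longrightarrow> k (x \<otimes> y) = mu (k x) (k y)"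
    and k_smult: "\<And>c x. x \<in> carrier A \<Longrightarrow> k (c \<odot> x) = scl c (k x)"
    and k_one: "k \<one> = e" and I: "I = {x \<in> carrier A. k x = 0}" and E: "E = k ` carrier A"
  shows "alg_rep (quot_alg A I) mu E e (\<lambda>X. k (SOME x. x \<in> X))"
    and "x \<in> carrier A \<Longrightarrow> k (SOME z. z \<in> I +> x) = k x"
proof -
  interpret abelian_group A by (rule ag)
  have k_zero: "k \<zero> = 0" using k_add[of \<zero> \<zero>] by simp
  have k_minus: "k (x \<ominus> y) = k x - k y" if "x \<in> carrier A" "y \<in> carrier A" for x y
    using k_add[of "x \<ominus> y" y] that by (simp add: a_minus_def a_assoc l_neg)
  have coset: "I +> x = {z \<in> carrier A. k z = k x}" if x: "x \<in> carrier A" for x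
  proof safe
    fix z assume "z \<in> I +> x"
    then show "z \<in> carrier A" "k z = k x" using x by (auto simp: a_r_coset_def' I k_add)
  next
    fix z assume z: "z \<in> carrier A" "k z = k x"
    then have "z \<ominus> x \<in> I" using x by (simp add: I k_minus)
    moreover have "z = (z \<ominus> x) \<oplus> x" using x z by (simp add: a_minus_def a_assoc l_neg)
    ultimately show "z \<in> I +> x" by (auto simp: a_r_coset_def')
  qed
  \<comment> \<open>Any representative does, since \<open>k\<close> is constant on cosets.\<close>
  define K where "K X = k (SOME x. x \<in> X)" for X
  have K: "K (I +> x) = k x" if "x \<in> carrier A" for x
  proof -
    have "(SOME z. z \<in> I +> x) \<in> I +> x" by (rule someI[of _ x]) (simp add: coset that)
    then show ?thesis by (simp add: coset that K_def)
  qed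
  then show "x \<in> carrier A \<Longrightarrow> k (SOME z. z \<in> I +> x) = k x" by (simp add: K_def)
  let ?Q = "quot_alg A I"
  have car: "X \<in> carrier ?Q \<longleftrightarrow> (\<exists>x\<in>carrier A. X = I +> x)" for X by (auto simp: quot_alg_simps)
  have add: "(I +> x) \<oplus>\<^bsub>?Q\<^esub> (I +> y) = I +> (x \<oplus> y)" if xy: "x \<in> carrier A" "y \<in> carrier A" for x y
  proof -
    have "z \<in> (\<Union>a\<in>I +> x. \<Union>b\<in>I +> y. {a \<oplus> b})" if z: "z \<in> carrier A" "k z = k x + k y" for z
    proof -
      have "z = (z \<ominus> y) \<oplus> y" using z xy by (simp add: a_minus_def a_assoc l_neg)
      moreover have "z \<ominus> y \<in> I +> x" "y \<in> I +> y" using z xy by (simp_all add: coset k_minus)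
      ultimately show ?thesis by blast
    qed
    moreover have "a \<oplus> b \<in> I +> (x \<oplus> y)" if "a \<in> I +> x" "b \<in> I +> y" for a b
      using that xy by (simp add: coset k_add)
    ultimately have "(\<Union>a\<in>I +> x. \<Union>b\<in>I +> y. {a \<oplus> b}) = I +> (x \<oplus> y)"
      using xy by (fastforce simp: coset[of "x \<oplus> y"] k_add)
    then show ?thesis by (simp add: quot_alg_simps set_add_def')
  qed
  have mult: "(I +> x) \<otimes>\<^bsub>?Q\<^esub> (I +> y) = I +> (x \<otimes> y)" if xy: "x \<in> carrier A" "y \<in> carrier A" for x y
  proof -
    have "I +> (a \<otimes> b) = I +> (x \<otimes> y)" if "a \<in> I +> x" "b \<in> I +> y" for a b
      using that xy by (auto simp: coset cl k_mult)
    moreover have "x \<in> I +> x" "y \<in> I +> y" using xy by (auto simp: coset)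
    ultimately have "(\<Union>a\<in>I +> x. \<Union>b\<in>I +> y. I +> (a \<otimes> b)) = I +> (x \<otimes> y)" by blast
    then show ?thesis by (simp add: quot_alg_simps rcoset_mult_def)
  qed
  have smult: "c \<odot>\<^bsub>?Q\<^esub> (I +> x) = I +> (c \<odot> x)" if x: "x \<in> carrier A" for c x
  proof -
    have "I +> (c \<odot> a) = I +> (c \<odot> x)" if "a \<in> I +> x" for a
      using that x by (auto simp: coset cl k_smult)
    moreover have "x \<in> I +> x" using x by (auto simp: coset)
    ultimately have "(\<Union>a\<in>I +> x. I +> (c \<odot> a)) = I +> (c \<odot> x)" by blast
    then show ?thesis by (simp add: quot_alg_simps)
  qed
  have zero: "\<zero>\<^bsub>?Q\<^esub> = I +> \<zero>" using k_zero by (auto simp: quot_alg_simps coset I)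
  have "alg_rep ?Q mu E e K"
  proof
    show "V.subspace E"
    proof (rule V.subspaceI)
      show "0 \<in> E" using k_zero by (auto simp: E intro!: image_eqI[of _ _ \<zero>])
      fix c x y assume "x \<in> E"
      then show "scl c x \<in> E" using cl by (auto simp: E k_smult[symmetric])
      assume "y \<in> E"
      then show "x + y \<in> E" using \<open>x \<in> E\<close> by (auto simp: E k_add[symmetric])
    qed
    show "bij_betw K (carrier ?Q) E"
    proof (rule bij_betw_imageI)
      show "inj_on K (carrier ?Q)" 
      proof (rule inj_onI)
        fix X Y assume XY: "X \<in> carrier ?Q" "Y \<in> carrier ?Q" "K X = K Y"
        then obtain x y where "x \<in> carrier A" "y \<in> carrier A" "X = I +> x" "Y = I +> y" by (auto simp: car)
        then show "X = Y" using XY(3) K coset by simp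
      qed
      have "carrier ?Q = (\<lambda>x. I +> x) ` carrier A" by (auto simp: car)
      then show "K ` carrier ?Q = E" by (simp add: image_image E K cong: image_cong)
    qed
  qed (use bl in \<open>auto simp: car add mult smult zero K k_add k_mult k_smult k_zero k_one cl quot_alg_simps(3)\<close>)
  then show "alg_rep ?Q mu E e (\<lambda>X. k (SOME x. x \<in> X))" by (simp add: K_def[abs_def])
qed

section \<open>Coordinates for a finite-dimensional algebra\<close>

lemma pm_in_subspace:
  fixes v :: "'i \<Rightarrow>\<^sub>0 'f::field"
  assumes "V.subspace P" "\<And>i. i \<in> keys v \<Longrightarrow> sgl i \<in> P"
  shows "v \<in> P"
  by (subst pm_expand, intro V.subspace_sum V.subspace_scale assms)

lemma subspace_keys: "V.subspace {u :: 'i \<Rightarrow>\<^sub>0 'f::field. keys u \<subseteq> S}"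
proof (rule V.subspaceI)
  fix x y :: "'i \<Rightarrow>\<^sub>0 'f" assume "x \<in> {u. keys u \<subseteq> S}" "y \<in> {u. keys u \<subseteq> S}"
  then show "x + y \<in> {u. keys u \<subseteq> S}" using Poly_Mapping.keys_add[of x y] by blast
qed (auto simp: in_keys_iff)

text \<open>Coordinates with respect to a finite basis \<open>Bs\<close>, whose elements serve as
  their own indices: \<open>E\<close> consists of the functions supported on \<open>Bs\<close>, and
  \<open>h\<close> inverts the linear combination map \<open>g\<close>.\<close>

lemma alg_rep_exists:
  fixes A :: "('f::field, 'a) module" (structure)
  assumes "unital_algebra A" "vectorspace.fin_dim class_ring A"
  obtains mu E e and h :: "'a \<Rightarrow> ('a \<Rightarrow>\<^sub>0 'f)" where "alg_rep A mu E e h" "unital_model mu E e"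
proof -
  interpret A: unital_algebra A by fact
  obtain Bs where Bs: "finite Bs" "A.basis Bs" using A.finite_basis_exists[OF assms(2)] by auto
  have Bc: "Bs \<subseteq> carrier A" using Bs by (simp add: A.basis_def)
  have uniq: "\<exists>!a. a \<in> Bs \<rightarrow>\<^sub>E UNIV \<and> A.lincomb a Bs = v" if "v \<in> carrier A" for v
    using A.basis_criterion[OF Bs(1) Bc] Bs(2) that by simp
  define E where "E = {u :: 'a \<Rightarrow>\<^sub>0 'f. keys u \<subseteq> Bs}"
  define g where "g u = A.lincomb (lookup u) Bs" for u
  have sE: "V.subspace E" unfolding E_def by (rule subspace_keys)
  have g_cl: "g u \<in> carrier A" for u unfolding g_def using Bc by (intro A.lincomb_closed) auto
  have g_add: "g (u + v) = g u \<oplus> g v" for u v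
    using A.lincomb_sum[OF Bs(1) Bc, of "lookup u" "lookup v"] by (simp add: g_def lookup_add[abs_def])
  have g_scl: "g (scl c u) = c \<odot> g u" for c u
  proof -
    have "lookup (scl c u) = (\<lambda>b. c * lookup u b)" by (rule ext) simp
    then show ?thesis using A.lincomb_smult[OF Bc, of "lookup u" c] by (simp add: g_def)
  qed
  have inj: "u = v" if uv: "u \<in> E" "v \<in> E" "g u = g v" for u v
  proof -
    \<comment> \<open>\<open>uniq\<close> concerns coefficient functions that are undefined off
      \<open>Bs\<close>, hence the restrictions.\<close>
    have "A.lincomb (restrict (lookup w) Bs) Bs = g w" for w
      unfolding g_def using Bc by (intro A.lincomb_cong) auto
    then have "A.lincomb (restrict (lookup u) Bs) Bs = g u" "A.lincomb (restrict (lookup v) Bs) Bs = g u"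
      using uv by auto
    moreover have "restrict (lookup u) Bs \<in> Bs \<rightarrow>\<^sub>E UNIV" "restrict (lookup v) Bs \<in> Bs \<rightarrow>\<^sub>E UNIV" by auto
    ultimately have eq: "restrict (lookup u) Bs = restrict (lookup v) Bs" using uniq[OF g_cl[of u]] by blast
    show ?thesis
    proof (rule poly_mapping_eqI)
      fix b
      show "lookup u b = lookup v b"
      proof (cases "b \<in> Bs")
        case True
        then show ?thesis using fun_cong[OF eq, of b] by simp
      next
        case False
        then have "b \<notin> keys u" "b \<notin> keys v" using uv by (auto simp: E_def)
        then show ?thesis by (simp add: in_keys_iff)
      qed
    qed
  qed
  have surj: "\<exists>u\<in>E. g u = v" if v: "v \<in> carrier A" for v
  proof -
    obtain a where a: "A.lincomb a Bs = v" using uniq[OF v] by blast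
    have "finite {b. (if b \<in> Bs then a b else 0) \<noteq> 0}"
      by (rule finite_subset[OF _ Bs(1)]) auto
    then have l: "lookup (Abs_poly_mapping (\<lambda>b. if b \<in> Bs then a b else 0)) = (\<lambda>b. if b \<in> Bs then a b else 0)"
      by (rule lookup_Abs_poly_mapping)
    have "g (Abs_poly_mapping (\<lambda>b. if b \<in> Bs then a b else 0)) = v"
      unfolding g_def l a[symmetric] using Bc by (intro A.lincomb_cong) auto
    moreover have "Abs_poly_mapping (\<lambda>b. if b \<in> Bs then a b else 0) \<in> E"
      by (auto simp: E_def in_keys_iff l split: if_splits)
    ultimately show ?thesis by blast
  qed
  have bij: "bij_betw g E (carrier A)"
  proof (rule bij_betw_imageI)
    show "inj_on g E" using inj by (auto simp: inj_on_def)
    show "g ` E = carrier A" using g_cl surj by blast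
  qed
  define h where "h = inv_into E g"
  have bij': "bij_betw h (carrier A) E" unfolding h_def by (rule bij_betw_inv_into[OF bij])
  have gh: "g (h x) = x" if "x \<in> carrier A" for x
    using bij_betw_inv_into_right[OF bij that] by (simp add: h_def)
  have hE: "h x \<in> E" if "x \<in> carrier A" for x using bij' that by (auto simp: bij_betw_def)
  have sm0: "0 \<odot> x = \<zero>" if "x \<in> carrier A" for x using A.smult_l_null[OF that] by simp
  have sm1: "1 \<odot> x = x" if "x \<in> carrier A" for x using A.smult_one[OF that] by simp
  have g0: "g 0 = \<zero>" using g_scl[of 0 0] sm0[OF g_cl[of 0]] by simp
  have g_sgl: "g (sgl i) = i" if i: "i \<in> Bs" for i
  proof -
    have "g (sgl i) = (\<Oplus>b\<in>Bs. if i = b then b else \<zero>)"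
      unfolding g_def A.lincomb_def using Bc
      by (intro A.M.finsum_cong') (auto simp: lookup_single when_def subset_iff sm0 sm1)
    then show ?thesis using A.M.finsum_singleton[OF i Bs(1), of "\<lambda>b. b"] Bc by auto
  qed
  \<comment> \<open>The product of basis vectors, extended to all functions. Indices off
    \<open>Bs\<close> contribute arbitrary values, which matter only for arguments outside
    \<open>E\<close>.\<close>
  define mu where "mu u v = lext (\<lambda>i. lext (\<lambda>j. h (i \<otimes> j)) v) u" for u v
  have bl: "blin mu"
    unfolding blin_def mu_def by (auto intro: lin_lext lin_lext_param)
  have muE: "mu u v \<in> E" if "u \<in> E" "v \<in> E" for u v
    unfolding mu_def lext_def using that Bc
    by (intro V.subspace_sum V.subspace_scale sE hE A.mult_closed) (auto simp: E_def)
  have zero_mult: "\<zero> \<otimes> x = \<zero>" "x \<otimes> \<zero> = \<zero>" if "x \<in> carrier A" for x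
    using that A.smult_mult[of \<zero> x 0] A.mult_smult[of x \<zero> 0] A.mult_closed by (auto simp: sm0)
  have "g (mu u (sgl j)) = g u \<otimes> j" if u: "u \<in> E" and j: "j \<in> Bs" for u j
  proof -
    have jc: "j \<in> carrier A" using j Bc by auto
    have "u \<in> {u \<in> E. g (mu u (sgl j)) = g u \<otimes> j}"
    proof (rule pm_in_subspace)
      show "V.subspace {u \<in> E. g (mu u (sgl j)) = g u \<otimes> j}"
        using sE jc by (auto intro!: V.subspaceI simp: V.subspace_0 V.subspace_add V.subspace_scale
          lin_0[OF blinD(2)[OF bl]] lin_add[OF blinD(2)[OF bl]] lin_scl[OF blinD(2)[OF bl]]
          g0 g_add g_scl zero_mult g_cl A.add_mult A.smult_mult)
      fix i assume "i \<in> keys u"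
      then have i: "i \<in> Bs" "i \<in> carrier A" using u Bc by (auto simp: E_def)
      then show "sgl i \<in> {u \<in> E. g (mu u (sgl j)) = g u \<otimes> j}"
        using jc by (simp add: E_def mu_def gh A.mult_closed g_sgl)
    qed
    then show ?thesis by simp
  qed note g_mu1 = this
  have g_mu: "g (mu u v) = g u \<otimes> g v" if u: "u \<in> E" and v: "v \<in> E" for u v
  proof -
    have "v \<in> {v \<in> E. g (mu u v) = g u \<otimes> g v}"
    proof (rule pm_in_subspace)
      show "V.subspace {v \<in> E. g (mu u v) = g u \<otimes> g v}"
        using sE by (auto intro!: V.subspaceI simp: V.subspace_0 V.subspace_add V.subspace_scale
          lin_0[OF blinD(1)[OF bl]] lin_add[OF blinD(1)[OF bl]] lin_scl[OF blinD(1)[OF bl]]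
          g0 g_add g_scl zero_mult g_cl A.mult_add A.mult_smult)
      fix j assume "j \<in> keys v"
      then have "j \<in> Bs" using v by (auto simp: E_def)
      then show "sgl j \<in> {v \<in> E. g (mu u v) = g u \<otimes> g v}"
        using g_mu1[OF u] g_sgl by (simp add: E_def)
    qed
    then show ?thesis by simp
  qed
  have rep: "alg_rep A mu E (h \<one>) h"
  proof
    fix x y c assume x: "x \<in> carrier A"
    show "h (c \<odot> x) = scl c (h x)"
      using x by (intro inj) (auto simp: gh g_scl hE V.subspace_scale sE)
    assume y: "y \<in> carrier A"
    show "h (x \<oplus> y) = h x + h y"
      using x y by (intro inj) (auto simp: gh g_add hE V.subspace_add sE)
    show "h (x \<otimes> y) = mu (h x) (h y)"
      using x y by (intro inj) (auto simp: gh g_mu hE muE A.mult_closed)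
  next
    show "h \<zero> = 0" by (intro inj) (auto simp: gh g0 hE V.subspace_0 sE)
  qed (auto simp: bl sE bij' A.mult_closed A.one_in_carrier)
  moreover have "unital_model mu E (h \<one>)"
  proof
    fix x assume x: "x \<in> E"
    show "mu (h \<one>) x = x" "mu x (h \<one>) = x"
      using x by (auto intro!: inj simp: muE hE g_mu gh A.one_in_carrier A.one_mult A.mult_one g_cl)
  qed (auto simp: bl sE muE hE A.one_in_carrier)
  ultimately show ?thesis using that by blast
qed


section \<open>Representing tensor products and quotients\<close>

text \<open>Formal pairs such as \<open>sgl (hi v, y)\<close> depend on \<open>v\<close> linearly
  only up to bilinearity relations. Modulo those, such a map is still determined by its values on
  the basis.\<close>

lemma lin_modulo:
  assumes R: "V.subspace R" and add: "\<And>v w. F (v + w) - (F v + F w) \<in> R"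
    and scale: "\<And>c v. F (scl c v) - scl c (F v) \<in> R"
  shows "F v - lext (\<lambda>i. F (sgl i)) v \<in> R"
proof -
  let ?L = "lext (\<lambda>i. F (sgl i))"
  have "v \<in> {v. F v - ?L v \<in> R}"
  proof (rule pm_in_subspace)
    show "V.subspace {v. F v - ?L v \<in> R}"
    proof (rule V.subspaceI)
      show "0 \<in> {v. F v - ?L v \<in> R}" using scale[of 0 0] by (simp add: lin_0[OF lin_lext])
    next
      fix x y assume "x \<in> {v. F v - ?L v \<in> R}" "y \<in> {v. F v - ?L v \<in> R}"
      then have "(F (x + y) - (F x + F y)) + ((F x - ?L x) + (F y - ?L y)) \<in> R"
        using add by (intro V.subspace_add[OF R]) auto
      then show "x + y \<in> {v. F v - ?L v \<in> R}" by (simp add: lin_add[OF lin_lext] algebra_simps)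
    next
      fix c x assume "x \<in> {v. F v - ?L v \<in> R}"
      then have "(F (scl c x) - scl c (F x)) + scl c (F x - ?L x) \<in> R"
        using scale by (intro V.subspace_add[OF R] V.subspace_scale[OF R]) auto
      then show "scl c x \<in> {v. F v - ?L v \<in> R}"
        by (simp add: lin_scl[OF lin_lext] V.scale_right_diff_distrib)
    qed
  qed (simp add: V.subspace_0 R)
  then show ?thesis by simp
qed

lemma alg_rep_pair:
  assumes "alg_rep A mu E e h" "alg_rep B nu E' e' k"
  shows "alg_rep (pair_alg A B)
    (\<lambda>f g. lext (\<lambda>p. lext (\<lambda>q. sgl (fst p \<otimes>\<^bsub>A\<^esub> fst q, snd p \<otimes>\<^bsub>B\<^esub> snd q)) g) f)
    {f. keys f \<subseteq> carrier A \<times> carrier B} (sgl (\<one>\<^bsub>A\<^esub>, \<one>\<^bsub>B\<^esub>)) (\<lambda>f. f)"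
proof -
  interpret A: alg_rep A mu E e h by fact
  interpret B: alg_rep B nu E' e' k by fact
  let ?C = "{f :: _ \<Rightarrow>\<^sub>0 'b. keys f \<subseteq> carrier A \<times> carrier B}"
  let ?m = "\<lambda>f g. lext (\<lambda>p. lext (\<lambda>q. sgl (fst p \<otimes>\<^bsub>A\<^esub> fst q, snd p \<otimes>\<^bsub>B\<^esub> snd q)) g) f"
  have s: "V.subspace ?C" by (rule subspace_keys)
  have mult: "mult (pair_alg A B) f g = ?m f g" for f g
  proof -
    have "?m f g = (\<Sum>p\<in>keys f. \<Sum>q\<in>keys g. scl (lookup f p * lookup g q) (sgl (fst p \<otimes>\<^bsub>A\<^esub> fst q, snd p \<otimes>\<^bsub>B\<^esub> snd q)))"
      by (simp add: lext_def V.scale_sum_right)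
    then show ?thesis by (simp add: pair_alg_def single_scl[symmetric])
  qed
  have "?m f g \<in> ?C" if "f \<in> ?C" "g \<in> ?C" for f g
  proof -
    have "sgl (fst p \<otimes>\<^bsub>A\<^esub> fst q, snd p \<otimes>\<^bsub>B\<^esub> snd q) \<in> ?C" if "p \<in> keys f" "q \<in> keys g" for p q
      using that \<open>f \<in> ?C\<close> \<open>g \<in> ?C\<close> by (auto intro!: A.cl B.cl)
    then show ?thesis unfolding lext_def by (intro V.subspace_sum[OF s] V.subspace_scale[OF s])
  qed
  moreover have "blin ?m" unfolding blin_def by (auto intro: lin_lext lin_lext_param)
  moreover have "carrier (pair_alg A B) = ?C" by (simp add: pair_alg_def)
  moreover have "one (pair_alg A B) = sgl (\<one>\<^bsub>A\<^esub>, \<one>\<^bsub>B\<^esub>)" "zero (pair_alg A B) = 0" "add (pair_alg A B) = (+)"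
    "module.smult (pair_alg A B) = scl"
    by (simp_all add: pair_alg_def scl_def[abs_def])
  ultimately show ?thesis
    using V.subspace_add[OF s] V.subspace_scale[OF s] V.subspace_0[OF s] A.cl B.cl s
    by unfold_locales (simp_all add: mult bij_betw_def)
qed

lemma bilinearity_relations_intros:
  "x \<in> carrier A \<Longrightarrow> x' \<in> carrier A \<Longrightarrow> y \<in> carrier B \<Longrightarrow>
    sgl (x \<oplus>\<^bsub>A\<^esub> x', y) - sgl (x, y) - sgl (x', y) \<in> bilinearity_relations A B"
  "x \<in> carrier A \<Longrightarrow> y \<in> carrier B \<Longrightarrow> y' \<in> carrier B \<Longrightarrow>
    sgl (x, y \<oplus>\<^bsub>B\<^esub> y') - sgl (x, y) - sgl (x, y') \<in> bilinearity_relations A B"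
  "x \<in> carrier A \<Longrightarrow> y \<in> carrier B \<Longrightarrow> sgl (c \<odot>\<^bsub>A\<^esub> x, y) - scl c (sgl (x, y)) \<in> bilinearity_relations A B"
  "x \<in> carrier A \<Longrightarrow> y \<in> carrier B \<Longrightarrow> sgl (x, c \<odot>\<^bsub>B\<^esub> y) - scl c (sgl (x, y)) \<in> bilinearity_relations A B"
  unfolding bilinearity_relations_def single_scl[symmetric] by blast+

text \<open>The map \<open>t\<close> from formal pairs to tensors kills the relations. Conversely
  \<open>D\<close> sends tensors back to formal pairs, and \<open>D (t f)\<close> agrees with
  \<open>f\<close> modulo the relations; so \<open>t f = 0\<close> puts \<open>f\<close> into their
  span.\<close>

lemma relation_space_eq_kernel:
  assumes "alg_rep A mu E e h" "alg_rep B nu E' e' k"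
  shows "relation_space A B = {f \<in> carrier (pair_alg A B). lext (\<lambda>p. tens (h (fst p)) (k (snd p))) f = 0}"
proof -
  interpret A: alg_rep A mu E e h by fact
  interpret B: alg_rep B nu E' e' k by fact
  let ?C = "{f :: _ \<Rightarrow>\<^sub>0 'b. keys f \<subseteq> carrier A \<times> carrier B}"
  have s: "V.subspace ?C" by (rule subspace_keys)
  have car: "carrier (pair_alg A B) = ?C" by (simp add: pair_alg_def)
  interpret P: alg_rep "pair_alg A B"
      "\<lambda>f g. lext (\<lambda>p. lext (\<lambda>q. sgl (fst p \<otimes>\<^bsub>A\<^esub> fst q, snd p \<otimes>\<^bsub>B\<^esub> snd q)) g) f"
      ?C "sgl (\<one>\<^bsub>A\<^esub>, \<one>\<^bsub>B\<^esub>)" "\<lambda>f. f"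
    by (rule alg_rep_pair) fact+
  define t where "t = lext (\<lambda>p. tens (h (fst p)) (k (snd p)))"
  have lt: "lin t" unfolding t_def by (rule lin_lext)
  have t_sgl: "t (sgl p) = tens (h (fst p)) (k (snd p))" for p by (simp add: t_def)
  have ker: "V.subspace {f \<in> ?C. t f = 0}"
    using V.subspace_inter[OF s lin_kernel[OF lt]] by (simp add: Int_def)
  have rel: "bilinearity_relations A B \<subseteq> {f \<in> ?C. t f = 0}"
  proof
    fix r assume "r \<in> bilinearity_relations A B"
    then consider
      x x' y where "r = sgl (x \<oplus>\<^bsub>A\<^esub> x', y) - sgl (x, y) - sgl (x', y)" "x \<in> carrier A" "x' \<in> carrier A" "y \<in> carrier B"
      | x y y' where "r = sgl (x, y \<oplus>\<^bsub>B\<^esub> y') - sgl (x, y) - sgl (x, y')" "x \<in> carrier A" "y \<in> carrier B" "y' \<in> carrier B"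
      | c x y where "r = sgl (c \<odot>\<^bsub>A\<^esub> x, y) - scl c (sgl (x, y))" "x \<in> carrier A" "y \<in> carrier B"
      | c x y where "r = sgl (x, c \<odot>\<^bsub>B\<^esub> y) - scl c (sgl (x, y))" "x \<in> carrier A" "y \<in> carrier B"
      unfolding bilinearity_relations_def single_scl[symmetric] by blast
    then show "r \<in> {f \<in> ?C. t f = 0}"
    proof cases
      case 1
      moreover have "r \<in> ?C" unfolding 1(1) using 1 by (intro V.subspace_diff[OF s]) (auto simp: A.cl)
      ultimately show ?thesis
        by (simp add: lin_diff[OF lt] t_sgl A.hom lin_add[OF lin_tens(2)])
    next
      case 2
      moreover have "r \<in> ?C" unfolding 2(1) using 2 by (intro V.subspace_diff[OF s]) (auto simp: B.cl)
      ultimately show ?thesis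
        by (simp add: lin_diff[OF lt] t_sgl B.hom lin_add[OF lin_tens(1)])
    next
      case 3
      moreover have "r \<in> ?C" unfolding 3(1) using 3
        by (intro V.subspace_diff[OF s] V.subspace_scale[OF s]) (auto simp: A.cl)
      ultimately show ?thesis
        by (simp add: lin_diff[OF lt] lin_scl[OF lt] t_sgl A.hom lin_scl[OF lin_tens(2)])
    next
      case 4
      moreover have "r \<in> ?C" unfolding 4(1) using 4
        by (intro V.subspace_diff[OF s] V.subspace_scale[OF s]) (auto simp: B.cl)
      ultimately show ?thesis
        by (simp add: lin_diff[OF lt] lin_scl[OF lt] t_sgl B.hom lin_scl[OF lin_tens(1)])
    qed
  qed
  have R: "relation_space A B = V.span (bilinearity_relations A B)"
    using P.image_span[of "bilinearity_relations A B"] rel car by (simp add: relation_space_def subset_iff)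
  let ?R = "V.span (bilinearity_relations A B)"
  have sR: "V.subspace ?R" by simp
  obtain p where p: "lin p" "\<And>x. p x \<in> E" "\<And>x. x \<in> E \<Longrightarrow> p x = x"
    using exists_projector[OF A.sub] by blast
  obtain q where q: "lin q" "\<And>x. q x \<in> E'" "\<And>x. x \<in> E' \<Longrightarrow> q x = x"
    using exists_projector[OF B.sub] by blast
  \<comment> \<open>The basis functions \<open>sgl i\<close> need not lie in \<open>E\<close>;
    projecting by \<open>p\<close> beforehand gives a linear inverse of \<open>h\<close> defined on
    all of them.\<close>
  define hi where "hi v = inv_into (carrier A) h (p v)" for v
  define ki where "ki v = inv_into (carrier B) k (q v)" for v
  have hi: "hi v \<in> carrier A" "h (hi v) = p v" for v
    using bij_betwE[OF bij_betw_inv_into[OF A.bij]] bij_betw_inv_into_right[OF A.bij] p(2)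
    by (auto simp: hi_def)
  have ki: "ki v \<in> carrier B" "k (ki v) = q v" for v
    using bij_betwE[OF bij_betw_inv_into[OF B.bij]] bij_betw_inv_into_right[OF B.bij] q(2)
    by (auto simp: ki_def)
  have hih: "hi (h x) = x" if "x \<in> carrier A" for x
    by (rule A.h_eqI) (simp_all add: that hi p A.h_mem)
  have kik: "ki (k x) = x" if "x \<in> carrier B" for x
    by (rule B.h_eqI) (simp_all add: that ki q B.h_mem)
  have hi_add: "hi (v + w) = hi v \<oplus>\<^bsub>A\<^esub> hi w" and hi_scl: "hi (scl c v) = c \<odot>\<^bsub>A\<^esub> hi v" for v w c
    by (auto intro!: A.h_eqI simp: hi A.hom A.cl lin_add[OF p(1)] lin_scl[OF p(1)])
  have ki_add: "ki (v + w) = ki v \<oplus>\<^bsub>B\<^esub> ki w" and ki_scl: "ki (scl c v) = c \<odot>\<^bsub>B\<^esub> ki v" for v w c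
    by (auto intro!: B.h_eqI simp: ki B.hom B.cl lin_add[OF q(1)] lin_scl[OF q(1)])
  define D where "D = lext (\<lambda>p. sgl (hi (sgl (fst p)), ki (sgl (snd p))) :: _ \<Rightarrow>\<^sub>0 'b)"
  have claim: "sgl (x, y) - D (tens (h x) (k y)) \<in> ?R" if x: "x \<in> carrier A" and y: "y \<in> carrier B" for x y
  proof -
    \<comment> \<open>The two entries are expanded in the basis one after the other, each time up to
      relations.\<close>
    have 1: "sgl (hi v, y) - lext (\<lambda>i. sgl (hi (sgl i), y)) v \<in> ?R" for v
      using y hi by (intro lin_modulo[OF sR, of "\<lambda>v. sgl (hi v, y)"])
        (auto simp: hi_add hi_scl diff_diff_eq[symmetric] intro!: V.span_base bilinearity_relations_intros)
    have 2: "sgl (hi v, ki w) - lext (\<lambda>j. sgl (hi v, ki (sgl j))) w \<in> ?R" for v w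
      using ki hi by (intro lin_modulo[OF sR, of "\<lambda>w. sgl (hi v, ki w)"])
        (auto simp: ki_add ki_scl diff_diff_eq[symmetric] intro!: V.span_base bilinearity_relations_intros)
    have "lext (\<lambda>i. sgl (hi (sgl i), y)) (h x) - lext (\<lambda>i. lext (\<lambda>j. sgl (hi (sgl i), ki (sgl j))) (k y)) (h x) \<in> ?R"
      unfolding lext_def[of "\<lambda>i. sgl (hi (sgl i), y)"] lext_def[of "\<lambda>i. lext (\<lambda>j. sgl (hi (sgl i), ki (sgl j))) (k y)"]
        sum_subtractf[symmetric] V.scale_right_diff_distrib[symmetric]
      using 2[of _ "k y"] kik[OF y] by (intro V.span_sum V.span_scale) auto
    then have "(sgl (hi (h x), y) - lext (\<lambda>i. sgl (hi (sgl i), y)) (h x)) + (lext (\<lambda>i. sgl (hi (sgl i), y)) (h x)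
        - lext (\<lambda>i. lext (\<lambda>j. sgl (hi (sgl i), ki (sgl j))) (k y)) (h x)) \<in> ?R"
      using 1 by (intro V.span_add)
    moreover have "D (tens u v) = lext (\<lambda>i. lext (\<lambda>j. sgl (hi (sgl i), ki (sgl j))) v) u" for u v
      by (rule blin_eqI[where f = "\<lambda>u v. D (tens u v)"])
        (auto simp: D_def tens_sgl blin_def[of "\<lambda>x y. lext (F x y) x" for F]
          intro: blin_lin_comp[OF lin_lext blin_tens], auto simp: blin_def intro: lin_lext lin_lext_param)
    ultimately show ?thesis by (simp add: hih x)
  qed
  have "f \<in> ?R" if f: "f \<in> ?C" "t f = 0" for f
  proof -
    have "f \<in> {f. f - D (t f) \<in> ?R}"
    proof (rule pm_in_subspace)
      show "V.subspace {f. f - D (t f) \<in> ?R}"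
        unfolding D_def by (rule lin_vimage[OF lin_minus[OF lin_ident lin_comp[OF lin_lext lt]] sR])
      fix z assume "z \<in> keys f"
      then have "fst z \<in> carrier A" "snd z \<in> carrier B" using f by auto
      then show "sgl z \<in> {f. f - D (t f) \<in> ?R}" using claim[of "fst z" "snd z"] by (simp add: t_sgl)
    qed
    then show ?thesis using f by (simp add: D_def lin_0[OF lin_lext])
  qed
  moreover have "?R \<subseteq> {f \<in> ?C. t f = 0}" using rel ker by (rule V.span_minimal)
  ultimately show ?thesis unfolding R car t_def[symmetric] by blast
qed

text \<open>The choice of \<open>f\<close> is immaterial: by \<open>relation_space_eq_kernel\<close>
  the cosets of \<open>relation_space\<close> are the fibres of this linear extension.\<close>

definition tensor_rep :: "('f::field, 'a) module \<Rightarrow> ('f, 'b) module \<Rightarrow> ('a \<Rightarrow> ('i \<Rightarrow>\<^sub>0 'f))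
    \<Rightarrow> ('b \<Rightarrow> ('j \<Rightarrow>\<^sub>0 'f)) \<Rightarrow> ('a \<times> 'b \<Rightarrow>\<^sub>0 'f) set \<Rightarrow> ('i \<times> 'j \<Rightarrow>\<^sub>0 'f)" where
  "tensor_rep A B h k X = lext (\<lambda>p. tens (h (fst p)) (k (snd p))) (SOME f. f \<in> X)"

lemma alg_rep_tensor:
  assumes "alg_rep A mu E e h" "alg_rep B nu E' e' k"
  shows "alg_rep (tensor_alg A B) (tmul mu nu) (TS E E') (tens e e') (tensor_rep A B h k)"
    and "x \<in> carrier A \<Longrightarrow> y \<in> carrier B \<Longrightarrow> tensor_rep A B h k (pure_tensor A B x y) = tens (h x) (k y)"
    and "x \<in> carrier A \<Longrightarrow> y \<in> carrier B \<Longrightarrow> pure_tensor A B x y \<in> carrier (tensor_alg A B)"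
proof -
  interpret A: alg_rep A mu E e h by fact
  interpret B: alg_rep B nu E' e' k by fact
  let ?C = "{f :: _ \<Rightarrow>\<^sub>0 'b. keys f \<subseteq> carrier A \<times> carrier B}"
  interpret P: alg_rep "pair_alg A B"
      "\<lambda>f g. lext (\<lambda>p. lext (\<lambda>q. sgl (fst p \<otimes>\<^bsub>A\<^esub> fst q, snd p \<otimes>\<^bsub>B\<^esub> snd q)) g) f"
      ?C "sgl (\<one>\<^bsub>A\<^esub>, \<one>\<^bsub>B\<^esub>)" "\<lambda>f. f"
    by (rule alg_rep_pair) fact+
  define t where "t = lext (\<lambda>p. tens (h (fst p)) (k (snd p)))"
  have lt: "lin t" unfolding t_def by (rule lin_lext)
  have t_sgl: "t (sgl p) = tens (h (fst p)) (k (snd p))" for p by (simp add: t_def)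
  have car: "carrier (pair_alg A B) = ?C" by (simp add: pair_alg_def)
  have E: "TS E E' = t ` carrier (pair_alg A B)"
  proof
    show "TS E E' \<subseteq> t ` carrier (pair_alg A B)"
    proof
      fix u assume "u \<in> TS E E'"
      then show "u \<in> t ` carrier (pair_alg A B)"
      proof (rule TS_induct)
        fix x y assume "x \<in> E" "y \<in> E'"
        then obtain x' y' where "x' \<in> carrier A" "y' \<in> carrier B" "x = h x'" "y = k y'"
          using A.h_surj B.h_surj by metis
        then show "tens x y \<in> t ` carrier (pair_alg A B)"
          by (intro image_eqI[of _ _ "sgl (x', y')"]) (auto simp: t_sgl car)
      qed (auto intro!: A.sub B.sub lin_image[OF lt] simp: car subspace_keys)
    qed
    show "t ` carrier (pair_alg A B) \<subseteq> TS E E'"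
    proof safe
      fix f assume f: "f \<in> carrier (pair_alg A B)"
      have "f \<in> {f. t f \<in> TS E E'}"
      proof (rule pm_in_subspace)
        fix z assume "z \<in> keys f"
        then show "sgl z \<in> {f. t f \<in> TS E E'}"
          using f by (auto simp: car t_sgl intro!: tens_in_TS A.sub B.sub A.h_mem B.h_mem)
      qed (intro lin_vimage[OF lt] subspace_TS A.sub B.sub)
      then show "t f \<in> TS E E'" by simp
    qed
  qed
  have mult: "t (f \<otimes>\<^bsub>pair_alg A B\<^esub> g) = tmul mu nu (t f) (t g)" if f: "f \<in> ?C" and g: "g \<in> ?C" for f g
  proof -
    let ?m = "\<lambda>f g. lext (\<lambda>p. lext (\<lambda>q. sgl (fst p \<otimes>\<^bsub>A\<^esub> fst q, snd p \<otimes>\<^bsub>B\<^esub> snd q)) g) f"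
    note l = blinD[OF P.bl] blinD[OF blin_tmul]
    have "f \<in> {f. t (?m f g) - tmul mu nu (t f) (t g) = 0}"
    proof (rule pm_in_subspace)
      fix z assume z: "z \<in> keys f"
      have "g \<in> {g. t (?m (sgl z) g) - tmul mu nu (t (sgl z)) (t g) = 0}"
      proof (rule pm_in_subspace)
        fix w assume w: "w \<in> keys g"
        show "sgl w \<in> {g. t (?m (sgl z) g) - tmul mu nu (t (sgl z)) (t g) = 0}"
        proof -
          have "fst z \<in> carrier A" "snd z \<in> carrier B" using z f by (cases z; auto)+
          moreover have "fst w \<in> carrier A" "snd w \<in> carrier B" using w g by (cases w; auto)+
          ultimately show ?thesis by (simp add: t_sgl tmul_tens[OF A.bl B.bl] A.hom B.hom)
        qed
      qed (rule lin_kernel[OF lin_minus[OF lin_comp[OF lt l(1)] lin_comp[OF l(3) lt]]])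
      then show "sgl z \<in> {f. t (?m f g) - tmul mu nu (t f) (t g) = 0}" by simp
    qed (rule lin_kernel[OF lin_minus[OF lin_comp[OF lt l(2)] lin_comp[OF l(4) lt]]])
    then show ?thesis using f g by (simp add: P.h_mult car)
  qed
  have eq: "(\<lambda>X. t (SOME x. x \<in> X)) = tensor_rep A B h k"
    by (simp add: tensor_rep_def[abs_def] t_def)
  have smult: "t (c \<odot>\<^bsub>pair_alg A B\<^esub> f) = scl c (t f)" if "f \<in> ?C" for c f
    using that by (simp add: P.h_smult car lin_scl[OF lt])
  have add: "t (f \<oplus>\<^bsub>pair_alg A B\<^esub> g) = t f + t g" if "f \<in> ?C" "g \<in> ?C" for f g
    using that by (simp add: P.h_add car lin_add[OF lt])
  have one: "t (\<one>\<^bsub>pair_alg A B\<^esub>) = tens e e'" by (simp add: P.h_one t_sgl A.hom B.hom)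
  note * = alg_rep_quotient[OF P.abelian_group blin_tmul P.mult_cl P.smult_cl P.one_cl add mult smult one
      relation_space_eq_kernel[OF assms, folded t_def] E]
  show "alg_rep (tensor_alg A B) (tmul mu nu) (TS E E') (tens e e') (tensor_rep A B h k)"
    unfolding tensor_alg_def eq[symmetric] by (rule *(1)) (auto simp: car)
  assume xy: "x \<in> carrier A" "y \<in> carrier B"
  have "t (SOME z. z \<in> relation_space A B +>\<^bsub>pair_alg A B\<^esub> sgl (x, y)) = t (sgl (x, y))"
    by (rule *(2)) (use xy in \<open>auto simp: car\<close>)
  then show "tensor_rep A B h k (pure_tensor A B x y) = tens (h x) (k y)"
    by (simp add: pure_tensor_def eq[symmetric] t_sgl)
  show "pure_tensor A B x y \<in> carrier (tensor_alg A B)"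
    using xy by (auto simp: tensor_alg_def quot_alg_simps pure_tensor_def car intro!: exI[of _ "sgl (x, y)"])
qed

lemma image_tensor_subspace:
  assumes A: "alg_rep A mu E e h" and B: "alg_rep B nu E' e' k"
    and U: "U \<subseteq> carrier A" "V.subspace (h ` U)" and W: "W \<subseteq> carrier B" "V.subspace (k ` W)"
  shows "tensor_rep A B h k ` tensor_subspace A B U W = TS (h ` U) (k ` W)"
    and "tensor_subspace A B U W \<subseteq> carrier (tensor_alg A B)"
proof -
  interpret T: alg_rep "tensor_alg A B" "tmul mu nu" "TS E E'" "tens e e'" "tensor_rep A B h k"
    by (rule alg_rep_tensor) fact+
  interpret M: Module.module class_ring "tensor_alg A B" by (rule T.module)
  let ?S = "{pure_tensor A B u w | u w. u \<in> U \<and> w \<in> W}"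
  note pt = alg_rep_tensor(2,3)[OF A B]
  have S: "?S \<subseteq> carrier (tensor_alg A B)" using pt(2) U W by auto
  show "tensor_subspace A B U W \<subseteq> carrier (tensor_alg A B)"
    unfolding tensor_subspace_def using S by (rule M.span_is_subset2)
  have "tensor_rep A B h k ` ?S = {tens x y | x y. x \<in> h ` U \<and> y \<in> k ` W}" (is "?L = ?R")
  proof
    show "?L \<subseteq> ?R"
    proof safe
      fix u w assume "u \<in> U" "w \<in> W"
      then show "\<exists>x y. tensor_rep A B h k (pure_tensor A B u w) = tens x y \<and> x \<in> h ` U \<and> y \<in> k ` W"
        using pt(1)[of u w] U W by blast
    qed
    show "?R \<subseteq> ?L"
    proof safe
      fix u w assume uw: "u \<in> U" "w \<in> W"
      then have "tens (h u) (k w) = tensor_rep A B h k (pure_tensor A B u w)"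
        using pt(1) U W by (auto simp: subset_iff)
      then show "tens (h u) (k w) \<in> ?L" using uw by blast
    qed
  qed
  then show "tensor_rep A B h k ` tensor_subspace A B U W = TS (h ` U) (k ` W)"
    unfolding tensor_subspace_def T.image_span[OF S] by (simp add: TS_eq_span U W)
qed

text \<open>The quotient is modelled on the image of \<open>E\<close> under \<open>p\<close>, a
  complement of the ideal when \<open>p\<close> projects along it, with products projected back by
  \<open>p\<close>. So the model of a quotient stays in the same function space.\<close>

lemma alg_rep_projected_quotient:
  assumes "alg_rep A mu E e h" and p: "lin p"
    and I: "I = {x \<in> carrier A. p (h x) = 0}"
    and mult: "\<And>x y. x \<in> E \<Longrightarrow> y \<in> E \<Longrightarrow> p (mu (p x) (p y)) = p (mu x y)"
  shows "alg_rep (quot_alg A I) (\<lambda>x y. p (mu x y)) (p ` E) (p e) (\<lambda>X. p (h (SOME x. x \<in> X)))"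
proof -
  interpret A: alg_rep A mu E e h by fact
  have "p ` E = (\<lambda>x. p (h x)) ` carrier A" using A.bij by (simp add: bij_betw_def image_image[symmetric])
  then show ?thesis
    using alg_rep_quotient(1)[where k = "\<lambda>x. p (h x)", OF A.abelian_group blin_lin_comp[OF p A.bl]
        A.mult_cl A.smult_cl A.one_cl _ _ _ _ I]
    by (simp add: A.hom lin_add[OF p] lin_scl[OF p] mult A.h_mem)
qed

section \<open>Separability idempotents from separable polynomials\<close>

text \<open>Euclid's algorithm. Unlike coprimality, the resulting identity survives evaluation at an
  element of an algebra.\<close>

lemma coprime_poly_bezout:
  fixes p q :: "'f::field poly"
  assumes "coprime p q"
  shows "\<exists>u v. u * p + v * q = 1"
  using assms
proof (induction "euclidean_size q" arbitrary: p q rule: less_induct)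
  case less
  show ?case
  proof (cases "q = 0")
    case True
    then have "p dvd 1" using less.prems by simp
    then obtain u where "1 = p * u" by (rule dvdE)
    then show ?thesis using True by (intro exI[of _ u]) (simp add: mult.commute)
  next
    case False
    have "coprime q (p mod q)"
      using less.prems by (intro coprimeI) (meson coprime_common_divisor dvd_mod_imp_dvd)
    then obtain u v where uv: "u * q + v * (p mod q) = 1"
      using less.hyps[OF mod_size_less[OF False]] by blast
    have "v * p + (u - v * D) * q = u * q + v * (p - D * q)" for D by (simp add: algebra_simps)
    from this[of "p div q"] have "v * p + (u - v * (p div q)) * q = 1"
      using uv by (simp add: minus_div_mult_eq_mod)
    then show ?thesis by blast
  qed
qed

text \<open>Modulo \<open>p\<close>, both \<open>X\<close> and \<open>p'\<close> are invertible and
  \<open>D\<close> equals \<open>X p'\<close>; modulo \<open>X\<close>, \<open>D\<close> equals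
  \<open>p\<close>, which has the inverse \<open>d\<close>. So \<open>D\<close> is prime to
  \<open>p\<close> and to \<open>X\<close>, and multiplying the two identities handles the
  product.\<close>

lemma bezout_mult:
  fixes p X :: "'a::comm_ring_1"
  assumes up: "u * p + v * p' = 1" and dp: "d * p - d * r * X = 1" and D: "D = p + X * p'"
  shows "\<exists>s t. s * (X * p) + t * D = 1"
proof -
  define s where "s = u + v * p' * d + v * d * r"
  define t where "t = - v * d * r"
  have "s * p + t * D = u * p + v * p' * (d * p - d * r * X)"
    by (simp add: s_def t_def D algebra_simps)
  then have 1: "s * p + t * D = 1" by (simp add: dp up)
  have "(- d * r - d * p') * X + d * D = d * p - d * r * X"
    by (simp add: D algebra_simps)
  then have 2: "(- d * r - d * p') * X + d * D = 1" by (simp add: dp)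
  have "(s * p + t * D) * ((- d * r - d * p') * X + d * D) = 1" unfolding 1 2 by simp
  then have "(s * (- d * r - d * p')) * (X * p) + (s * p * d + t * ((- d * r - d * p') * X + d * D)) * D = 1"
    by (simp add: algebra_simps)
  then show ?thesis by blast
qed

text \<open>An element of a factor field, extended by zero to the product algebra, is a root of
  \<open>X p\<close> but in general not of its minimal polynomial \<open>p\<close>. If
  \<open>p\<close> has a nonzero constant term, then \<open>X\<close> is prime to \<open>p\<close>,
  and \<open>X p\<close> is again prime to its derivative.\<close>

lemma bezout_times_X:
  fixes p :: "'f::field poly"
  assumes "coprime p (pderiv p)" "coeff p 0 \<noteq> 0"
  shows "\<exists>u v. u * pCons 0 p + v * pderiv (pCons 0 p) = 1"
proof -
  let ?X = "[:0, 1:] :: 'f poly"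
  obtain u v where uv: "u * p + v * pderiv p = 1" using coprime_poly_bezout[OF assms(1)] by blast
  obtain c r where p: "p = pCons c r" by (cases p) auto
  have c: "c \<noteq> 0" using assms p by simp
  define d where "d = [:inverse c:]"
  have pX: "p = [:c:] + ?X * r" by (simp add: p)
  have d: "d * p - d * r * ?X = 1"
    unfolding pX by (simp add: algebra_simps d_def c one_pCons)
  have "pderiv (pCons 0 p) = p + ?X * pderiv p" by (simp add: pderiv_pCons)
  then show ?thesis using bezout_mult[OF uv d] by simp
qed

section \<open>Coefficient shifts and the derivative\<close>

lemma poly_shift_Suc_pCons: "poly_shift (Suc i) (pCons a q) = poly_shift i q"
  by (rule poly_eqI) (simp add: coeff_poly_shift)

lemma X_times_poly_shift:
  fixes q :: "'f::comm_ring_1 poly"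
  shows "[:0, 1:] * poly_shift (Suc i) q = poly_shift i q - [:coeff q i:]"
  by (rule poly_eqI) (simp add: coeff_poly_shift coeff_pCons split: nat.split)

text \<open>The shifts are the coefficients, as a polynomial in \<open>s\<close>, of
  \<open>(q(t) - q(s)) / (t - s)\<close>; setting \<open>s = t\<close> gives the derivative.\<close>

lemma sum_poly_shift_eq_pderiv:
  fixes q :: "'f::idom poly"
  assumes "degree q \<le> n"
  shows "(\<Sum>i<n. [:0, 1:] ^ i * poly_shift (Suc i) q) = pderiv q"
  using assms
proof (induction q arbitrary: n)
  case 0
  have "poly_shift i 0 = (0 :: 'f poly)" for i by (rule poly_eqI) (simp add: coeff_poly_shift)
  then show ?case by simp
next
  case (pCons a q)
  show ?case
  proof (cases n)
    case 0
    then have "q = 0" using pCons.prems by (simp split: if_splits)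
    then show ?thesis using 0 by simp
  next
    case (Suc m)
    have "(\<Sum>i<n. [:0, 1:] ^ i * poly_shift (Suc i) (pCons a q))
        = q + [:0, 1:] * (\<Sum>i<m. [:0, 1:] ^ i * poly_shift (Suc i) q)"
      by (simp only: Suc sum.lessThan_Suc_shift poly_shift_Suc_pCons sum_distrib_left)
        (simp add: algebra_simps)
    also have "\<dots> = pderiv (pCons a q)"
      using pCons by (simp add: Suc pderiv_pCons split: if_splits)
    finally show ?thesis .
  qed
qed

locale comm_alg = assoc_alg mu C e for mu :: "('i \<Rightarrow>\<^sub>0 'f::field) \<Rightarrow> ('i \<Rightarrow>\<^sub>0 'f) \<Rightarrow> ('i \<Rightarrow>\<^sub>0 'f)" (infixl \<open>\<cdot>\<close> 70)
    and C e +
  assumes comm: "x \<in> C \<Longrightarrow> y \<in> C \<Longrightarrow> x \<cdot> y = y \<cdot> x"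
begin

lemma left_comm: "x \<in> C \<Longrightarrow> y \<in> C \<Longrightarrow> z \<in> C \<Longrightarrow> x \<cdot> (y \<cdot> z) = y \<cdot> (x \<cdot> z)"
  using assoc comm by metis

section \<open>Evaluation of polynomials at an element\<close>

definition pev :: "('i \<Rightarrow>\<^sub>0 'f) \<Rightarrow> 'f poly \<Rightarrow> ('i \<Rightarrow>\<^sub>0 'f)" where
  "pev k p = fold_coeffs (\<lambda>c v. scl c e + k \<cdot> v) p 0"

lemma pev_0 [simp]: "pev k 0 = 0" by (simp add: pev_def)

lemma pev_pCons [simp]: "pev k (pCons c p) = scl c e + k \<cdot> pev k p"
  by (cases "p = 0 \<and> c = 0") (auto simp: pev_def zeros)

lemma pev_add: "pev k (p + q) = pev k p + pev k q"
  by (induction p q rule: poly_induct2) (simp_all add: distr V.scale_left_distrib)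

lemma pev_smult: "pev k (Polynomial.smult c p) = scl c (pev k p)"
  by (induction p) (simp_all add: V.scale_right_distrib scls)

lemma pev_diff: "pev k (p - q) = pev k p - pev k q"
  using pev_add[of k "p - q" q] by simp

lemma pev_sum: "pev k (sum f S) = (\<Sum>i\<in>S. pev k (f i))"
  by (induction S rule: infinite_finite_induct) (simp_all add: pev_add)

context
  fixes k assumes k: "k \<in> C"
begin

lemma pev_mem: "pev k p \<in> C"
  by (induction p) (simp_all add: mem k)

lemma pev_mult: "pev k (p * q) = pev k p \<cdot> pev k q"
  by (induction p) (simp_all add: zeros pev_add pev_smult distr scls unit_l pev_mem k assoc)

lemma pev_1: "pev k 1 = e"
  by (simp add: one_pCons zeros)

lemma pev_X_mult: "pev k ([:0, 1:] * p) = k \<cdot> pev k p"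
  by simp

lemma pev_X_power_Suc: "pev k ([:0, 1:] ^ Suc i) = k \<cdot> pev k ([:0, 1:] ^ i)"
  by simp

lemma pev_altdef: "pev k p = (\<Sum>i\<le>degree p. scl (coeff p i) (pev k ([:0, 1:] ^ i)))"
proof -
  have "p = (\<Sum>i\<le>degree p. Polynomial.smult (coeff p i) ([:0, 1:] ^ i))"
    by (simp add: poly_as_sum_of_monoms monom_altdef[symmetric])
  then have "pev k p = pev k (\<Sum>i\<le>degree p. Polynomial.smult (coeff p i) ([:0, 1:] ^ i))" by simp
  then show ?thesis by (simp only: pev_sum pev_smult)
qed

text \<open>With \<open>q(t)/(t - k) = \<Sum> \<beta>\<^sub>i t\<^sup>i\<close> the tensor \<open>\<Sum> k\<^sup>i \<otimes> \<beta>\<^sub>i / q'(k)\<close> is a separability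
  idempotent, since \<open>q(t)/(t - k)\<close> takes the value \<open>q'(k)\<close> at \<open>t = k\<close>.\<close>
lemma separating_element:
  assumes q: "lead_coeff q = 1" "pev k q = 0" and b: "u * q + v * pderiv q = 1"
  defines "a \<equiv> \<lambda>i. pev k ([:0, 1:] ^ i)" and "b \<equiv> \<lambda>i. pev k (poly_shift (Suc i) q * v)"
  shows "(\<Sum>i<degree q. a i \<cdot> b i) = e" and "balanced mu {..<degree q} a b k"
    and "a i \<in> C" "b i \<in> C"
proof -
  let ?d = "degree q"
  show "a i \<in> C" "b i \<in> C" by (simp_all add: a_def b_def pev_mem del: mult_pCons_left)
  have "(\<Sum>i<?d. a i \<cdot> b i) = pev k ((\<Sum>i<?d. [:0, 1:] ^ i * poly_shift (Suc i) q) * v)"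
    unfolding a_def b_def sum_distrib_right pev_sum
    by (intro sum.cong refl) (simp only: pev_mult[symmetric] mult.assoc)
  \<comment> \<open>Since \<open>q\<close> vanishes at \<open>k\<close>, the Bezout identity makes
    the value of \<open>v\<close> at \<open>k\<close> the inverse of \<open>q'(k)\<close>.\<close>
  also have "\<dots> = pev k (u * q + v * pderiv q)"
    by (simp only: sum_poly_shift_eq_pderiv[OF order_refl] pev_add pev_mult q zeros) (simp add: comm pev_mem)
  finally show "(\<Sum>i<?d. a i \<cdot> b i) = e" by (simp add: b pev_1)
  \<comment> \<open>The companion matrix of \<open>q\<close>: multiplication by \<open>k\<close>
    raises the power, and at the top power \<open>q(k) = 0\<close> rewrites the result.\<close>
  define m where "m i j = (if i = Suc j then 1 else 0) - (if Suc j = ?d then coeff q i else 0)" for i j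
  have "k \<cdot> a i = (\<Sum>j<?d. scl (m j i) (a j))" if i: "i < ?d" for i
  proof -
    have "(\<Sum>j<?d. scl (m j i) (a j)) = (\<Sum>j<?d. if j = Suc i then a j else 0)
        - (\<Sum>j<?d. if Suc i = ?d then scl (coeff q j) (a j) else 0)"
      unfolding sum_subtractf[symmetric]
      by (intro sum.cong refl) (simp add: m_def V.scale_left_diff_distrib)
    also have "(\<Sum>j<?d. if j = Suc i then a j else 0) = (if Suc i < ?d then a (Suc i) else 0)"
      by simp
    finally have eq: "(\<Sum>j<?d. scl (m j i) (a j)) = (if Suc i < ?d then a (Suc i) else 0)
        - (\<Sum>j<?d. if Suc i = ?d then scl (coeff q j) (a j) else 0)" .
    have ka: "k \<cdot> a i = a (Suc i)" by (simp add: a_def)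
    show ?thesis
    proof (cases "Suc i = ?d")
      case True
      have "0 = (\<Sum>j\<le>?d. scl (coeff q j) (a j))" using pev_altdef[of q] q by (simp add: a_def)
      also have "\<dots> = (\<Sum>j<?d. scl (coeff q j) (a j)) + a ?d"
        using q by (simp add: lessThan_Suc_atMost[symmetric])
      finally have "a ?d = - (\<Sum>j<?d. scl (coeff q j) (a j))"
        by (simp add: eq_neg_iff_add_eq_0 add.commute)
      then show ?thesis using True eq ka by simp
    next
      case False
      then show ?thesis using eq ka i by simp
    qed
  qed
  moreover have "b i \<cdot> k = (\<Sum>j<?d. scl (m i j) (b j))" if i: "i < ?d" for i
  proof -
    obtain d' where d': "?d = Suc d'" using i by (cases ?d) auto
    have "(\<Sum>j<?d. scl (m i j) (b j)) = (\<Sum>j<?d. if i = Suc j then b j else 0)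
        - (\<Sum>j<?d. if j = d' then scl (coeff q i) (b j) else 0)"
      unfolding sum_subtractf[symmetric]
      by (intro sum.cong refl) (auto simp: m_def V.scale_left_diff_distrib d')
    also have "(\<Sum>j<?d. if j = d' then scl (coeff q i) (b j) else 0) = scl (coeff q i) (b d')"
      by (simp add: d')
    \<comment> \<open>\<open>q\<close> is monic, so its last shift is the constant 1.\<close>
    also have "b d' = pev k v"
    proof -
      have "poly_shift ?d q = 1"
      proof (rule poly_eqI)
        fix n
        show "coeff (poly_shift ?d q) n = coeff 1 n"
          using q by (cases n) (auto simp: coeff_poly_shift coeff_eq_0)
      qed
      then show ?thesis by (simp add: b_def d'[symmetric])
    qed
    also have "(\<Sum>j<?d. if i = Suc j then b j else 0) = pev k (poly_shift i q * v)"
    proof (cases i)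
      \<comment> \<open>No \<open>Suc j\<close> is 0, so the sum vanishes; the right side contains
        the unshifted \<open>q\<close>, which vanishes at \<open>k\<close>.\<close>
      case 0
      then show ?thesis using q by (simp add: pev_mult zeros)
    next
      case (Suc i')
      then have "(\<Sum>j<?d. if i = Suc j then b j else 0) = (\<Sum>j<?d. if j = i' then b j else 0)"
        by (intro sum.cong) auto
      then show ?thesis using Suc i by (simp add: b_def)
    qed
    finally have "(\<Sum>j<?d. scl (m i j) (b j)) = pev k ((poly_shift i q - [:coeff q i:]) * v)"
      by (simp add: left_diff_distrib pev_diff pev_smult)
    also have "\<dots> = pev k ([:0, 1:] * (poly_shift (Suc i) q * v))"
      by (simp only: X_times_poly_shift[symmetric] mult.assoc)
    also have "\<dots> = b i \<cdot> k"
      by (simp only: pev_X_mult b_def) (rule comm[OF k pev_mem])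
    finally show ?thesis by simp
  qed
  ultimately show "balanced mu {..<?d} a b k" by (auto simp: balanced_def)
qed

end

text \<open>In a commutative algebra \<open>c\<close> can be brought next to either factor. So a
  matrix that balances one family, combined with the identity matrix on the other index, balances
  the products.\<close>

lemma balanced_product:
  fixes S :: "'s set" and T :: "'t set"
  assumes S: "finite S" "\<And>i. i \<in> S \<Longrightarrow> a i \<in> C \<and> b i \<in> C"
    and T: "finite T" "\<And>i. i \<in> T \<Longrightarrow> a' i \<in> C \<and> b' i \<in> C"
    and c: "c \<in> C" and bal: "balanced mu S a b c \<or> balanced mu T a' b' c"
  shows "balanced mu (S \<times> T) (\<lambda>p. a (fst p) \<cdot> a' (snd p)) (\<lambda>p. b (fst p) \<cdot> b' (snd p)) c"
  using bal
proof
  assume "balanced mu S a b c"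
  then obtain m where m: "\<And>i. i \<in> S \<Longrightarrow> c \<cdot> a i = (\<Sum>j\<in>S. scl (m j i) (a j))"
    "\<And>i. i \<in> S \<Longrightarrow> b i \<cdot> c = (\<Sum>j\<in>S. scl (m i j) (b j))"
    unfolding balanced_def by blast
  define n where "n p q = m (fst p) (fst q) * (if snd p = snd q then 1 else 0)" for p q :: "'s \<times> 't"
  have "c \<cdot> (a i \<cdot> a' l) = (\<Sum>p\<in>S \<times> T. scl (n p (i, l)) (a (fst p) \<cdot> a' (snd p)))" if il: "i \<in> S" "l \<in> T" for i l
  proof -
    have "(\<Sum>p\<in>S \<times> T. scl (n p (i, l)) (a (fst p) \<cdot> a' (snd p)))
        = (\<Sum>j\<in>S. \<Sum>l'\<in>T. if l' = l then scl (m j i) (a j \<cdot> a' l') else 0)"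
      unfolding sum.cartesian_product by (intro sum.cong) (auto simp: n_def)
    also have "\<dots> = (c \<cdot> a i) \<cdot> a' l" using T il by (simp add: m(1) sums scls)
    finally show ?thesis using S T c il by (simp add: assoc)
  qed
  moreover have "(b i \<cdot> b' l) \<cdot> c = (\<Sum>p\<in>S \<times> T. scl (n (i, l) p) (b (fst p) \<cdot> b' (snd p)))" if il: "i \<in> S" "l \<in> T" for i l
  proof -
    have "(\<Sum>p\<in>S \<times> T. scl (n (i, l) p) (b (fst p) \<cdot> b' (snd p)))
        = (\<Sum>j\<in>S. \<Sum>l'\<in>T. if l' = l then scl (m i j) (b j \<cdot> b' l') else 0)"
      unfolding sum.cartesian_product by (intro sum.cong) (auto simp: n_def)
    also have "\<dots> = (b i \<cdot> c) \<cdot> b' l" using T il by (simp add: m(2) sums scls)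
    finally show ?thesis using S T c il by (simp add: assoc comm[of c "b' l"])
  qed
  ultimately show ?thesis unfolding balanced_def by (intro exI[of _ n]) auto
next
  assume "balanced mu T a' b' c"
  then obtain m where m: "\<And>i. i \<in> T \<Longrightarrow> c \<cdot> a' i = (\<Sum>j\<in>T. scl (m j i) (a' j))"
    "\<And>i. i \<in> T \<Longrightarrow> b' i \<cdot> c = (\<Sum>j\<in>T. scl (m i j) (b' j))"
    unfolding balanced_def by blast
  define n where "n p q = m (snd p) (snd q) * (if fst p = fst q then 1 else 0)" for p q :: "'s \<times> 't"
  have swap: "(\<Sum>p\<in>S \<times> T. F p) = (\<Sum>l\<in>T. \<Sum>i\<in>S. F (i, l))" for F :: "'s \<times> 't \<Rightarrow> 'i \<Rightarrow>\<^sub>0 'f"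
    by (subst sum.swap) (simp add: sum.cartesian_product)
  have "c \<cdot> (a i \<cdot> a' l) = (\<Sum>p\<in>S \<times> T. scl (n p (i, l)) (a (fst p) \<cdot> a' (snd p)))" if il: "i \<in> S" "l \<in> T" for i l
  proof -
    have "(\<Sum>p\<in>S \<times> T. scl (n p (i, l)) (a (fst p) \<cdot> a' (snd p)))
        = (\<Sum>l'\<in>T. \<Sum>j\<in>S. if j = i then scl (m l' l) (a j \<cdot> a' l') else 0)"
      unfolding swap by (intro sum.cong) (auto simp: n_def)
    also have "\<dots> = a i \<cdot> (c \<cdot> a' l)" using S il by (simp add: m(1) sums scls)
    finally show ?thesis using S T c il by (simp add: left_comm)
  qed
  moreover have "(b i \<cdot> b' l) \<cdot> c = (\<Sum>p\<in>S \<times> T. scl (n (i, l) p) (b (fst p) \<cdot> b' (snd p)))" if il: "i \<in> S" "l \<in> T" for i l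
  proof -
    have "(\<Sum>p\<in>S \<times> T. scl (n (i, l) p) (b (fst p) \<cdot> b' (snd p)))
        = (\<Sum>l'\<in>T. \<Sum>j\<in>S. if j = i then scl (m l l') (b j \<cdot> b' l') else 0)"
      unfolding swap by (intro sum.cong) (auto simp: n_def)
    also have "\<dots> = b i \<cdot> (b' l \<cdot> c)" using S il by (simp add: m(2) sums scls)
    finally show ?thesis using S T c il by (simp add: assoc)
  qed
  ultimately show ?thesis unfolding balanced_def by (intro exI[of _ n]) auto
qed

lemma balanced_reindex:
  assumes f: "bij_betw f S' S" and bal: "balanced mu S a b c"
  shows "balanced mu S' (\<lambda>i. a (f i)) (\<lambda>i. b (f i)) c"
proof -
  obtain m where m: "\<And>i. i \<in> S \<Longrightarrow> c \<cdot> a i = (\<Sum>j\<in>S. scl (m j i) (a j))"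
    "\<And>i. i \<in> S \<Longrightarrow> b i \<cdot> c = (\<Sum>j\<in>S. scl (m i j) (b j))"
    using bal unfolding balanced_def by blast
  have "c \<cdot> a (f i) = (\<Sum>j\<in>S'. scl (m (f j) (f i)) (a (f j))) \<and> b (f i) \<cdot> c = (\<Sum>j\<in>S'. scl (m (f i) (f j)) (b (f j)))"
    if "i \<in> S'" for i
    using bij_betwE[OF f] that m[of "f i"] sum.reindex_bij_betw[OF f, of "\<lambda>j. scl (m j (f i)) (a j)"]
      sum.reindex_bij_betw[OF f, of "\<lambda>j. scl (m (f i) j) (b j)"] by simp
  then show ?thesis unfolding balanced_def by (intro exI[of _ "\<lambda>i j. m (f i) (f j)"]) simp
qed

text \<open>The polynomial \<open>q\<close> may be a proper multiple of the minimal polynomial,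
  which leaves room for an extra factor \<open>X\<close>.\<close>

definition separable :: "('i \<Rightarrow>\<^sub>0 'f) \<Rightarrow> bool" where
  "separable k \<longleftrightarrow> k \<in> C \<and> (\<exists>q u v. lead_coeff q = 1 \<and> pev k q = 0 \<and> u * q + v * pderiv q = 1)"

text \<open>The separability idempotents of the generators multiply to one for the algebra.\<close>
lemma separating_finite:
  assumes "finite X" "\<And>k. k \<in> X \<Longrightarrow> separable k"
  shows "\<exists>(S :: nat set) a b. finite S \<and> (\<forall>i\<in>S. a i \<in> C \<and> b i \<in> C) \<and> (\<Sum>i\<in>S. a i \<cdot> b i) = e
    \<and> (\<forall>c\<in>X. balanced mu S a b c)"
  using assms
proof (induction X rule: finite_induct)
  case empty
  show ?case
    by (rule exI[of _ "{0}"], rule exI[of _ "\<lambda>_. e"], rule exI[of _ "\<lambda>_. e"]) (simp add: mem unit_l)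
next
  case (insert k X)
  obtain S :: "nat set" and a b where S: "finite S" "\<And>i. i \<in> S \<Longrightarrow> a i \<in> C \<and> b i \<in> C"
    "(\<Sum>i\<in>S. a i \<cdot> b i) = e" "\<And>c. c \<in> X \<Longrightarrow> balanced mu S a b c"
    using insert by blast
  obtain q u v where k: "k \<in> C" and q: "lead_coeff q = 1" "pev k q = 0" "u * q + v * pderiv q = 1"
    using insert.prems[of k] by (auto simp: separable_def)
  define a' where "a' i = pev k ([:0, 1:] ^ i)" for i
  define b' where "b' i = pev k (poly_shift (Suc i) q * v)" for i
  note T = separating_element[OF k q, folded a'_def b'_def]
  let ?P = "S \<times> {..<degree q}"
  let ?a = "\<lambda>p. a (fst p) \<cdot> a' (snd p)" and ?b = "\<lambda>p. b (fst p) \<cdot> b' (snd p)"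
  have bal: "balanced mu ?P ?a ?b c" if "c \<in> insert k X" for c
    using that S T insert.prems by (intro balanced_product) (auto simp: separable_def)
  have "(\<Sum>p\<in>?P. ?a p \<cdot> ?b p) = (\<Sum>i\<in>S. \<Sum>j<degree q. (a i \<cdot> b i) \<cdot> (a' j \<cdot> b' j))"
    unfolding sum.cartesian_product
    using S(2) T(3,4) by (intro sum.cong) (auto simp: assoc mem left_comm)
  also have "\<dots> = (\<Sum>i\<in>S. a i \<cdot> b i) \<cdot> (\<Sum>j<degree q. a' j \<cdot> b' j)"
    by (simp add: sums) (rule sum.swap)
  finally have one: "(\<Sum>p\<in>?P. ?a p \<cdot> ?b p) = e" by (simp add: S T unit_l unit)
  have fin: "finite ?P" using S by simp
  \<comment> \<open>The product index set lives in another type. Enumerating it by numbers keeps the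
    index type fixed, as the induction requires.\<close>
  obtain f where f: "bij_betw f {0..<card ?P} ?P" using ex_bij_betw_nat_finite[OF fin] by blast
  have "(\<Sum>i\<in>{0..<card ?P}. ?a (f i) \<cdot> ?b (f i)) = e"
    using sum.reindex_bij_betw[OF f, of "\<lambda>p. ?a p \<cdot> ?b p"] one by simp
  moreover have "?a (f i) \<in> C \<and> ?b (f i) \<in> C" if "i \<in> {0..<card ?P}" for i
  proof -
    have "f i \<in> ?P" using bij_betwE[OF f] that by blast
    then show ?thesis using S(2) T(3,4) by (auto simp: mem mem_Times_iff)
  qed
  ultimately show ?case
    using balanced_reindex[OF f bal]
    by (intro exI[of _ "{0..<card ?P}"] exI[of _ "\<lambda>i. ?a (f i)"] exI[of _ "\<lambda>i. ?b (f i)"]) auto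
qed

lemma separating_exists:
  assumes "finite X" "\<And>k. k \<in> X \<Longrightarrow> separable k" "C \<subseteq> V.span X"
  shows "\<exists>(S :: nat set) a b. separating mu e C S a b"
proof -
  obtain S :: "nat set" and a b where S: "finite S" "\<forall>i\<in>S. a i \<in> C \<and> b i \<in> C" "(\<Sum>i\<in>S. a i \<cdot> b i) = e"
    "\<forall>c\<in>X. balanced mu S a b c"
    using separating_finite[OF assms(1,2)] by blast
  have "V.span X \<subseteq> {c. balanced mu S a b c}"
    by (rule V.span_minimal) (use S subspace_balanced[OF bl] in auto)
  then show ?thesis using S assms(3) sub closed unfolding separating_def by blast
qed

end

section \<open>Etale subalgebras\<close>

text \<open>The unit \<open>d\<close> of the embedded field is in general only an idempotent of
  \<open>C\<close>. So \<open>pev\<close>, which uses \<open>e\<close> for the zeroth power, is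
  compared with \<open>alg_eval\<close> on polynomials without constant term: \<open>p\<close>
  itself if its constant term is zero, and \<open>X p\<close> otherwise.\<close>

lemma separable_of_field_element:
  assumes "comm_alg mu C e" and "alg_rep F mu D d th" and D: "D \<subseteq> C"
    and F: "finite_separable_extension F" and x: "x \<in> carrier F"
  shows "comm_alg.separable mu C e (th x)"
proof -
  interpret C: comm_alg mu C e by fact
  interpret R: alg_rep F mu D d th by fact
  interpret F: field F using F by (simp add: finite_separable_extension_def)
  define k where "k = th x"
  have k: "k \<in> C" using R.h_mem[OF x] D by (auto simp: k_def)
  have pow: "C.pev k ([:0, 1:] ^ Suc j) = th (x [^]\<^bsub>F\<^esub> Suc j)" for j
  proof (induction j)
    case 0
    then show ?case using x k by (simp add: C.zeros C.unit_r k_def)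
  next
    case (Suc j)
    have c: "th (x [^]\<^bsub>F\<^esub> Suc j) \<in> C" using x D R.h_mem by blast
    have "C.pev k ([:0, 1:] ^ Suc (Suc j)) = mu k (C.pev k ([:0, 1:] ^ Suc j))"
      by (rule C.pev_X_power_Suc[OF k])
    also have "\<dots> = mu (th (x [^]\<^bsub>F\<^esub> Suc j)) (th x)"
      unfolding Suc k_def[symmetric] by (rule C.comm[OF k c])
    also have "\<dots> = th (x [^]\<^bsub>F\<^esub> Suc (Suc j))"
      using x by (simp add: R.h_mult)
    finally show ?case .
  qed
  have ev: "C.pev k q = th (alg_eval F q x)" if q0: "coeff q 0 = 0" for q
  proof -
    have "th (alg_eval F q x) = (\<Sum>i\<le>degree q. scl (coeff q i) (th (x [^]\<^bsub>F\<^esub> i)))"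
      unfolding alg_eval_def using x by (simp add: R.h_finsum R.cl R.hom)
    also have "\<dots> = (\<Sum>i\<le>degree q. scl (coeff q i) (C.pev k ([:0, 1:] ^ i)))"
    proof (intro sum.cong refl)
      fix i
      show "scl (coeff q i) (th (x [^]\<^bsub>F\<^esub> i)) = scl (coeff q i) (C.pev k ([:0, 1:] ^ i))"
        using pow[of "i - 1"] q0 by (cases i) auto
    qed
    finally show ?thesis using C.pev_altdef[OF k, of q] by simp
  qed
  obtain p where p: "is_minimal_polynomial F x p" "coprime p (pderiv p)"
    using F x by (auto simp: finite_separable_extension_def separable_element_def)
  have dvd: "th (alg_eval F q x) = 0" if "p dvd q" for q
  proof -
    have "alg_eval F q x = \<zero>\<^bsub>F\<^esub>" using p(1) that by (simp add: is_minimal_polynomial_def)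
    then show ?thesis by (simp add: R.h_zero)
  qed
  have lc: "lead_coeff p = 1" using p(1) by (simp add: is_minimal_polynomial_def)
  have "\<exists>q u v. lead_coeff q = 1 \<and> C.pev k q = 0 \<and> u * q + v * pderiv q = 1"
  proof (cases "coeff p 0 = 0")
    case True
    then show ?thesis using ev dvd lc coprime_poly_bezout[OF p(2)] by (metis dvd_refl)
  next
    case False
    have "p \<noteq> 0" using lc by auto
    moreover have "p dvd pCons 0 p" by (rule dvdI[of _ _ "[:0, 1:]"]) simp
    ultimately have "lead_coeff (pCons 0 p) = 1" "C.pev k (pCons 0 p) = 0"
      using ev[of "pCons 0 p"] dvd[of "pCons 0 p"] lc by (simp_all del: C.pev_pCons)
    then show ?thesis using bezout_times_X[OF p(2) False] by blast
  qed
  then show ?thesis using k by (simp add: C.separable_def k_def)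
qed

lemma alg_rep_isomorphic:
  assumes "alg_rep A mu E e h" and iso: "f \<in> ring_iso A B"
    and scale: "\<And>c x. x \<in> carrier A \<Longrightarrow> f (c \<odot>\<^bsub>A\<^esub> x) = c \<odot>\<^bsub>B\<^esub> f x" and zero: "f \<zero>\<^bsub>A\<^esub> = \<zero>\<^bsub>B\<^esub>"
  shows "alg_rep B mu E e (\<lambda>y. h (inv_into (carrier A) f y))"
proof -
  interpret A: alg_rep A mu E e h by fact
  have bij: "bij_betw f (carrier A) (carrier B)" and hom: "f \<in> Ring.ring_hom A B"
    using iso by (auto simp: ring_iso_def)
  let ?g = "inv_into (carrier A) f"
  have g: "?g (f x) = x" if "x \<in> carrier A" for x using bij that by (simp add: bij_betw_inv_into_left)
  have car: "y \<in> carrier B \<longleftrightarrow> (\<exists>x\<in>carrier A. y = f x)" for y using bij by (auto simp: bij_betw_def)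
  note fh = ring_hom_add[OF hom, symmetric] ring_hom_mult[OF hom, symmetric] ring_hom_one[OF hom, symmetric]
    scale[symmetric] zero[symmetric]
  show ?thesis
  proof
    show "bij_betw (\<lambda>y. h (?g y)) (carrier B) E"
      using bij_betw_trans[OF bij_betw_inv_into[OF bij] A.bij] by (simp add: comp_def)
  qed (use A.cl in \<open>auto simp: car fh g A.bl A.sub A.hom simp del: One_nat_def\<close>)
qed

lemma product_alg_simps:
  "carrier (product_alg n E) = (\<Pi>\<^sub>E i\<in>{..<n}. carrier (E i))"
  "f \<otimes>\<^bsub>product_alg n E\<^esub> g = (\<lambda>i\<in>{..<n}. f i \<otimes>\<^bsub>E i\<^esub> g i)"
  "f \<oplus>\<^bsub>product_alg n E\<^esub> g = (\<lambda>i\<in>{..<n}. f i \<oplus>\<^bsub>E i\<^esub> g i)"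
  "c \<odot>\<^bsub>product_alg n E\<^esub> f = (\<lambda>i\<in>{..<n}. c \<odot>\<^bsub>E i\<^esub> f i)"
  "\<zero>\<^bsub>product_alg n E\<^esub> = (\<lambda>i\<in>{..<n}. \<zero>\<^bsub>E i\<^esub>)"
  by (simp_all add: product_alg_def)

text \<open>Each factor is embedded in \<open>C\<close> by extension by zero, and finite spanning
  sets of the factors together span \<open>C\<close>. Every spanning element comes from a single
  field, where its separability is known.\<close>

lemma etale_generators:
  fixes K :: "('f::field, 'a) module"
  assumes "alg_rep K mu C e h" and "assoc_alg mu C e" and "etale K"
  shows "comm_alg mu C e"
    and "\<exists>X. finite X \<and> (\<forall>k\<in>X. comm_alg.separable mu C e k) \<and> C \<subseteq> V.span X"
proof -
  interpret K: alg_rep K mu C e h by fact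
  interpret C: assoc_alg mu C e by fact
  obtain n and E :: "nat \<Rightarrow> ('f, 'a) module" where fse: "\<And>i. i < n \<Longrightarrow> finite_separable_extension (E i)"
    and iso: "alg_isomorphic K (product_alg n E)"
    using assms(3) by (auto simp: etale_def)
  let ?P = "product_alg n E"
  have ua: "unital_algebra (E i)" and fld: "field (E i)" and fd: "vectorspace.fin_dim class_ring (E i)"
    if "i < n" for i using fse[OF that] by (auto simp: finite_separable_extension_def)
  have comm: "x \<otimes>\<^bsub>E i\<^esub> y = y \<otimes>\<^bsub>E i\<^esub> x" if "i < n" "x \<in> carrier (E i)" "y \<in> carrier (E i)" for i x y
  proof -
    interpret F: field "E i" by (rule fld[OF that(1)])
    show ?thesis using that by (simp add: F.m_comm)
  qed
  have ops1: "\<zero>\<^bsub>E i\<^esub> \<in> carrier (E i)" "\<zero>\<^bsub>E i\<^esub> \<oplus>\<^bsub>E i\<^esub> \<zero>\<^bsub>E i\<^esub> = \<zero>\<^bsub>E i\<^esub>"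
    "\<zero>\<^bsub>E i\<^esub> \<otimes>\<^bsub>E i\<^esub> \<zero>\<^bsub>E i\<^esub> = \<zero>\<^bsub>E i\<^esub>" "\<one>\<^bsub>E i\<^esub> \<in> carrier (E i)"
    "x \<in> carrier (E i) \<Longrightarrow> x \<oplus>\<^bsub>E i\<^esub> \<zero>\<^bsub>E i\<^esub> = x" "x \<in> carrier (E i) \<Longrightarrow> \<zero>\<^bsub>E i\<^esub> \<oplus>\<^bsub>E i\<^esub> x = x"
    "x \<in> carrier (E i) \<Longrightarrow> y \<in> carrier (E i) \<Longrightarrow> x \<oplus>\<^bsub>E i\<^esub> y \<in> carrier (E i)"
    "x \<in> carrier (E i) \<Longrightarrow> y \<in> carrier (E i) \<Longrightarrow> x \<otimes>\<^bsub>E i\<^esub> y \<in> carrier (E i)"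
    if "i < n" for i x y
  proof -
    interpret F: field "E i" by (rule fld[OF that])
    show "\<zero>\<^bsub>E i\<^esub> \<in> carrier (E i)" "\<zero>\<^bsub>E i\<^esub> \<oplus>\<^bsub>E i\<^esub> \<zero>\<^bsub>E i\<^esub> = \<zero>\<^bsub>E i\<^esub>"
      "\<zero>\<^bsub>E i\<^esub> \<otimes>\<^bsub>E i\<^esub> \<zero>\<^bsub>E i\<^esub> = \<zero>\<^bsub>E i\<^esub>" "\<one>\<^bsub>E i\<^esub> \<in> carrier (E i)" by simp_all
    show "x \<oplus>\<^bsub>E i\<^esub> \<zero>\<^bsub>E i\<^esub> = x" "\<zero>\<^bsub>E i\<^esub> \<oplus>\<^bsub>E i\<^esub> x = x" if "x \<in> carrier (E i)"
      using that by simp_all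
    show "x \<oplus>\<^bsub>E i\<^esub> y \<in> carrier (E i)" "x \<otimes>\<^bsub>E i\<^esub> y \<in> carrier (E i)"
      if "x \<in> carrier (E i)" "y \<in> carrier (E i)" using that by simp_all
  qed
  have ops2: "c \<odot>\<^bsub>E i\<^esub> \<zero>\<^bsub>E i\<^esub> = \<zero>\<^bsub>E i\<^esub>"
    "x \<in> carrier (E i) \<Longrightarrow> 0 \<odot>\<^bsub>E i\<^esub> x = \<zero>\<^bsub>E i\<^esub>"
    "x \<in> carrier (E i) \<Longrightarrow> c \<odot>\<^bsub>E i\<^esub> x \<in> carrier (E i)"
    if "i < n" for i c x
  proof -
    interpret U: unital_algebra "E i" by (rule ua[OF that])
    show "c \<odot>\<^bsub>E i\<^esub> \<zero>\<^bsub>E i\<^esub> = \<zero>\<^bsub>E i\<^esub>" using U.smult_r_null[of c] by simp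
    show "0 \<odot>\<^bsub>E i\<^esub> x = \<zero>\<^bsub>E i\<^esub>" "c \<odot>\<^bsub>E i\<^esub> x \<in> carrier (E i)" if "x \<in> carrier (E i)"
      using that U.smult_l_null[of x] U.smult_closed[of c x] by simp_all
  qed
  note ops = ops1 ops2
  obtain f where f: "f \<in> ring_iso K ?P" "\<And>c x. x \<in> carrier K \<Longrightarrow> f (c \<odot>\<^bsub>K\<^esub> x) = c \<odot>\<^bsub>?P\<^esub> f x"
    using iso by (auto simp: alg_isomorphic_def)
  have "f \<zero>\<^bsub>K\<^esub> \<in> carrier ?P"
    using f(1) K.zero_cl by (auto simp: ring_iso_def ring_hom_closed)
  then have fz: "f \<zero>\<^bsub>K\<^esub> i \<in> carrier (E i)" if "i < n" for i using that by (auto simp: product_alg_simps)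
  \<comment> \<open>\<open>f\<close> respects zero because zero is the scalar 0 times
    itself.\<close>
  have "0 \<odot>\<^bsub>K\<^esub> \<zero>\<^bsub>K\<^esub> = \<zero>\<^bsub>K\<^esub>" by (rule K.h_eqI) (simp_all add: K.cl K.hom)
  then have "f \<zero>\<^bsub>K\<^esub> = 0 \<odot>\<^bsub>?P\<^esub> f \<zero>\<^bsub>K\<^esub>" using f(2)[OF K.zero_cl, of 0] by simp
  also have "\<dots> = \<zero>\<^bsub>?P\<^esub>" using fz by (auto simp: product_alg_simps ops intro!: restrict_ext)
  finally have f0: "f \<zero>\<^bsub>K\<^esub> = \<zero>\<^bsub>?P\<^esub>" .
  define H where "H = (\<lambda>y. h (inv_into (carrier K) f y))"
  interpret P: alg_rep ?P mu C e H
    unfolding H_def by (rule alg_rep_isomorphic[OF K.alg_rep_axioms f f0])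
  show ca: "comm_alg mu C e"
  proof
    fix x y assume "x \<in> C" "y \<in> C"
    then obtain a b where ab: "a \<in> carrier ?P" "b \<in> carrier ?P" "x = H a" "y = H b" using P.h_surj by metis
    then have "a \<otimes>\<^bsub>?P\<^esub> b = b \<otimes>\<^bsub>?P\<^esub> a"
      by (auto simp: product_alg_simps intro!: restrict_ext comm)
    then show "mu x y = mu y x" using ab P.h_mult by metis
  qed
  define inj where "inj i x = (\<lambda>j\<in>{..<n}. if j = i then x else \<zero>\<^bsub>E j\<^esub>)" for i x
  define th where "th i x = H (inj i x)" for i x
  have inj_car: "inj i x \<in> carrier ?P" if "i < n" "x \<in> carrier (E i)" for i x
    using that by (auto simp: inj_def product_alg_simps ops)
  have rep: "alg_rep (E i) mu (th i ` carrier (E i)) (th i \<one>\<^bsub>E i\<^esub>) (th i)" if i: "i < n" for i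
  proof -
    have add: "th i (x \<oplus>\<^bsub>E i\<^esub> y) = th i x + th i y" if "x \<in> carrier (E i)" "y \<in> carrier (E i)" for x y
    proof -
      have "inj i (x \<oplus>\<^bsub>E i\<^esub> y) = inj i x \<oplus>\<^bsub>?P\<^esub> inj i y"
        by (auto simp: inj_def product_alg_simps ops intro!: restrict_ext)
      then show ?thesis using that i by (simp add: th_def P.h_add inj_car)
    qed
    have mult: "th i (x \<otimes>\<^bsub>E i\<^esub> y) = mu (th i x) (th i y)" if "x \<in> carrier (E i)" "y \<in> carrier (E i)" for x y
    proof -
      have "inj i (x \<otimes>\<^bsub>E i\<^esub> y) = inj i x \<otimes>\<^bsub>?P\<^esub> inj i y"
        by (auto simp: inj_def product_alg_simps ops intro!: restrict_ext)
      then show ?thesis using that i by (simp add: th_def P.h_mult inj_car)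
    qed
    have smult: "th i (c \<odot>\<^bsub>E i\<^esub> x) = scl c (th i x)" if "x \<in> carrier (E i)" for c x
    proof -
      have "inj i (c \<odot>\<^bsub>E i\<^esub> x) = c \<odot>\<^bsub>?P\<^esub> inj i x"
        by (auto simp: inj_def product_alg_simps ops intro!: restrict_ext)
      then show ?thesis using that i by (simp add: th_def P.h_smult inj_car)
    qed
    have zero: "th i \<zero>\<^bsub>E i\<^esub> = 0"
    proof -
      have "inj i \<zero>\<^bsub>E i\<^esub> = \<zero>\<^bsub>?P\<^esub>" by (auto simp: inj_def product_alg_simps)
      then show ?thesis by (simp add: th_def P.h_zero)
    qed
    have "inj_on (th i) (carrier (E i))"
    proof (rule inj_onI)
      fix x y assume xy: "x \<in> carrier (E i)" "y \<in> carrier (E i)" "th i x = th i y"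
      then have "inj i x = inj i y" using i by (auto simp: th_def intro!: P.h_eqI inj_car)
      from fun_cong[OF this, of i] show "x = y" using i by (simp add: inj_def)
    qed
    moreover have "V.subspace (th i ` carrier (E i))"
    proof (rule V.subspaceI)
      show "0 \<in> th i ` carrier (E i)" using zero ops(1)[OF i] by (metis imageI)
      fix c x assume x: "x \<in> th i ` carrier (E i)"
      then show "scl c x \<in> th i ` carrier (E i)" using ops i by (auto simp: smult[symmetric])
      fix y assume "y \<in> th i ` carrier (E i)"
      then show "x + y \<in> th i ` carrier (E i)" using x ops i by (auto simp: add[symmetric])
    qed
    ultimately show ?thesis
      by unfold_locales (auto simp: bij_betw_def P.bl ops i add mult smult zero)
  qed
  have thC: "th i ` carrier (E i) \<subseteq> C" if "i < n" for i
    using P.h_mem inj_car that by (auto simp: th_def)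
  have "\<exists>A. finite A \<and> A \<subseteq> carrier (E i) \<and> LinearCombinations.module.span class_ring (E i) A = carrier (E i)"
    if i: "i < n" for i
  proof -
    interpret U: unital_algebra "E i" by (rule ua[OF i])
    show ?thesis using fd[OF i] unfolding U.fin_dim_def by auto
  qed
  then obtain A where A: "\<And>i. i < n \<Longrightarrow> finite (A i)" "\<And>i. i < n \<Longrightarrow> A i \<subseteq> carrier (E i)"
    "\<And>i. i < n \<Longrightarrow> LinearCombinations.module.span class_ring (E i) (A i) = carrier (E i)"
    by metis
  define X where "X = (\<Union>i<n. th i ` A i)"
  have "finite X" using A by (auto simp: X_def)
  moreover have "comm_alg.separable mu C e k" if "k \<in> X" for k
    using that A(2) separable_of_field_element[OF ca rep thC fse] by (auto simp: X_def)
  moreover have "v \<in> V.span X" if v: "v \<in> C" for v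
  proof -
    obtain g where g: "g \<in> carrier ?P" "v = H g" using P.h_surj[OF v] by auto
    have gi: "g i \<in> carrier (E i)" if "i < n" for i using g that by (auto simp: product_alg_simps)
    define G where "G m = (\<lambda>j\<in>{..<n}. if j < m then g j else \<zero>\<^bsub>E j\<^esub>)" for m
    have HG: "m \<le> n \<Longrightarrow> H (G m) = (\<Sum>i<m. th i (g i))" for m
    proof (induction m)
      case 0
      have "G 0 = \<zero>\<^bsub>?P\<^esub>" by (simp add: G_def product_alg_simps)
      then show ?case by (simp add: P.h_zero)
    next
      case (Suc m)
      have "G (Suc m) = G m \<oplus>\<^bsub>?P\<^esub> inj m (g m)"
        using Suc.prems gi by (auto simp: G_def inj_def product_alg_simps ops less_Suc_eq intro!: restrict_ext)
      moreover have "G m \<in> carrier ?P" using gi by (auto simp: G_def product_alg_simps ops)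
      ultimately show ?case using Suc gi by (simp add: P.h_add inj_car th_def)
    qed
    have "G n = g"
      using g by (auto simp: G_def product_alg_simps PiE_def extensional_def fun_eq_iff)
    then have "v = (\<Sum>i<n. th i (g i))" using HG[OF order_refl] g by simp
    moreover have "th i (g i) \<in> V.span X" if i: "i < n" for i
    proof -
      interpret Ei: alg_rep "E i" mu "th i ` carrier (E i)" "th i \<one>\<^bsub>E i\<^esub>" "th i" by (rule rep[OF i])
      have "th i (g i) \<in> V.span (th i ` A i)"
        using Ei.image_span[OF A(2)[OF i]] A(3)[OF i] gi[OF i] by blast
      also have "\<dots> \<subseteq> V.span X" using i by (intro V.span_mono) (auto simp: X_def)
      finally show ?thesis .
    qed
    ultimately show ?thesis by (auto intro: V.span_sum)
  qed
  ultimately show "\<exists>X. finite X \<and> (\<forall>k\<in>X. comm_alg.separable mu C e k) \<and> C \<subseteq> V.span X" by blast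
qed

section \<open>Minimal faithfulness\<close>

lemma (in alg_rep) subgroup_preimage:
  assumes "V.subspace M" shows "subgroup {x \<in> carrier A. h x \<in> M} (add_monoid A)"
  using assms
  by (intro subgroup.intro) (auto simp: hom cl h_neg a_inv_def[symmetric] V.subspace_0 V.subspace_add V.subspace_neg)

text \<open>\<open>bimodule_action\<close> evaluates a chosen representative of the coset; this
  keeps the choice inside the formal pairs from the carriers.\<close>

lemma tensor_alg_representative:
  assumes "alg_rep A mu E e h" "alg_rep B nu E' e' k" and r: "r \<in> carrier (tensor_alg A B)"
  shows "keys (SOME f. f \<in> r) \<subseteq> carrier A \<times> carrier B"
proof -
  let ?R = "relation_space A B"
  have R: "?R = {f \<in> carrier (pair_alg A B). lext (\<lambda>p. tens (h (fst p)) (k (snd p))) f = 0}"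
    by (rule relation_space_eq_kernel) fact+
  obtain g where g: "keys g \<subseteq> carrier A \<times> carrier B" "r = ?R +>\<^bsub>pair_alg A B\<^esub> g"
    using r by (auto simp: tensor_alg_def quot_alg_simps pair_alg_def)
  have add: "add (pair_alg A B) = (+)" and car: "carrier (pair_alg A B) = {f. keys f \<subseteq> carrier A \<times> carrier B}"
    by (simp_all add: pair_alg_def)
  have r_eq: "r = (\<lambda>f. f + g) ` ?R" unfolding g(2) a_r_coset_def' add by blast
  have "0 \<in> ?R" unfolding R car by (simp add: lin_0[OF lin_lext])
  then have "0 + g \<in> r" unfolding r_eq by (rule imageI)
  then have "(SOME f. f \<in> r) \<in> r" by (rule someI)
  then obtain f where f: "f \<in> ?R" "(SOME f. f \<in> r) = f + g" unfolding r_eq by blast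
  then have "keys f \<subseteq> carrier A \<times> carrier B" unfolding R car by simp
  then show ?thesis using f(2) g(1) Poly_Mapping.keys_add[of f g] by auto
qed

text \<open>The elements \<open>x - \<pi> x\<close> together with \<open>C\<close> form a faithful submodule, where \<open>\<pi>\<close> is the
  averaging projection onto the centralizer of \<open>C\<close>: a tensor that kills \<open>1\<close> kills the
  whole centralizer.\<close>
lemma minimally_faithful_avg:
  fixes A :: "('f::field, 'a) module" (structure)
  assumes rep: "alg_rep A mu E e h" and un: "unital_model mu E e" and K: "K \<subseteq> nucleus A"
    and repK: "alg_rep (A\<lparr>carrier := K\<rparr>) mu C e h" and ca: "comm_alg mu C e"
    and sep: "separating mu e C S a b"
    and mf: "minimally_faithful (tensor_alg (A\<lparr>carrier := K\<rparr>) (A\<lparr>carrier := K\<rparr>)) (bimodule A)"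
    and v: "v \<in> E"
  shows "avg mu S a b v \<in> C"
proof -
  interpret A: alg_rep A mu E e h by fact
  interpret U: unital_model mu E e by fact
  interpret C: comm_alg mu C e by fact
  interpret K: alg_rep "A\<lparr>carrier := K\<rparr>" mu C e h by fact
  note bl = A.bl
  have KC: "h x \<in> C" "x \<in> carrier A" if "x \<in> K" for x
    using that K.h_mem A.nucleus_iff K by auto
  have CN: "c \<in> nuc mu E" if "c \<in> C" for c
    using K.h_surj[OF that] A.nucleus_iff K by auto
  have CE: "c \<in> E" if "c \<in> C" for c using CN[OF that] U.nuc_subset by auto
  have S: "finite S" "\<And>i. i \<in> S \<Longrightarrow> a i \<in> C" "\<And>i. i \<in> S \<Longrightarrow> b i \<in> C" "(\<Sum>i\<in>S. mu (a i) (b i)) = e"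
    and bal: "\<And>c. c \<in> C \<Longrightarrow> balanced mu S a b c"
    using sep by (auto simp: separating_def)
  let ?pi = "avg mu S a b"
  note lpi = lin_avg[OF bl, of S a b]
  have piE: "?pi z \<in> E" if "z \<in> E" for z
    unfolding avg_def using that S CE by (intro V.subspace_sum[OF U.sub] U.closed) auto
  \<comment> \<open>Balancing carries \<open>c\<close> from the left factors \<open>a i\<close> to
    the right factors \<open>b i\<close>, where it leaves the sum on the other side.\<close>
  have cent: "mu c (?pi z) = mu (?pi z) c" if c: "c \<in> C" and z: "z \<in> E" for c z
  proof -
    obtain m where m: "\<And>i. i \<in> S \<Longrightarrow> mu c (a i) = (\<Sum>j\<in>S. scl (m j i) (a j))"
      "\<And>i. i \<in> S \<Longrightarrow> mu (b i) c = (\<Sum>j\<in>S. scl (m i j) (b j))"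
      using bal[OF c] by (auto simp: balanced_def)
    have "mu c (?pi z) = (\<Sum>i\<in>S. mu (mu (mu c (a i)) z) (b i))"
      unfolding avg_def C.sums using S CE CN c z U.closed
      by (intro sum.cong refl) (simp add: U.nuc_assoc(1)[OF CN[OF c]])
    also have "\<dots> = (\<Sum>i\<in>S. \<Sum>j\<in>S. scl (m j i) (mu (mu (a j) z) (b i)))"
      by (intro sum.cong refl) (simp add: m C.sums C.scls)
    also have "\<dots> = (\<Sum>j\<in>S. \<Sum>i\<in>S. scl (m j i) (mu (mu (a j) z) (b i)))" by (rule sum.swap)
    also have "\<dots> = (\<Sum>j\<in>S. mu (mu (a j) z) (mu (b j) c))"
      by (intro sum.cong refl) (simp add: m C.sums C.scls)
    also have "\<dots> = (\<Sum>j\<in>S. mu (mu (mu (a j) z) (b j)) c)"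
      using S CE c z U.closed by (intro sum.cong refl) (simp add: U.nuc_assoc(3)[OF CN[OF c]])
    also have "\<dots> = mu (?pi z) c" by (simp add: avg_def C.sums)
    finally show ?thesis .
  qed
  \<comment> \<open>An element that commutes with \<open>C\<close> can be pulled out in front of the
    sum, which leaves \<open>mu y e\<close>.\<close>
  have fix1: "?pi y = y" if y: "y \<in> E" "\<And>c. c \<in> C \<Longrightarrow> mu c y = mu y c" for y
  proof -
    have "?pi y = (\<Sum>i\<in>S. mu y (mu (a i) (b i)))"
      unfolding avg_def using S y CE CN by (intro sum.cong refl) (simp add: U.nuc_assoc(2))
    also have "\<dots> = y" using y by (simp add: C.sums[symmetric] S U.unit_r)
    finally show ?thesis .
  qed
  \<comment> \<open>The action, in coordinates, of the tensor represented by
    \<open>f\<close>.\<close>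
  define rho where "rho f x = (\<Sum>p\<in>keys f. scl (lookup f p) (mu (mu (h (fst p)) x) (h (snd p))))"
    for f :: "'a \<times> 'a \<Rightarrow>\<^sub>0 'f" and x
  have lrho: "lin (rho f)" for f
    unfolding rho_def by (intro lin_setsum lin_scale lin_comp[OF blinD(2)[OF bl] blinD(1)[OF bl]])
  have rhoE: "rho f x \<in> E" if "keys f \<subseteq> K \<times> K" "x \<in> E" for f x
    unfolding rho_def using that KC CE
    by (intro V.subspace_sum[OF U.sub] V.subspace_scale[OF U.sub] U.closed) auto
  have rhoC: "rho f x \<in> C" if "keys f \<subseteq> K \<times> K" "x \<in> C" for f x
    unfolding rho_def using that KC
    by (intro V.subspace_sum[OF C.sub] V.subspace_scale[OF C.sub] C.closed) auto
  \<comment> \<open>As \<open>C\<close> is commutative and nuclear, multiplying on both sides by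
    elements of \<open>C\<close> commutes with a second such operation. So averaging commutes with
    the action, which is \<open>rho_pi\<close>.\<close>
  have swap: "mu (mu k (mu (mu x z) y)) l = mu (mu x (mu (mu k z) l)) y"
    if "k \<in> C" "l \<in> C" "x \<in> C" "y \<in> C" "z \<in> E" for k l x y z
  proof -
    have "mu (mu k (mu (mu x z) y)) l = mu (mu (mu k x) z) (mu y l)"
      using that CE CN U.closed by (simp add: U.nuc_assoc(1)[of k] U.nuc_assoc(3)[of l])
    also have "\<dots> = mu (mu (mu x k) z) (mu l y)" using that by (simp add: C.comm)
    also have "\<dots> = mu (mu x (mu (mu k z) l)) y"
      using that CE CN U.closed by (simp add: U.nuc_assoc(1)[of x] U.nuc_assoc(3)[of y])
    finally show ?thesis .
  qed
  have rho_pi: "rho f (?pi z) = ?pi (rho f z)" if f: "keys f \<subseteq> K \<times> K" and z: "z \<in> E" for f z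
  proof -
    have "rho f (?pi z) = (\<Sum>p\<in>keys f. \<Sum>i\<in>S. scl (lookup f p) (mu (mu (h (fst p)) (mu (mu (a i) z) (b i))) (h (snd p))))"
      by (simp add: rho_def avg_def C.sums V.scale_sum_right)
    also have "\<dots> = (\<Sum>p\<in>keys f. \<Sum>i\<in>S. scl (lookup f p) (mu (mu (a i) (mu (mu (h (fst p)) z) (h (snd p)))) (b i)))"
      using f z S KC by (intro sum.cong refl arg_cong[of _ _ "scl _"] swap) auto
    also have "\<dots> = (\<Sum>p\<in>keys f. scl (lookup f p) (?pi (mu (mu (h (fst p)) z) (h (snd p)))))"
      by (simp add: avg_def V.scale_sum_right)
    also have "\<dots> = ?pi (rho f z)" by (simp add: rho_def lin_sum[OF lpi] lin_scl[OF lpi])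
    finally show ?thesis .
  qed
  \<comment> \<open>Every \<open>z\<close> is \<open>z - ?pi z\<close> plus \<open>?pi z\<close>; in
    \<open>M\<close> the second part is confined to \<open>C\<close>. If \<open>M\<close> contains
    all of \<open>E\<close>, applying \<open>?pi\<close> shows that its values lie in
    \<open>C\<close>.\<close>
  define M where "M = ssum ((\<lambda>x. x - ?pi x) ` E) C"
  have ld: "lin (\<lambda>x. x - ?pi x)" by (intro lin_minus lin_ident lpi)
  have sM: "V.subspace M" unfolding M_def by (intro subspace_ssum lin_image[OF ld] U.sub C.sub)
  have rhoM: "rho f x \<in> M" if f: "keys f \<subseteq> K \<times> K" and x: "x \<in> M" for f x
  proof -
    obtain z c where zc: "z \<in> E" "c \<in> C" "x = (z - ?pi z) + c" using x by (auto simp: M_def ssum_def)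
    then have "rho f x = (rho f z - ?pi (rho f z)) + rho f c"
      using f by (simp add: lin_add[OF lrho] lin_diff[OF lrho] rho_pi)
    then show ?thesis using rhoE[OF f zc(1)] rhoC[OF f zc(2)] by (auto simp: M_def ssum_def)
  qed
  let ?KK = "A\<lparr>carrier := K\<rparr>"
  let ?R = "tensor_alg ?KK ?KK"
  have keysK: "keys (SOME f. f \<in> r) \<subseteq> K \<times> K" if "r \<in> carrier ?R" for r
    using tensor_alg_representative[OF repK repK that] by simp
  have act: "h (bimodule_action A r x) = rho (SOME f. f \<in> r) (h x) \<and> bimodule_action A r x \<in> carrier A"
    if r: "r \<in> carrier ?R" and x: "x \<in> carrier A" for r x
  proof -
    have cl: "lookup f p \<odot> ((fst p \<otimes> x) \<otimes> snd p) \<in> carrier A" if "keys f \<subseteq> K \<times> K" "p \<in> keys f" for f p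
      using that x KC by (intro A.cl) auto
    have k: "fst p \<in> carrier A" "snd p \<in> carrier A" if "p \<in> keys (SOME f. f \<in> r)" for p
      using that keysK[OF r] KC by auto
    have "h (bimodule_action A r x) = rho (SOME f. f \<in> r) (h x)"
      unfolding bimodule_action_def Let_def rho_def using cl[OF keysK[OF r]] k x
      by (simp add: A.h_finsum A.hom A.cl)
    moreover have "bimodule_action A r x \<in> carrier A"
      unfolding bimodule_action_def Let_def using cl[OF keysK[OF r]] by (intro A.finsum_closed) auto
    ultimately show ?thesis by simp
  qed
  define P where "P = {x \<in> carrier A. h x \<in> M}"
  have am: "subgroup X (add_monoid (bimodule A)) \<longleftrightarrow> subgroup X (add_monoid A)" for X
    by (simp add: subgroup_def m_inv_def bimodule_def)
  have smB: "module.smult (bimodule A) = bimodule_action A" and carB: "carrier (bimodule A) = carrier A"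
    and zB: "zero (bimodule A) = \<zero>" and aB: "add (bimodule A) = add A"
    by (simp_all add: bimodule_def)
  have subP: "Module.submodule P ?R (bimodule A)"
  proof (rule Module.submodule.intro)
    show "subgroup P (add_monoid (bimodule A))" unfolding am P_def by (rule A.subgroup_preimage[OF sM])
    show "Module.submodule_axioms P ?R (bimodule A)"
      using act keysK rhoM by (auto simp: Module.submodule_axioms_def smB P_def)
  qed
  have zero_set: "{\<zero>} = {x \<in> carrier A. h x \<in> {0}}"
    using A.zero_cl A.h_zero by (auto intro: A.h_eqI)
  have sub0: "Module.submodule {\<zero>} ?R (bimodule A)"
  proof (rule Module.submodule.intro)
    show "subgroup {\<zero>} (add_monoid (bimodule A))" unfolding am zero_set by (rule A.subgroup_preimage) simp
    show "Module.submodule_axioms {\<zero>} ?R (bimodule A)"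
      using act A.zero_cl by (auto simp: Module.submodule_axioms_def smB A.h_zero lin_0[OF lrho] intro!: A.h_eqI)
  qed
  have zP: "\<zero> \<in> P" using A.zero_cl A.h_zero V.subspace_0[OF sM] by (simp add: P_def)
  have faith: "faithful_module ?R (quot_alg ((bimodule A)\<lparr>carrier := P\<rparr>) {\<zero>})"
    unfolding faithful_module_def
  proof (intro ballI impI)
    let ?B = "(bimodule A)\<lparr>carrier := P\<rparr>"
    fix r assume r: "r \<in> carrier ?R"
      and kill: "\<forall>x\<in>carrier (quot_alg ?B {\<zero>}). r \<odot>\<^bsub>quot_alg ?B {\<zero>}\<^esub> x = \<zero>\<^bsub>quot_alg ?B {\<zero>}\<^esub>"
    define f where "f = (SOME f. f \<in> r)"
    have fK: "keys f \<subseteq> K \<times> K" using keysK[OF r] by (simp add: f_def)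
    \<comment> \<open>The section to be tested is \<open>P\<close> modulo zero, whose elements are
      singletons.\<close>
    have coset: "{\<zero>} +>\<^bsub>?B\<^esub> x = {x}" if "x \<in> carrier A" for x
      using that by (simp add: a_r_coset_def' aB)
    have "rho f (h x) = 0" if x: "x \<in> P" for x
    proof -
      have xA: "x \<in> carrier A" using x by (simp add: P_def)
      have "{x} \<in> carrier (quot_alg ?B {\<zero>})" using x coset[OF xA] by (auto simp: quot_alg_simps)
      then have "r \<odot>\<^bsub>quot_alg ?B {\<zero>}\<^esub> {x} = {\<zero>}" using kill by (simp add: quot_alg_simps(4))
      then have "{bimodule_action A r x} = {\<zero>}"
        using coset act[OF r xA] by (simp add: quot_alg_simps(6) smB)
      then show ?thesis using act[OF r xA] A.h_zero by (simp add: f_def)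
    qed
    then have rho0: "rho f w = 0" if "w \<in> M" "w \<in> E" for w
      using that A.h_surj[of w] by (auto simp: P_def)
    have CM: "c \<in> M" if "c \<in> C" for c
      using that ssum_base(2)[OF lin_image[OF ld U.sub] C.sub] by (simp add: M_def)
    have rho1: "rho f c = mu c (rho f e)" if c: "c \<in> E" "\<And>x. x \<in> C \<Longrightarrow> mu x c = mu c x" for c
      unfolding rho_def C.sums C.scls
    proof (intro sum.cong refl arg_cong[of _ _ "scl _"])
      fix p assume "p \<in> keys f"
      then have p: "h (fst p) \<in> C" "h (snd p) \<in> C" using fK KC by auto
      then show "mu (mu (h (fst p)) c) (h (snd p)) = mu c (mu (mu (h (fst p)) e) (h (snd p)))"
        using c CE CN by (simp add: C.unit_r U.nuc_assoc(2))
    qed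
    \<comment> \<open>Split \<open>w\<close> into \<open>w - ?pi w\<close>, which lies in
      \<open>M\<close>, and \<open>?pi w\<close>, which centralizes \<open>C\<close> and is killed
      because \<open>e\<close> is.\<close>
    have "rho f w = 0" if w: "w \<in> E" for w
    proof -
      have "rho f (?pi w) = mu (?pi w) (rho f e)"
        using rho1[of "?pi w"] piE[OF w] cent[OF _ w] by simp
      also have "rho f e = 0" using rho0[OF CM[OF C.unit] U.unit] .
      finally have 1: "rho f (?pi w) = 0" by (simp add: C.zeros)
      have "w - ?pi w \<in> M"
        using w ssum_base(1)[OF lin_image[OF ld U.sub] C.sub] by (simp add: M_def)
      then have "rho f (w - ?pi w) = 0" using w piE by (intro rho0) (auto intro: V.subspace_diff[OF U.sub])
      then show ?thesis using 1 by (simp add: lin_diff[OF lrho])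
    qed
    then have "bimodule_action A r x = \<zero>" if "x \<in> carrier A" for x
      using act[OF r that] that A.h_mem A.h_zero A.zero_cl by (intro A.h_eqI) (auto simp: f_def)
    moreover have "faithful_module ?R (bimodule A)" using mf by (simp add: minimally_faithful_def)
    ultimately show "r = \<zero>\<^bsub>?R\<^esub>" using r by (simp add: faithful_module_def smB carB zB)
  qed
  \<comment> \<open>\<open>P\<close> modulo zero is a faithful section, so by minimality it is not
    proper.\<close>
  have "P = carrier A"
    using mf faith subP sub0 zP unfolding minimally_faithful_def carB zB by blast
  then have "v \<in> M" using A.h_surj[OF v] by (auto simp: P_def)
  then obtain z c where zc: "z \<in> E" "c \<in> C" "v = (z - ?pi z) + c" by (auto simp: M_def ssum_def)
  have "?pi (?pi z) = ?pi z" using zc piE cent by (intro fix1) auto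
  moreover have "?pi c = c" using zc CE C.comm by (intro fix1) auto
  ultimately have "?pi v = c" by (simp add: zc(3) lin_add[OF lpi] lin_diff[OF lpi])
  then show ?thesis using zc by simp
qed

text \<open>Packages semiassociativity for \<open>nuc_tensor\<close> and \<open>jac_tensor\<close>.
  Coordinates are chosen once, for \<open>A\<close>, and \<open>K\<close> is read in the same
  coordinates, so that its separability idempotent lives in the nucleus of the model.\<close>

lemma semiassociative_model:
  fixes A :: "('f::field, 'a) module"
  assumes "semiassociative A"
  obtains mu E e and h :: "'a \<Rightarrow> ('a \<Rightarrow>\<^sub>0 'f)" and C and S :: "nat set" and a b
  where "alg_rep A mu E e h" "unital_model mu E e" "separating mu e C S a b" "C \<subseteq> nuc mu E"
    "\<And>z. z \<in> nuc mu E \<Longrightarrow> avg mu S a b z \<in> C"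
proof -
  obtain K where ua: "unital_algebra A" and fd: "vectorspace.fin_dim class_ring A" and K: "K \<subseteq> nucleus A"
    "subalgebra_with_one K A" "etale (A\<lparr>carrier := K\<rparr>)"
    "minimally_faithful (tensor_alg (A\<lparr>carrier := K\<rparr>) (A\<lparr>carrier := K\<rparr>)) (bimodule A)"
    using assms by (auto simp: semiassociative_def)
  obtain mu E e and h :: "'a \<Rightarrow> ('a \<Rightarrow>\<^sub>0 'f)" where rep: "alg_rep A mu E e h" and un: "unital_model mu E e"
    using alg_rep_exists[OF ua fd] by blast
  interpret A: alg_rep A mu E e h by fact
  interpret U: unital_model mu E e by fact
  interpret N: assoc_alg mu U.N e by (rule U.assoc_alg_nuc)
  define C where "C = h ` K"
  interpret sK: Module.submodule K class_ring A using K(2) by (simp add: subalgebra_with_one_def)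
  have KA: "K \<subseteq> carrier A" using K(1) A.nucleus_iff by auto
  have Kcl: "x \<oplus>\<^bsub>A\<^esub> y \<in> K" "x \<otimes>\<^bsub>A\<^esub> y \<in> K" "c \<odot>\<^bsub>A\<^esub> x \<in> K" "\<zero>\<^bsub>A\<^esub> \<in> K" "\<one>\<^bsub>A\<^esub> \<in> K"
    if "x \<in> K" "y \<in> K" for x y c
    using that sK.m_closed sK.one_closed sK.smult_closed[of c x] K(2) by (auto simp: subalgebra_with_one_def)
  have one: "\<one>\<^bsub>A\<^esub> \<in> K" using K(2) by (simp add: subalgebra_with_one_def)
  note Kc = subsetD[OF KA]
  have sC: "V.subspace C"
  proof (rule V.subspaceI)
    show "0 \<in> C" using Kcl(4)[OF one one] A.h_zero by (auto simp: C_def intro!: image_eqI[of _ _ "\<zero>\<^bsub>A\<^esub>"])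
    fix c x assume "x \<in> C"
    then show "scl c x \<in> C" using Kcl Kc by (auto simp: C_def A.h_smult[symmetric])
    fix y assume "y \<in> C"
    then show "x + y \<in> C" using \<open>x \<in> C\<close> Kcl Kc by (auto simp: C_def A.h_add[symmetric])
  qed
  have eC: "e \<in> C" using one A.h_one by (auto simp: C_def)
  have cC: "mu x y \<in> C" if "x \<in> C" "y \<in> C" for x y
    using that Kcl Kc by (auto simp: C_def A.h_mult[symmetric])
  have CN: "C \<subseteq> U.N" using K(1) A.nucleus_iff by (auto simp: C_def)
  have repK: "alg_rep (A\<lparr>carrier := K\<rparr>) mu C e h"
    unfolding C_def by (rule A.alg_rep_subalgebra[OF KA]) (use sC eC cC in \<open>auto simp: C_def\<close>)
  have as: "assoc_alg mu C e"
    by unfold_locales (use CN N.unit_l N.unit_r N.assoc N.bl sC eC cC in \<open>auto simp: subset_iff\<close>)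
  note ca = etale_generators(1)[OF repK as K(3)]
  obtain X where X: "finite X" "\<And>k. k \<in> X \<Longrightarrow> comm_alg.separable mu C e k" "C \<subseteq> V.span X"
    using etale_generators(2)[OF repK as K(3)] by blast
  obtain S :: "nat set" and a b where sep: "separating mu e C S a b"
    using comm_alg.separating_exists[OF ca X] by blast
  show ?thesis
  proof (rule that[OF rep un sep CN])
    fix z assume "z \<in> U.N"
    then show "avg mu S a b z \<in> C"
      using minimally_faithful_avg[OF rep un K(1) repK ca sep K(4)] U.nuc_subset by auto
  qed
qed


section \<open>The radical and the semisimple quotient of a tensor product\<close>

lemma exists_complementary_projector:
  fixes J :: "('i \<Rightarrow>\<^sub>0 'f::field) set"
  assumes "V.subspace J"
  obtains p where "lin p" "\<And>x. p x = 0 \<longleftrightarrow> x \<in> J" "\<And>x. x - p x \<in> J"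
proof -
  obtain q where q: "lin q" "\<And>x. q x \<in> J" "\<And>x. x \<in> J \<Longrightarrow> q x = x"
    using exists_projector[OF assms] by blast
  show ?thesis
  proof (rule that[of "\<lambda>x. x - q x"])
    show "lin (\<lambda>x. x - q x)" by (intro lin_minus lin_ident q)
    show "x - q x = 0 \<longleftrightarrow> x \<in> J" for x using q(2)[of x] q(3)[of x] by auto
  qed (simp add: q)
qed

text \<open>As \<open>J\<close> is a two-sided ideal, the product of \<open>p x\<close> and
  \<open>p y\<close> differs from that of \<open>x\<close> and \<open>y\<close> by an element of
  \<open>J\<close>, which \<open>p\<close> kills.\<close>

lemma (in assoc_alg) projected_mult:
  assumes p: "lin p" "\<And>x. p x = 0 \<longleftrightarrow> x \<in> J" "\<And>x. x - p x \<in> J" and xy: "x \<in> N" "y \<in> N"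
  shows "p (p x \<cdot> p y) = p (x \<cdot> y)"
proof -
  have "p x \<in> N" using mem(3)[OF xy(1), of "x - p x"] p(3)[of x] jac_subset by auto
  then have "(x - p x) \<cdot> y + p x \<cdot> (y - p y) \<in> J"
    using p(3) xy jac_right lidealD(5)[OF jac_lideal] by (intro lidealD(3)[OF jac_lideal]) auto
  also have "(x - p x) \<cdot> y + p x \<cdot> (y - p y) = x \<cdot> y - p x \<cdot> p y" by (simp add: distr)
  finally show ?thesis using p by (metis lin_diff eq_iff_diff_eq_0)
qed

lemma alg_rep_nucleus:
  assumes "alg_rep A mu E e h" "unital_model mu E e"
  shows "alg_rep (nucleus_alg A) mu (nuc mu E) e h"
proof -
  interpret A: alg_rep A mu E e h by fact
  interpret U: unital_model mu E e by fact
  show ?thesis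
    using A.alg_rep_subalgebra[of "nucleus A"] A.nucleus_iff U.subspace_nuc U.unit_nuc U.nuc_closed
    by (auto simp: nucleus_alg_def A.image_nucleus)
qed

lemma alg_rep_sigma:
  assumes "alg_rep A mu E e h" "unital_model mu E e" and p: "lin p"
    and ker: "\<And>x. x \<in> nuc mu E \<Longrightarrow> p x = 0 \<longleftrightarrow> x \<in> jac mu (nuc mu E)"
    and mult: "\<And>x y. x \<in> nuc mu E \<Longrightarrow> y \<in> nuc mu E \<Longrightarrow> p (mu (p x) (p y)) = p (mu x y)"
  shows "alg_rep (sigma_alg A) (\<lambda>x y. p (mu x y)) (p ` nuc mu E) (p e) (\<lambda>X. p (h (SOME x. x \<in> X)))"
proof -
  interpret N: alg_rep "nucleus_alg A" mu "nuc mu E" e h by (rule alg_rep_nucleus) fact+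
  have "jacobson_radical (nucleus_alg A) = {x \<in> carrier (nucleus_alg A). p (h x) = 0}"
    using N.jacobson_iff N.h_mem ker by blast
  then show ?thesis
    unfolding sigma_alg_def by (rule alg_rep_projected_quotient[OF N.alg_rep_axioms p _ mult])
qed

theorem proposition13p5:
  fixes A :: "('f::field, 'a) module" and B :: "('f, 'b) module"
  assumes "semiassociative A" and "semiassociative B"
  shows "jacobson_radical (nucleus_alg (tensor_alg A B)) =
           tensor_subspace A B (jacobson_radical (nucleus_alg A)) (nucleus B)
           <+>\<^bsub>tensor_alg A B\<^esub>
           tensor_subspace A B (nucleus A) (jacobson_radical (nucleus_alg B))
         \<and> alg_isomorphic (sigma_alg (tensor_alg A B)) (tensor_alg (sigma_alg A) (sigma_alg B))"
proof -
  obtain mu E e and h :: "'a \<Rightarrow> ('a \<Rightarrow>\<^sub>0 'f)" and C and S :: "nat set" and a b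
    where A: "alg_rep A mu E e h" "unital_model mu E e" "separating mu e C S a b" "C \<subseteq> nuc mu E"
      "\<And>z. z \<in> nuc mu E \<Longrightarrow> avg mu S a b z \<in> C"
    using semiassociative_model[OF assms(1)] by blast
  obtain nu E' e' and k :: "'b \<Rightarrow> ('b \<Rightarrow>\<^sub>0 'f)" and C' and T :: "nat set" and a' b'
    where B: "alg_rep B nu E' e' k" "unital_model nu E' e'" "separating nu e' C' T a' b'" "C' \<subseteq> nuc nu E'"
      "\<And>z. z \<in> nuc nu E' \<Longrightarrow> avg nu T a' b' z \<in> C'"
    using semiassociative_model[OF assms(2)] by blast
  interpret A: unital_model mu E e by fact
  interpret B: unital_model nu E' e' by fact
  interpret NA: assoc_alg mu A.N e by (rule A.assoc_alg_nuc)
  interpret NB: assoc_alg nu B.N e' by (rule B.assoc_alg_nuc)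
  interpret RA: alg_rep "nucleus_alg A" mu A.N e h by (rule alg_rep_nucleus[OF A(1,2)])
  interpret RB: alg_rep "nucleus_alg B" nu B.N e' k by (rule alg_rep_nucleus[OF B(1,2)])
  let ?T = "tensor_alg A B" and ?m = "tmul mu nu" and ?H = "tensor_rep A B h k"
  have repT: "alg_rep ?T ?m (TS E E') (tens e e') ?H" by (rule alg_rep_tensor(1)[OF A(1) B(1)])
  have unT: "unital_model ?m (TS E E') (tens e e')" by (rule unital_model_tensor[OF A(2) B(2)])
  interpret T: alg_rep ?T ?m "TS E E'" "tens e e'" ?H by (rule repT)
  have nucT: "nuc ?m (TS E E') = TS A.N B.N" by (rule nuc_tensor[OF A(2) B(2)])
  interpret RT: alg_rep "nucleus_alg ?T" ?m "TS A.N B.N" "tens e e'" ?H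
    using alg_rep_nucleus[OF repT unT] by (simp add: nucT)
  have jacT: "jac ?m (TS A.N B.N) = ssum (TS NA.J B.N) (TS A.N NB.J)"
    by (rule jac_tensor[OF A.assoc_alg_nuc A(3-5) B.assoc_alg_nuc B(3-5)])
  have nA: "nucleus A \<subseteq> carrier A" "h ` nucleus A = A.N"
    and nB: "nucleus B \<subseteq> carrier B" "k ` nucleus B = B.N"
    using alg_rep.nucleus_iff[OF A(1)] alg_rep.nucleus_iff[OF B(1)]
      alg_rep.image_nucleus[OF A(1)] alg_rep.image_nucleus[OF B(1)] by auto
  have jA: "jacobson_radical (nucleus_alg A) \<subseteq> carrier A" and jB: "jacobson_radical (nucleus_alg B) \<subseteq> carrier B"
    using nA(1) nB(1) by (auto simp: jacobson_radical_def nucleus_alg_def)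
  have sJ: "V.subspace NA.J" "V.subspace NB.J"
    by (intro NA.lideal_subspace NA.jac_lideal NB.lideal_subspace NB.jac_lideal)+
  let ?X = "jacobson_radical (nucleus_alg ?T)"
  let ?Y1 = "tensor_subspace A B (jacobson_radical (nucleus_alg A)) (nucleus B)"
  let ?Y2 = "tensor_subspace A B (nucleus A) (jacobson_radical (nucleus_alg B))"
  have Y1: "?H ` ?Y1 = TS NA.J B.N" "?Y1 \<subseteq> carrier ?T"
    using image_tensor_subspace[OF A(1) B(1) jA _ nB(1)]
    by (simp_all add: RA.image_jacobson nB sJ B.subspace_nuc)
  have Y2: "?H ` ?Y2 = TS A.N NB.J" "?Y2 \<subseteq> carrier ?T"
    using image_tensor_subspace[OF A(1) B(1) nA(1) _ jB]
    by (simp_all add: RB.image_jacobson nA sJ A.subspace_nuc)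
  \<comment> \<open>Both sides lie in the carrier, where \<open>?H\<close> is injective, so it
    suffices to compare their images in the model.\<close>
  have "?H ` ?X = ?H ` (?Y1 <+>\<^bsub>?T\<^esub> ?Y2)"
    by (simp add: RT.image_jacobson jacT T.image_set_add[OF Y1(2) Y2(2)] Y1 Y2)
  moreover have "?X \<subseteq> carrier ?T"
    by (auto simp: jacobson_radical_def nucleus_alg_def nucleus_def)
  moreover have "?Y1 <+>\<^bsub>?T\<^esub> ?Y2 \<subseteq> carrier ?T"
    using Y1(2) Y2(2) T.add_cl by (auto simp: set_add_def' subset_iff)
  ultimately have eq: "?X = ?Y1 <+>\<^bsub>?T\<^esub> ?Y2"
    using T.bij inj_on_image_eq_iff[of ?H "carrier ?T"] by (auto simp: bij_betw_def)
  obtain p where p: "lin p" "\<And>x. p x = 0 \<longleftrightarrow> x \<in> NA.J" "\<And>x. x - p x \<in> NA.J"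
    using exists_complementary_projector[OF sJ(1)] by blast
  obtain q where q: "lin q" "\<And>x. q x = 0 \<longleftrightarrow> x \<in> NB.J" "\<And>x. x - q x \<in> NB.J"
    using exists_complementary_projector[OF sJ(2)] by blast
  have p0: "p x = 0" if "x \<in> NA.J" for x using p(2) that by simp
  have q0: "q x = 0" if "x \<in> NB.J" for x using q(2) that by simp
  note pm = NA.projected_mult[OF p] and qm = NB.projected_mult[OF q]
  \<comment> \<open>\<open>p\<close> and \<open>q\<close> project along the radicals of the factors;
    by \<open>tensor_kernel\<close> and \<open>jacT\<close> the kernel of their tensor product on
    \<open>TS A.N B.N\<close> is the radical of the product.\<close>
  let ?p = "tmap p q"
  note lp = lin_tmap[of p q] and bT = blin_tmul[of mu nu] and tt = tmul_tens[OF A.bl B.bl]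
  have sN: "V.subspace A.N" "V.subspace B.N" by (rule A.subspace_nuc B.subspace_nuc)+
  have kerT: "?p u = 0 \<longleftrightarrow> u \<in> jac ?m (TS A.N B.N)" if u: "u \<in> TS A.N B.N" for u
  proof
    assume "?p u = 0"
    then have "u \<in> ssum (TS NA.J B.N) (TS A.N NB.J)"
      using NA.jac_subset NB.jac_subset p q sN u
      by (intro tensor_kernel[where F = "{p}" and F' = "{q}"]) auto
    then show "u \<in> jac ?m (TS A.N B.N)" by (simp add: jacT)
  next
    assume "u \<in> jac ?m (TS A.N B.N)"
    then obtain v w where vw: "u = v + w" "v \<in> TS NA.J B.N" "w \<in> TS A.N NB.J"
      by (auto simp: jacT ssum_def)
    have "?p v = 0"
      by (rule TS_linear_eq[OF vw(2) sJ(1) sN(2) lp lin_zero]) (simp add: tmap_tens p(1) q(1) p0 lin_0[OF lin_tens(2)])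
    moreover have "?p w = 0"
      by (rule TS_linear_eq[OF vw(3) sN(1) sJ(2) lp lin_zero]) (simp add: tmap_tens p(1) q(1) q0 lin_0[OF lin_tens(1)])
    ultimately show "?p u = 0" by (simp add: vw(1) lin_add[OF lp])
  qed
  have multT: "?p (?m (?p u) (?p v)) = ?p (?m u v)" if u: "u \<in> TS A.N B.N" and v: "v \<in> TS A.N B.N" for u v
  proof (rule TS_linear_eq[OF u sN])
    fix x y assume xy: "x \<in> A.N" "y \<in> B.N"
    show "?p (?m (?p (tens x y)) (?p v)) = ?p (?m (tens x y) v)"
    proof (rule TS_linear_eq[OF v sN])
      fix x' y' assume "x' \<in> A.N" "y' \<in> B.N"
      then show "?p (?m (?p (tens x y)) (?p (tens x' y'))) = ?p (?m (tens x y) (tens x' y'))"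
        using xy by (simp add: tmap_tens p(1) q(1) tt pm qm)
    qed (rule lin_comp[OF lp lin_comp[OF blinD(1)[OF bT] lp]] lin_comp[OF lp blinD(1)[OF bT]])+
  qed (rule lin_comp[OF lp lin_comp[OF blinD(2)[OF bT] lp]] lin_comp[OF lp blinD(2)[OF bT]])+
  have sigT: "alg_rep (sigma_alg ?T) (\<lambda>u v. ?p (?m u v)) (?p ` TS A.N B.N) (?p (tens e e'))
      (\<lambda>X. ?p (?H (SOME x. x \<in> X)))"
    using alg_rep_sigma[OF repT unT lp, unfolded nucT, OF kerT multT] .
  have sigA: "alg_rep (sigma_alg A) (\<lambda>x y. p (mu x y)) (p ` A.N) (p e) (\<lambda>X. p (h (SOME x. x \<in> X)))"
    by (rule alg_rep_sigma[OF A(1,2) p(1)]) (simp_all add: p pm)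
  have sigB: "alg_rep (sigma_alg B) (\<lambda>x y. q (nu x y)) (q ` B.N) (q e') (\<lambda>X. q (k (SOME x. x \<in> X)))"
    by (rule alg_rep_sigma[OF B(1,2) q(1)]) (simp_all add: q qm)
  \<comment> \<open>Projecting in each factor before tensoring agrees with tensoring before
    projecting. This makes the models of the two sides of the isomorphism coincide.\<close>
  have "tmul (\<lambda>x y. p (mu x y)) (\<lambda>x y. q (nu x y)) u v = ?p (?m u v)" for u v
    by (rule blin_eqI[OF blin_tmul blin_lin_comp[OF lp bT]])
      (simp add: tens_sgl[symmetric] tmul_tens blin_lin_comp p(1) q(1) A.bl B.bl tmap_tens split_paired_all)
  then have m: "(\<lambda>u v. ?p (?m u v)) = tmul (\<lambda>x y. p (mu x y)) (\<lambda>x y. q (nu x y))" by (simp add: fun_eq_iff)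
  have "alg_isomorphic (sigma_alg ?T) (tensor_alg (sigma_alg A) (sigma_alg B))"
    by (rule alg_isomorphic_reps[OF sigT[unfolded m tmap_image_TS[OF sN p(1) q(1)] tmap_tens[OF p(1) q(1)]]
        alg_rep_tensor(1)[OF sigA sigB]])
  then show ?thesis using eq by blast
qed

end
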